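(* There is an algorithm that, given integers $n$, $p$, $q$ with $0\le q\le p\le n$, outputs an $(n,p,q)$-set-inclusion-family $\mathcal{C}$ of size at most $\kappa(n,p,q)\cdot 2^{o(n)}$ in time $\kappa(n,p,q)\cdot 2^{o(n)}$, where $\kappa(n,p,q)=\binom{n}{q}/\binom{p}{q}$.
   Context: Let $U$ be a universe of size $n$ and $0\le q\le p\le n$. A family $\mathcal{C}\subseteq\binom{U}{q}$ (subsets of $U$ of size $q$) is an $(n,p,q)$-set-inclusion-family if for every set $S\in\binom{U}{p}$ there exists $Y\in\mathcal{C}$ with $Y\subseteq S$. *)

theory Defs
  imports Complex_Main "HOL-Library.Landau_Symbols" "HOL-Library.Log_Nat"
begin

section \<open>Set-inclusion families\<close>

definition set_inclusion_family ::
  "'a set \<Rightarrow> nat \<Rightarrow> nat \<Rightarrow> nat \<Rightarrow> 'a set set \<Rightarrow> bool"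
where
  "set_inclusion_family U n p q \<C> \<longleftrightarrow>
     finite U \<and> card U = n \<and> q \<le> p \<and> p \<le> n \<and>
     \<C> \<subseteq> {Y. Y \<subseteq> U \<and> card Y = q} \<and>
     (\<forall>S. S \<subseteq> U \<and> card S = p \<longrightarrow> (\<exists>Y\<in>\<C>. Y \<subseteq> S))"

definition kappa :: "nat \<Rightarrow> nat \<Rightarrow> nat \<Rightarrow> real" where
  "kappa n p q = real (n choose q) / real (p choose q)"


section \<open>Random access machines\<close>

text \<open>
  Algorithms are programs of the random access machine of Cook and Reckhow: registers
  indexed by the natural numbers, each holding an unbounded natural number, addition,
  (truncated) subtraction, indirect addressing and a conditional jump. A program is a fixed
  finite list of instructions, so it is uniform in its input.
\<close>

datatype instr =
    Const nat nat      \<comment> \<open>\<open>R\<^sub>i := c\<close>\<close>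
  | Add nat nat nat    \<comment> \<open>\<open>R\<^sub>i := R\<^sub>j + R\<^sub>k\<close>\<close>
  | Sub nat nat nat    \<comment> \<open>\<open>R\<^sub>i := max 0 (R\<^sub>j - R\<^sub>k)\<close>\<close>
  | Load nat nat       \<comment> \<open>\<open>R\<^sub>i := R\<^bsub>R\<^sub>j\<^esub>\<close>\<close>
  | Store nat nat      \<comment> \<open>\<open>R\<^bsub>R\<^sub>i\<^esub> := R\<^sub>j\<close>\<close>
  | Jump nat nat       \<comment> \<open>go to instruction \<open>l\<close> if \<open>R\<^sub>i > 0\<close>\<close>
  | Print nat          \<comment> \<open>append \<open>R\<^sub>i\<close> to the output\<close>

type_synonym ram = "instr list"

text \<open>Program counter, register contents, output written so far.\<close>

type_synonym config = "nat \<times> (nat \<Rightarrow> nat) \<times> nat list"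

fun step :: "instr \<Rightarrow> config \<Rightarrow> config" where
  "step (Const i c) (pc, R, out) = (Suc pc, R(i := c), out)"
| "step (Add i j k) (pc, R, out) = (Suc pc, R(i := R j + R k), out)"
| "step (Sub i j k) (pc, R, out) = (Suc pc, R(i := R j - R k), out)"
| "step (Load i j) (pc, R, out) = (Suc pc, R(i := R (R j)), out)"
| "step (Store i j) (pc, R, out) = (Suc pc, R(R i := R j), out)"
| "step (Jump i l) (pc, R, out) = (if R i > 0 then l else Suc pc, R, out)"
| "step (Print i) (pc, R, out) = (Suc pc, R, out @ [R i])"

text \<open>
  Time is measured by the logarithmic cost criterion: an instruction is charged the bit
  lengths of the numbers it operates on, including indirect addresses. Under the unit cost
  criterion one step could manipulate numbers of exponential bit length.
\<close>

definition bits :: "nat \<Rightarrow> nat" where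
  "bits x = max 1 (floorlog 2 x)"

fun step_cost :: "instr \<Rightarrow> (nat \<Rightarrow> nat) \<Rightarrow> nat" where
  "step_cost (Const i c) R = bits c"
| "step_cost (Add i j k) R = bits (R j) + bits (R k)"
| "step_cost (Sub i j k) R = bits (R j) + bits (R k)"
| "step_cost (Load i j) R = bits (R j) + bits (R (R j))"
| "step_cost (Store i j) R = bits (R i) + bits (R j)"
| "step_cost (Jump i l) R = bits (R i)"
| "step_cost (Print i) R = bits (R i)"

inductive exec :: "ram \<Rightarrow> config \<Rightarrow> nat \<Rightarrow> config \<Rightarrow> bool" for P where
  exec_refl: "exec P c 0 c"
| exec_step: "pc < length P \<Longrightarrow> exec P (step (P ! pc) (pc, R, out)) t c
    \<Longrightarrow> exec P (pc, R, out) (step_cost (P ! pc) R + t) c"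

definition init_regs :: "nat list \<Rightarrow> nat \<Rightarrow> nat" where
  "init_regs xs i = (if i < length xs then xs ! i else 0)"

text \<open>
  \<open>ram_outputs P xs ys t\<close>: on input \<open>xs\<close>, placed in the first registers, \<open>P\<close> halts
  (by leaving its instruction list) after time \<open>t\<close> and has printed \<open>ys\<close>.
\<close>

definition ram_outputs :: "ram \<Rightarrow> nat list \<Rightarrow> nat list \<Rightarrow> nat \<Rightarrow> bool" where
  "ram_outputs P xs ys t \<longleftrightarrow>
     (\<exists>pc R. exec P (0, init_regs xs, []) t (pc, R, ys) \<and> length P \<le> pc)"

lemma exec_halt_unique:
  assumes "exec P c t c1" and "exec P c t' c2"
    and "length P \<le> fst c1" and "length P \<le> fst c2"
  shows "t = t' \<and> c1 = c2"
  using assms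
proof (induction arbitrary: t' rule: exec.induct)
  case (exec_refl c)
  from exec_refl(1) show ?case
    using exec_refl(2-) by cases auto
next
  case (exec_step pc R out t c)
  from exec_step.prems(1) show ?case
  proof cases
    case exec_refl
    then show ?thesis using exec_step by auto
  next
    case (exec_step s)
    then show ?thesis using exec_step.IH exec_step.prems by auto
  qed
qed

lemma ram_outputs_unique:
  "ram_outputs P xs ys t \<Longrightarrow> ram_outputs P xs ys' t' \<Longrightarrow> ys = ys' \<and> t = t'"
  unfolding ram_outputs_def by (auto dest: exec_halt_unique)

text \<open>
  A family of sets of positive integers is written as a list of its members, each one as a
  list of its elements terminated by \<open>0\<close>. A member may be listed several times; the number
  of listed sets is at most the running time of the program that prints them.
\<close>

definition lists_family :: "nat list \<Rightarrow> nat set set \<Rightarrow> bool" where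
  "lists_family xs \<C> \<longleftrightarrow>
     (\<exists>Ys. xs = concat (map (\<lambda>Y. Y @ [0]) Ys) \<and>
           (\<forall>Y\<in>set Ys. distinct Y \<and> 0 \<notin> set Y) \<and>
           \<C> = set ` set Ys)"

end

theory Submission
  imports Defs "HOL-Library.Nat_Bijection" "HOL-Real_Asymp.Real_Asymp"
begin

text \<open>
  Cut the universe, padded by less than one block, into \<open>m \<approx> n / b\<close> blocks of size \<open>b \<approx> log n\<close>.
  Inside a block, greedy set cover finds families \<open>F P Q\<close> of size at most
  \<open>kappa b P Q * (b + 1)\<close> by brute force in time polynomial in \<open>n\<close>. For a set \<open>S\<close> with profile
  \<open>P\<^sub>i = card (S \<inter> block i)\<close>, Vandermonde's identity and a comparison of ratios give a
  split \<open>q = \<Sum> Q\<^sub>i\<close> for which the product of the \<open>kappa b P\<^sub>i Q\<^sub>i\<close> is at most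
  \<open>kappa (m b) p q\<close>, so the products of the block families over all profiles and all splits of
  small cost form an inclusion family. There are only \<open>(b + 1)^(2 m) = 2^(o(n))\<close> profiles and splits,
  and the cost threshold is found by trying
  \<open>0, 1, 2, \<dots>\<close> in turn.

  The machine program is written in a language whose arithmetic is limited to increments and
  truncated subtraction. Hence no number exceeds the input plus the number of steps, and the
  logarithmic cost is at most the number of steps times \<open>O(n)\<close>.
\<close>

section \<open>A loop language and its compilation to random access machines\<close>

text \<open>Greedy set cover on the whole universe would give a family of the right size, but its
  search takes time exponential in \<open>n\<close> however small \<open>kappa n p q\<close> is.
  Blocks of logarithmic size make this search polynomial, and a loss polynomial in \<open>b\<close>
  per block is affordable because there are only about \<open>n / log n\<close> blocks. The
  remaining obstacle is that the time must be linear in \<open>kappa n p q\<close>, a number that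
  the program never computes. Block families are therefore measured by a power of two within a
  factor 2 of their size: the product of the sizes over the blocks is then bounded through a sum of
  exponents, which a program with increments can handle, and the rounding costs only
  \<open>2^m\<close>. The existence of a cheap split for every profile bounds the threshold at which
  the search ends. Among the printing loops, those of length \<open>2^W\<close> are never nested in
  each other, which makes the time linear in \<open>2^W\<close>.\<close>

text \<open>\<open>For x y z c\<close> runs \<open>c\<close> with \<open>x = 0, 1, \<dots>\<close> while \<open>x\<close> is below both \<open>y\<close> and \<open>z\<close>. The second bound \<open>z\<close> is a cap:
  if the caps of a program are never assigned, their initial values bound its cost.\<close>

datatype com =
    Skip
  | Set nat nat
  | Mov nat nat
  | Inc nat
  | Sb nat nat nat
  | Get nat nat nat
  | Put nat nat nat
  | Out nat
  | Seq com com (infixr ";;" 60)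
  | If nat com com
  | For nat nat nat com

record st =
  vr :: "nat \<Rightarrow> nat"
  ar :: "nat \<Rightarrow> nat \<Rightarrow> nat"
  ot :: "nat list"

abbreviation upd :: "nat \<Rightarrow> nat \<Rightarrow> st \<Rightarrow> st" where
  "upd x v s \<equiv> s\<lparr>vr := (vr s)(x := v)\<rparr>"

primrec iter :: "nat \<Rightarrow> (st \<Rightarrow> st) \<Rightarrow> st \<Rightarrow> nat \<Rightarrow> st" where
  "iter x f s 0 = upd x 0 s"
| "iter x f s (Suc k) = upd x (Suc k) (f (iter x f s k))"

text \<open>The number of rounds of a loop is fixed on entry, although the compiled loop compares
  its counter with both bounds in every round. The two views agree under \<open>wf\<close>, where
  the body assigns neither the counter nor the bounds.\<close>

primrec sem :: "com \<Rightarrow> st \<Rightarrow> st" where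
  "sem Skip = (\<lambda>s. s)"
| "sem (Set x c) = (\<lambda>s. upd x c s)"
| "sem (Mov x y) = (\<lambda>s. upd x (vr s y) s)"
| "sem (Inc x) = (\<lambda>s. upd x (Suc (vr s x)) s)"
| "sem (Sb x y z) = (\<lambda>s. upd x (vr s y - vr s z) s)"
| "sem (Get x a y) = (\<lambda>s. upd x (ar s a (vr s y)) s)"
| "sem (Put a y x) = (\<lambda>s. s\<lparr>ar := (ar s)(a := (ar s a)(vr s y := vr s x))\<rparr>)"
| "sem (Out x) = (\<lambda>s. s\<lparr>ot := ot s @ [vr s x]\<rparr>)"
| "sem (c ;; d) = (\<lambda>s. sem d (sem c s))"
| "sem (If x c d) = (\<lambda>s. if vr s x > 0 then sem c s else sem d s)"
| "sem (For x y z c) = (\<lambda>s. iter x (sem c) s (min (vr s y) (vr s z)))"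

text \<open>Assigning a constant is charged its value, so that values grow by at most one per step.\<close>

primrec steps :: "com \<Rightarrow> st \<Rightarrow> nat" where
  "steps Skip = (\<lambda>s. 0)"
| "steps (Set x c) = (\<lambda>s. Suc c)"
| "steps (Mov x y) = (\<lambda>s. 1)"
| "steps (Inc x) = (\<lambda>s. 1)"
| "steps (Sb x y z) = (\<lambda>s. 1)"
| "steps (Get x a y) = (\<lambda>s. 1)"
| "steps (Put a y x) = (\<lambda>s. 1)"
| "steps (Out x) = (\<lambda>s. 1)"
| "steps (c ;; d) = (\<lambda>s. steps c s + steps d (sem c s))"
| "steps (If x c d) = (\<lambda>s. Suc (if vr s x > 0 then steps c s else steps d s))"
| "steps (For x y z c) =
     (\<lambda>s. Suc (\<Sum>k<min (vr s y) (vr s z). Suc (steps c (iter x (sem c) s k))))"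

primrec modv :: "com \<Rightarrow> nat set" where
  "modv Skip = {}"
| "modv (Set x c) = {x}"
| "modv (Mov x y) = {x}"
| "modv (Inc x) = {x}"
| "modv (Sb x y z) = {x}"
| "modv (Get x a y) = {x}"
| "modv (Put a y x) = {}"
| "modv (Out x) = {}"
| "modv (c ;; d) = modv c \<union> modv d"
| "modv (If x c d) = modv c \<union> modv d"
| "modv (For x y z c) = insert x (modv c)"

fun moda :: "com \<Rightarrow> nat set" where
  "moda (Put a y x) = {a}"
| "moda (c ;; d) = moda c \<union> moda d"
| "moda (If x c d) = moda c \<union> moda d"
| "moda (For x y z c) = moda c"
| "moda _ = {}"

fun silent :: "com \<Rightarrow> bool" where
  "silent (Out x) = False"
| "silent (c ;; d) = (silent c \<and> silent d)"
| "silent (If x c d) = (silent c \<and> silent d)"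
| "silent (For x y z c) = silent c"
| "silent _ = True"

text \<open>Variables live in registers below 60, and entry \<open>i\<close> of array \<open>a < 16\<close> in register
  \<open>64 + 16 i + a\<close>; registers 60 and 61 are scratch, 62 holds 1 and 63 holds 0.\<close>

primrec wf :: "com \<Rightarrow> bool" where
  "wf Skip = True"
| "wf (Set x c) = (x < 60)"
| "wf (Mov x y) = (x < 60 \<and> y < 60)"
| "wf (Inc x) = (x < 60)"
| "wf (Sb x y z) = (x < 60 \<and> y < 60 \<and> z < 60)"
| "wf (Get x a y) = (x < 60 \<and> a < 16 \<and> y < 60)"
| "wf (Put a y x) = (x < 60 \<and> a < 16 \<and> y < 60)"
| "wf (Out x) = (x < 60)"
| "wf (c ;; d) = (wf c \<and> wf d)"
| "wf (If x c d) = (x < 60 \<and> wf c \<and> wf d)"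
| "wf (For x y z c) = (x < 60 \<and> y < 60 \<and> z < 60 \<and> x \<noteq> y \<and> x \<noteq> z \<and>
     x \<notin> modv c \<and> y \<notin> modv c \<and> z \<notin> modv c \<and> wf c)"

section \<open>Frame properties and growth of values\<close>

lemma vr_iter_frame:
  assumes "\<And>s. vr (f s) v = vr s v" "v \<noteq> x"
  shows "vr (iter x f s k) v = vr s v"
  using assms by (induction k) auto

lemma vr_iter_index: "vr (iter x f s k) x = k"
  by (cases k) auto

lemma vr_frame: "x \<notin> modv c \<Longrightarrow> vr (sem c s) x = vr s x"
  by (induction c arbitrary: s) (auto simp: vr_iter_frame)

lemma ar_frame: "a \<notin> moda c \<Longrightarrow> ar (sem c s) a = ar s a"
proof (induction c arbitrary: s)
  case (For x y z c)
  have "ar (iter x (sem c) s k) a = ar s a" for k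
    using For by (induction k) auto
  then show ?case by simp
qed auto

lemma ot_frame: "silent c \<Longrightarrow> ot (sem c s) = ot s"
proof (induction c arbitrary: s)
  case (For x y z c)
  have "ot (iter x (sem c) s k) = ot s" for k
    using For by (induction k) auto
  then show ?case by simp
qed auto

text \<open>Every printed number costs a step; in the end this bounds the size of the family by the
  running time.\<close>

lemma length_ot_le_steps: "length (ot (sem c s)) \<le> length (ot s) + steps c s"
proof (induction c arbitrary: s)
  case (Seq c d)
  from Seq(1)[of s] Seq(2)[of "sem c s"] show ?case by simp
next
  case (For x y z c)
  have "length (ot (iter x (sem c) s k)) \<le>
      length (ot s) + (\<Sum>j<k. Suc (steps c (iter x (sem c) s j)))" for k
  proof (induction k)
    case (Suc k)
    with For[of "iter x (sem c) s k"] show ?case by simp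
  qed simp
  from this[of "min (vr s y) (vr s z)"] show ?case by simp
next
  case (If x c d)
  then show ?case by (simp add: le_SucI)
qed auto

definition bounded :: "nat \<Rightarrow> st \<Rightarrow> bool" where
  "bounded M s \<longleftrightarrow> (\<forall>v<60. vr s v \<le> M) \<and> (\<forall>a<16. \<forall>i. ar s a i \<le> M)"

lemma bounded_mono: "bounded M s \<Longrightarrow> M \<le> M' \<Longrightarrow> bounded M' s"
  unfolding bounded_def by (meson le_trans)

lemma bounded_upd: "bounded M s \<Longrightarrow> v \<le> M \<Longrightarrow> bounded M (upd x v s)"
  unfolding bounded_def by auto

lemma bounded_iter:
  assumes "\<And>M s. bounded M s \<Longrightarrow> bounded (M + steps c s) (sem c s)" "bounded M s" "k \<le> M"
  shows "bounded (M + (\<Sum>j<k. Suc (steps c (iter x (sem c) s j)))) (iter x (sem c) s k)"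
  using assms(3)
proof (induction k)
  case 0
  then show ?case using assms by (auto intro: bounded_upd)
next
  case (Suc k)
  let ?s = "iter x (sem c) s k" and ?T = "\<Sum>j<k. Suc (steps c (iter x (sem c) s j))"
  have "bounded (M + ?T + steps c ?s) (sem c ?s)"
    using Suc assms by simp
  then show ?case using Suc.prems
    by (auto intro!: bounded_upd elim: bounded_mono)
qed

text \<open>A step raises the largest value by at most one: only increments, loop counters and
  constants create new values, and a constant is charged its value.\<close>

lemma bounded_sem:
  assumes "wf c" "bounded M s"
  shows "bounded (M + steps c s) (sem c s)"
  using assms
proof (induction c arbitrary: M s)
  case (Seq c d)
  from Seq(2)[OF _ Seq(1)[OF _ Seq(4)]] Seq(3) show ?case by (simp add: add.assoc)
next
  case (For x y z c)
  have "bounded (M + (\<Sum>j<min (vr s y) (vr s z). Suc (steps c (iter x (sem c) s j))))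
      (iter x (sem c) s (min (vr s y) (vr s z)))"
    using For.prems by (intro bounded_iter For.IH) (auto simp: bounded_def min_le_iff_disj)
  then show ?case by (auto elim: bounded_mono)
next
  case (If x c d)
  have "bounded (M + steps c s) (sem c s)" "bounded (M + steps d s) (sem d s)"
    using If by auto
  then show ?case by (auto elim: bounded_mono)
qed (auto simp: bounded_def le_SucI trans_le_add1)

section \<open>Compilation and its simulation on the machine\<close>

fun clen :: "com \<Rightarrow> nat" where
  "clen Skip = 0"
| "clen (Get x a y) = 7"
| "clen (Put a y x) = 7"
| "clen (c ;; d) = clen c + clen d"
| "clen (If x c d) = clen c + clen d + 2"
| "clen (For x y z c) = clen c + 9"
| "clen _ = 1"

text \<open>Four doublings replace a multiplication by 16; the address is left in scratch register
  60.\<close>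

definition address :: "nat \<Rightarrow> nat \<Rightarrow> ram" where
  "address a y = [Const 61 (64 + a), Add 60 y y, Add 60 60 60, Add 60 60 60, Add 60 60 60,
     Add 60 60 61]"

text \<open>Jump targets are absolute, hence the start address as an argument.
  \<open>Jump 62\<close> is an unconditional jump, adding register 63 copies a value, and since only
  positivity can be tested, \<open>x < y\<close> is tested through the truncated difference
  \<open>y - x\<close>.\<close>

primrec comp :: "com \<Rightarrow> nat \<Rightarrow> ram" where
  "comp Skip = (\<lambda>l. [])"
| "comp (Set x c) = (\<lambda>l. [Const x c])"
| "comp (Mov x y) = (\<lambda>l. [Add x y 63])"
| "comp (Inc x) = (\<lambda>l. [Add x x 62])"
| "comp (Sb x y z) = (\<lambda>l. [Sub x y z])"
| "comp (Get x a y) = (\<lambda>l. address a y @ [Load x 60])"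
| "comp (Put a y x) = (\<lambda>l. address a y @ [Store 60 x])"
| "comp (Out x) = (\<lambda>l. [Print x])"
| "comp (c ;; d) = (\<lambda>l. comp c l @ comp d (l + clen c))"
| "comp (If x c d) = (\<lambda>l. Jump x (l + clen d + 2) # comp d (l + 1) @
     Jump 62 (l + clen d + clen c + 2) # comp c (l + clen d + 2))"
| "comp (For x y z c) = (\<lambda>l. [Const x 0, Sub 60 y x, Jump 60 (l + 4), Jump 62 (l + clen c + 9),
     Sub 60 z x, Jump 60 (l + 7), Jump 62 (l + clen c + 9)] @ comp c (l + 7) @
     [Add x x 62, Jump 62 (l + 1)])"

lemma length_comp: "length (comp c l) = clen c"
  by (induction c arbitrary: l) (auto simp: address_def)

definition code_at :: "ram \<Rightarrow> nat \<Rightarrow> ram \<Rightarrow> bool" where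
  "code_at P l C \<longleftrightarrow> (\<exists>A B. P = A @ C @ B \<and> length A = l)"

lemma code_at_append:
  "code_at P l (C @ D) \<longleftrightarrow> code_at P l C \<and> code_at P (l + length C) D"
proof
  assume "code_at P l (C @ D)"
  then obtain A B where AB: "P = A @ C @ D @ B" "length A = l"
    unfolding code_at_def by auto
  then have "P = (A @ C) @ D @ B" "length (A @ C) = l + length C" by auto
  with AB show "code_at P l C \<and> code_at P (l + length C) D"
    unfolding code_at_def by blast
next
  assume "code_at P l C \<and> code_at P (l + length C) D"
  then obtain A B A' B' where *: "P = A @ C @ B" "length A = l"
      "P = A' @ D @ B'" "length A' = l + length C"
    unfolding code_at_def by blast
  then have "(A @ C) @ B = A' @ (D @ B')" "length (A @ C) = length A'" by simp_all
  then have "A @ C = A'" "B = D @ B'"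
    using append_eq_append_conv[of "A @ C" A' B "D @ B'"] by blast+
  with * show "code_at P l (C @ D)"
    unfolding code_at_def by (metis append.assoc)
qed

lemma code_at_Cons:
  "code_at P l (i # D) \<longleftrightarrow> l < length P \<and> P ! l = i \<and> code_at P (Suc l) D"
proof -
  have "code_at P l [i] \<longleftrightarrow> l < length P \<and> P ! l = i"
  proof
    assume "l < length P \<and> P ! l = i"
    then have "P = take l P @ [i] @ drop (Suc l) P" "length (take l P) = l"
      using id_take_nth_drop[of l P] by auto
    then show "code_at P l [i]" unfolding code_at_def by blast
  qed (auto simp: code_at_def nth_append)
  then show ?thesis using code_at_append[of P l "[i]" D] by simp
qed

lemma exec_trans: "exec P c t c' \<Longrightarrow> exec P c' t' c'' \<Longrightarrow> exec P c (t + t') c''"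
  by (induction rule: exec.induct) (auto simp: add.assoc intro: exec.intros)

lemma bits_mono: "x \<le> y \<Longrightarrow> bits x \<le> bits y"
  unfolding bits_def using floorlog_mono[of x y 2] by linarith

definition reaches :: "ram \<Rightarrow> nat \<Rightarrow> config \<Rightarrow> config \<Rightarrow> bool" where
  "reaches P T c c' \<longleftrightarrow> (\<exists>t\<le>T. exec P c t c')"

lemma reaches_refl: "reaches P T c c"
  unfolding reaches_def using exec_refl by blast

lemma reaches_trans: "reaches P T c c' \<Longrightarrow> reaches P T' c' c'' \<Longrightarrow> T + T' \<le> S \<Longrightarrow> reaches P S c c''"
  unfolding reaches_def by (meson exec_trans add_mono le_trans)

lemma reaches_step:
  assumes "pc < length P" "P ! pc = i" "step_cost i R \<le> K" "reaches P T (step i (pc, R, out)) c"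
    "K + T \<le> S"
  shows "reaches P S (pc, R, out) c"
  using assms exec_step[of pc P R out] unfolding reaches_def
  by (metis add_mono_thms_linordered_semiring(1) le_trans)

lemma reaches_mono: "reaches P T c c' \<Longrightarrow> T \<le> T' \<Longrightarrow> reaches P T' c c'"
  unfolding reaches_def using le_trans by blast

lemma reaches_single:
  assumes "pc < length P" "P ! pc = i" "step i (pc, R, out) = c" "step_cost i R \<le> K"
  shows "reaches P K (pc, R, out) c"
  using reaches_step[of pc P i R K 0 out c K] assms reaches_refl by auto

lemma bits_le_twice: "x \<le> y \<Longrightarrow> bits x \<le> 2 * bits y"
  using bits_mono[of x y] by simp

lemma bits_add_le_twice: "x \<le> z \<Longrightarrow> y \<le> z \<Longrightarrow> bits x + bits y \<le> 2 * bits z"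
  using bits_mono[of x z] bits_mono[of y z] by simp

text \<open>The largest number involved is the final address, at most \<open>16 * M + 79\<close>;
  the bound \<open>16 * M + 100\<close> leaves room for it and fixes a uniform instruction
  cost.\<close>

lemma address_correct:
  assumes "code_at P l (address a y)" "y < 60" "a < 16" "R y \<le> M"
  shows "reaches P (6 * (2 * bits (16 * M + 100))) (l, R, out)
    (l + 6, R(61 := 64 + a, 60 := 64 + 16 * R y + a), out)"
proof -
  let ?K = "2 * bits (16 * M + 100)"
  have K: "bits u + bits v \<le> ?K" if "u \<le> 16 * M + 100" "v \<le> 16 * M + 100" for u v
    using that by (rule bits_add_le_twice)
  have K1: "bits (64 + a) \<le> ?K" using assms by (intro bits_le_twice) simp
  let ?R = "R(61 := 64 + a)"
  have c: "l < length P" "P ! l = Const 61 (64 + a)"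
    "l + 1 < length P" "P ! (l + 1) = Add 60 y y"
    "l + 2 < length P" "P ! (l + 2) = Add 60 60 60"
    "l + 3 < length P" "P ! (l + 3) = Add 60 60 60"
    "l + 4 < length P" "P ! (l + 4) = Add 60 60 60"
    "l + 5 < length P" "P ! (l + 5) = Add 60 60 61"
    using assms(1) by (auto simp: address_def code_at_Cons eval_nat_numeral)
  have 1: "reaches P ?K (l, R, out) (l + 1, ?R, out)"
    using c K1 by (intro reaches_single) auto
  have 2: "reaches P ?K (l + 1, ?R, out) (l + 2, ?R(60 := 2 * R y), out)"
    using c K[of "R y" "R y"] assms by (intro reaches_single) (auto simp: mult_2)
  have 3: "reaches P ?K (l + 2, ?R(60 := 2 * R y), out) (l + 3, ?R(60 := 4 * R y), out)"
    using c K[of "2 * R y" "2 * R y"] assms by (intro reaches_single) auto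
  have 4: "reaches P ?K (l + 3, ?R(60 := 4 * R y), out) (l + 4, ?R(60 := 8 * R y), out)"
    using c K[of "4 * R y" "4 * R y"] assms by (intro reaches_single) auto
  have 5: "reaches P ?K (l + 4, ?R(60 := 8 * R y), out) (l + 5, ?R(60 := 16 * R y), out)"
    using c K[of "8 * R y" "8 * R y"] assms by (intro reaches_single) auto
  have 6: "reaches P ?K (l + 5, ?R(60 := 16 * R y), out) (l + 6, ?R(60 := 64 + 16 * R y + a), out)"
    using c K[of "16 * R y" "64 + a"] assms by (intro reaches_single) (auto simp: algebra_simps)
  have t: "reaches P (k + ?K) c c''" if "reaches P k c c'" "reaches P ?K c' c''" for k c c' c''
    using that by (rule reaches_trans) simp
  from t[OF t[OF t[OF t[OF t[OF 1 2] 3] 4] 5] 6] show ?thesis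
    by (rule reaches_mono) simp
qed

definition represents :: "(nat \<Rightarrow> nat) \<Rightarrow> st \<Rightarrow> bool" where
  "represents R s \<longleftrightarrow> (\<forall>v<60. R v = vr s v) \<and> (\<forall>a<16. \<forall>i. R (64 + 16 * i + a) = ar s a i) \<and>
     R 62 = 1 \<and> R 63 = 0"

lemma represents_upd:
  assumes "represents R s" "x < 60"
  shows "represents (R(x := v)) (upd x v s)"
  using assms unfolding represents_def by auto

lemma represents_scratch:
  assumes "represents R s" "x = 60 \<or> x = 61"
  shows "represents (R(x := v)) s"
  using assms unfolding represents_def by auto

text \<open>As \<open>a < 16\<close>, the register number determines both array and index, so a
  write changes one entry and no register below 64.\<close>

lemma represents_put:
  assumes "represents R s" "a < 16"
  shows "represents (R(64 + 16 * i + a := v)) (s\<lparr>ar := (ar s)(a := (ar s a)(i := v))\<rparr>)"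
proof -
  have "64 + 16 * j + a' = 64 + 16 * i + a \<longleftrightarrow> j = i \<and> a' = a" if "a' < 16" for j a'
    using that assms(2) by presburger
  then show ?thesis using assms unfolding represents_def by auto
qed


lemma reaches_basic:
  assumes "pc < length P" "P ! pc = i" "step_cost i R \<le> K" "step i (pc, R, out) = c" "n \<ge> 8"
  shows "reaches P (n * K) (pc, R, out) c"
  using reaches_mono[OF reaches_single[OF assms(1,2,4,3)], of "n * K"] assms(5)
    mult_le_mono1[of 1 n K] by simp

text \<open>Eight instructions per step suffice: an array access takes seven, a loop round six
  besides its body, entering and leaving a loop together at most six. While \<open>A\<close> grows
  along the run, \<open>M\<close> bounds all values up to its end and keeps the instruction cost
  \<open>K\<close> fixed.\<close>

lemma comp_correct:
  assumes "wf c" "code_at P l (comp c l)" "represents R s" "bounded A s"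
    "A + steps c s \<le> M"
  defines "K \<equiv> 2 * bits (16 * M + 100)"
  shows "\<exists>R'. represents R' (sem c s) \<and>
    reaches P (8 * steps c s * K) (l, R, ot s) (l + clen c, R', ot (sem c s))"
  using assms(1-5)
proof (induction c arbitrary: l R s A)
  case Skip
  then show ?case by (auto intro: reaches_refl)
next
  case (Set x c)
  have "bits c \<le> K" unfolding K_def using Set.prems by (intro bits_le_twice) auto
  then show ?case using Set.prems
    by (auto simp: code_at_Cons fun_upd_def[symmetric] intro!: exI[of _ "R(x := c)"] represents_upd
        reaches_basic)
next
  case (Mov x y)
  have "bits (R y) + bits (R 63) \<le> K"
    unfolding K_def using Mov.prems
    by (intro bits_add_le_twice) (auto simp: represents_def bounded_def)
  moreover have "R y + R 63 = vr s y"
    using Mov.prems by (auto simp: represents_def)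
  ultimately show ?case using Mov.prems
    by (auto simp: code_at_Cons fun_upd_def[symmetric] intro!: exI[of _ "R(x := vr s y)"] represents_upd reaches_basic)
next
  case (Inc x)
  have "bits (R x) + bits (R 62) \<le> K"
    unfolding K_def using Inc.prems
    by (intro bits_add_le_twice) (auto simp: represents_def bounded_def)
  moreover have "R x + R 62 = Suc (vr s x)"
    using Inc.prems by (auto simp: represents_def)
  ultimately show ?case using Inc.prems
    by (auto simp: code_at_Cons fun_upd_def[symmetric] intro!: exI[of _ "R(x := Suc (vr s x))"] represents_upd
        reaches_basic)
next
  case (Sb x y z)
  have "bits (R y) + bits (R z) \<le> K"
    unfolding K_def using Sb.prems
    by (intro bits_add_le_twice) (auto simp: represents_def bounded_def)
  moreover have "R y - R z = vr s y - vr s z"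
    using Sb.prems by (auto simp: represents_def)
  ultimately show ?case using Sb.prems
    by (auto simp: code_at_Cons fun_upd_def[symmetric] intro!: exI[of _ "R(x := vr s y - vr s z)"] represents_upd
        reaches_basic)
next
  case (Out x)
  have "bits (R x) \<le> K"
    unfolding K_def using Out.prems
    by (intro bits_le_twice) (auto simp: represents_def bounded_def)
  moreover have "R x = vr s x"
    using Out.prems by (auto simp: represents_def)
  ultimately show ?case using Out.prems
    by (auto simp: code_at_Cons represents_def intro!: exI[of _ R] reaches_basic)
next
  case (Get x a y)
  define R1 where "R1 = R(61 := 64 + a, 60 := 64 + 16 * vr s y + a)"
  have y: "R y = vr s y" "vr s y \<le> M" and a: "a < 16" "x < 60"
    using Get.prems by (auto simp: represents_def bounded_def intro: le_trans)
  have r1: "represents R1 s"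
    unfolding R1_def using Get.prems by (intro represents_scratch) auto
  have ad: "reaches P (6 * K) (l, R, ot s) (l + 6, R1, ot s)"
    unfolding R1_def K_def using address_correct[of P l a y R M "ot s"] Get.prems y a
    by (auto simp: code_at_append)
  have R60: "R1 60 = 64 + 16 * vr s y + a" by (simp add: R1_def)
  have v: "R1 (R1 60) = ar s a (vr s y)"
    unfolding R60 using r1 a by (simp add: represents_def)
  have "ar s a (vr s y) \<le> A" using Get.prems(4) a by (simp add: bounded_def)
  then have v2: "ar s a (vr s y) \<le> M" using Get.prems(5) by simp
  have "bits (R1 60) + bits (R1 (R1 60)) \<le> K"
    unfolding K_def v using v2 y a by (intro bits_add_le_twice) (auto simp: R60)
  then have "reaches P K (l + 6, R1, ot s) (l + 7, R1(x := ar s a (vr s y)), ot s)"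
    using Get.prems v
    by (intro reaches_single[of _ _ "Load x 60"]) (auto simp: code_at_append code_at_Cons address_def eval_nat_numeral)
  with ad have "reaches P (8 * K) (l, R, ot s) (l + 7, R1(x := ar s a (vr s y)), ot s)"
    by (rule reaches_trans) simp
  then show ?case using r1 a
    by (auto intro!: exI[of _ "R1(x := ar s a (vr s y))"] represents_upd)
next
  case (Put a y x)
  define R1 where "R1 = R(61 := 64 + a, 60 := 64 + 16 * vr s y + a)"
  have y: "R y = vr s y" "vr s y \<le> M" and a: "a < 16" and x: "x < 60" "vr s x \<le> M"
    using Put.prems by (auto simp: represents_def bounded_def intro: le_trans)
  have r1: "represents R1 s"
    unfolding R1_def using Put.prems by (intro represents_scratch) auto
  have ad: "reaches P (6 * K) (l, R, ot s) (l + 6, R1, ot s)"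
    unfolding R1_def K_def using address_correct[of P l a y R M "ot s"] Put.prems y a
    by (auto simp: code_at_append)
  have v: "R1 60 = 64 + 16 * vr s y + a" "R1 x = vr s x"
    using r1 x by (auto simp: R1_def represents_def)
  have "bits (R1 60) + bits (R1 x) \<le> K"
    unfolding K_def v using v y a x by (intro bits_add_le_twice) auto
  then have "reaches P K (l + 6, R1, ot s) (l + 7, R1(64 + 16 * vr s y + a := vr s x), ot s)"
    using Put.prems v
    by (intro reaches_single[of _ _ "Store 60 x"]) (auto simp: code_at_append code_at_Cons address_def eval_nat_numeral)
  with ad have "reaches P (8 * K) (l, R, ot s) (l + 7, R1(64 + 16 * vr s y + a := vr s x), ot s)"
    by (rule reaches_trans) simp
  then show ?case using represents_put[OF r1 a(1)]
    by (auto intro!: exI[of _ "R1(64 + 16 * vr s y + a := vr s x)"])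
next
  case (Seq c d)
  obtain R1 where R1: "represents R1 (sem c s)"
    "reaches P (8 * steps c s * K) (l, R, ot s) (l + clen c, R1, ot (sem c s))"
    using Seq.IH(1)[of l R s A] Seq.prems by (auto simp: code_at_append length_comp)
  obtain R2 where R2: "represents R2 (sem d (sem c s))"
    "reaches P (8 * steps d (sem c s) * K) (l + clen c, R1, ot (sem c s))
      (l + clen c + clen d, R2, ot (sem d (sem c s)))"
    using Seq.IH(2)[of "l + clen c" R1 "sem c s" "A + steps c s"] Seq.prems R1 bounded_sem[of c A s]
    by (auto simp: code_at_append length_comp)
  have "reaches P (8 * steps (c ;; d) s * K) (l, R, ot s) (l + clen c + clen d, R2, ot (sem d (sem c s)))"
    by (rule reaches_trans[OF R1(2) R2(2)]) (simp add: algebra_simps)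
  then show ?case using R2(1) by (auto simp: add.assoc)
next
  case (If x c d)
  have x: "R x = vr s x" "vr s x \<le> M" and one: "R 62 = 1"
    using If.prems by (auto simp: represents_def bounded_def intro: le_trans)
  have bx: "bits (R x) \<le> K" and b1: "bits (R 62) \<le> K"
    unfolding K_def using x one by (auto intro!: bits_le_twice)
  have P: "l < length P" "P ! l = Jump x (l + clen d + 2)" "code_at P (l + 1) (comp d (l + 1))"
    "l + clen d + 1 < length P" "P ! (l + clen d + 1) = Jump 62 (l + clen d + clen c + 2)"
    "code_at P (l + clen d + 2) (comp c (l + clen d + 2))"
    using If.prems by (auto simp: code_at_append code_at_Cons length_comp)
  show ?case
  proof (cases "vr s x > 0")
    case True
    obtain R1 where R1: "represents R1 (sem c s)"
      "reaches P (8 * steps c s * K) (l + clen d + 2, R, ot s)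
        (l + clen d + 2 + clen c, R1, ot (sem c s))"
      using If.IH(1)[OF _ P(6) If.prems(3,4)] If.prems True by auto
    have "reaches P K (l, R, ot s) (l + clen d + 2, R, ot s)"
      using P bx x True by (intro reaches_single[of _ _ "Jump x (l + clen d + 2)"]) auto
    from reaches_trans[OF this R1(2) order_refl] have
      "reaches P (8 * Suc (steps c s) * K) (l, R, ot s) (l + clen d + 2 + clen c, R1, ot (sem c s))"
      by (rule reaches_mono) (simp add: algebra_simps)
    then show ?thesis using R1 True by (auto simp: algebra_simps)
  next
    case False
    obtain R1 where R1: "represents R1 (sem d s)"
      "reaches P (8 * steps d s * K) (l + 1, R, ot s) (l + 1 + clen d, R1, ot (sem d s))"
      using If.IH(2)[OF _ P(3) If.prems(3,4)] If.prems False by auto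
    have one1: "R1 62 = 1" using R1 by (auto simp: represents_def)
    have 1: "reaches P K (l, R, ot s) (l + 1, R, ot s)"
      using P bx x False by (intro reaches_single[of _ _ "Jump x (l + clen d + 2)"]) auto
    have 2: "reaches P K (l + 1 + clen d, R1, ot (sem d s)) (l + clen d + clen c + 2, R1, ot (sem d s))"
      using P b1 one one1 by (intro reaches_single[of _ _ "Jump 62 (l + clen d + clen c + 2)"]) auto
    from reaches_trans[OF reaches_trans[OF 1 R1(2) order_refl] 2 order_refl] have
      "reaches P (8 * Suc (steps d s) * K) (l, R, ot s) (l + clen d + clen c + 2, R1, ot (sem d s))"
      by (rule reaches_mono) (simp add: algebra_simps)
    then show ?thesis using R1 False by (auto simp: algebra_simps)
  qed
next
  case (For x y z c)
  let ?n = "min (vr s y) (vr s z)"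
  let ?s = "\<lambda>k. iter x (sem c) s k"
  let ?T = "\<lambda>k. \<Sum>j<k. Suc (steps c (?s j))"
  have wf: "x < 60" "y < 60" "z < 60" "x \<noteq> y" "x \<noteq> z" "x \<notin> modv c" "y \<notin> modv c" "z \<notin> modv c" "wf c"
    using For.prems by auto
  have P: "l < length P" "P ! l = Const x 0"
    "l + 1 < length P" "P ! (l + 1) = Sub 60 y x"
    "l + 2 < length P" "P ! (l + 2) = Jump 60 (l + 4)"
    "l + 3 < length P" "P ! (l + 3) = Jump 62 (l + clen c + 9)"
    "l + 4 < length P" "P ! (l + 4) = Sub 60 z x"
    "l + 5 < length P" "P ! (l + 5) = Jump 60 (l + 7)"
    "l + 6 < length P" "P ! (l + 6) = Jump 62 (l + clen c + 9)"
    "code_at P (l + 7) (comp c (l + 7))"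
    "l + clen c + 7 < length P" "P ! (l + clen c + 7) = Add x x 62"
    "l + clen c + 8 < length P" "P ! (l + clen c + 8) = Jump 62 (l + 1)"
    using For.prems by (auto simp: code_at_append code_at_Cons length_comp eval_nat_numeral algebra_simps)
  have M: "vr s y \<le> M" "vr s z \<le> M" using For.prems by (auto simp: bounded_def intro: le_trans)
  have vars: "vr (?s k) x = k" "vr (?s k) y = vr s y" "vr (?s k) z = vr s z" for k
    using wf by (auto simp: vr_iter_index vr_iter_frame vr_frame)
  have bd: "bounded (A + ?T k) (?s k)" if "k \<le> ?n" for k
    using that For.prems by (intro bounded_iter bounded_sem wf) (auto simp: bounded_def intro: le_trans)
  have TM: "A + ?T k \<le> M" if "k \<le> ?n" for k
  proof -
    have "?T k \<le> ?T ?n" using that by (intro sum_mono2) auto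
    then show ?thesis using For.prems(5) by simp
  qed
  have sub: "reaches P (2 * K) (l + 1, R', w) (if k < vr s y then l + 4 else l + 3, R'(60 := vr s y - k), w)"
    if "represents R' (?s k)" "k \<le> ?n" for R' k w
  proof -
    have r: "R' y = vr s y" "R' x = k" using that wf vars by (auto simp: represents_def)
    have c: "bits (R' y) + bits (R' x) \<le> K" "bits (R' y - R' x) \<le> K"
      unfolding K_def using r M that by (auto intro!: bits_add_le_twice bits_le_twice)
    have 1: "reaches P K (l + 1, R', w) (l + 2, R'(60 := vr s y - k), w)"
      using P c r by (intro reaches_single) auto
    have 2: "reaches P K (l + 2, R'(60 := vr s y - k), w)
        (if k < vr s y then l + 4 else l + 3, R'(60 := vr s y - k), w)"
      using P c r by (intro reaches_single) auto
    show ?thesis by (rule reaches_trans[OF 1 2]) simp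
  qed
  have sub2: "reaches P (2 * K) (l + 4, R', w) (if k < vr s z then l + 7 else l + 6, R'(60 := vr s z - k), w)"
    if "represents R' (?s k)" "k \<le> ?n" for R' k w
  proof -
    have r: "R' z = vr s z" "R' x = k" using that wf vars by (auto simp: represents_def)
    have c: "bits (R' z) + bits (R' x) \<le> K" "bits (R' z - R' x) \<le> K"
      unfolding K_def using r M that by (auto intro!: bits_add_le_twice bits_le_twice)
    have 1: "reaches P K (l + 4, R', w) (l + 5, R'(60 := vr s z - k), w)"
      using P c r by (intro reaches_single) auto
    have 2: "reaches P K (l + 5, R'(60 := vr s z - k), w)
        (if k < vr s z then l + 7 else l + 6, R'(60 := vr s z - k), w)"
      using P c r by (intro reaches_single) auto
    show ?thesis by (rule reaches_trans[OF 1 2]) simp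
  qed
  have leave: "reaches P K (l', R', w) (l + clen c + 9, R', w)"
    if "represents R' (?s k)" "l' = l + 3 \<or> l' = l + 6" for R' k l' w
  proof -
    have "R' 62 = 1" using that by (auto simp: represents_def)
    moreover have "bits 1 \<le> K" unfolding K_def by (intro bits_le_twice) simp
    ultimately show ?thesis using P that
      by (intro reaches_single[of _ _ "Jump 62 (l + clen c + 9)"]) auto
  qed
  \<comment> \<open>The machine is followed from one test of the counter to the next; the extra
    \<open>K\<close> pays for resetting the counter.\<close>
  have loop: "\<exists>R'. represents R' (?s k) \<and>
      reaches P (8 * ?T k * K + K) (l, R, ot s) (l + 1, R', ot (?s k))" if "k \<le> ?n" for k
    using that
  proof (induction k)
    case 0
    have "bits 0 \<le> K" unfolding K_def by (intro bits_le_twice) simp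
    then have "reaches P K (l, R, ot s) (l + 1, R(x := 0), ot s)"
      using P by (intro reaches_single[of _ _ "Const x 0"]) auto
    then show ?case using For.prems wf by (auto intro!: exI[of _ "R(x := 0)"] represents_upd)
  next
    case (Suc k)
    then obtain R1 where R1: "represents R1 (?s k)"
      "reaches P (8 * ?T k * K + K) (l, R, ot s) (l + 1, R1, ot (?s k))" by auto
    have k: "k < vr s y" "k < vr s z" "k \<le> ?n" using Suc.prems by auto
    define R2 where "R2 = R1(60 := vr s z - k)"
    have r2: "represents R2 (?s k)" "represents (R1(60 := vr s y - k)) (?s k)"
      unfolding R2_def using R1 by (auto intro: represents_scratch)
    have 1: "reaches P (4 * K) (l + 1, R1, ot (?s k)) (l + 7, R2, ot (?s k))"
      using reaches_trans[OF sub[OF R1(1) k(3), of "ot (?s k)"] _, of "2 * K" _ "4 * K"]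
        sub2[OF r2(2) k(3), of "ot (?s k)"] k by (simp add: R2_def)
    obtain R3 where R3: "represents R3 (sem c (?s k))"
      "reaches P (8 * steps c (?s k) * K) (l + 7, R2, ot (?s k)) (l + 7 + clen c, R3, ot (sem c (?s k)))"
      using For.IH[OF wf(9) P(15) r2(1) bd[OF k(3)]] TM[OF Suc.prems] by auto
    have x3: "R3 x = k" "R3 62 = 1"
      using R3 wf vars(1)[of k] by (auto simp: represents_def vr_frame)
    have c: "bits (R3 x) + bits (R3 62) \<le> K" "bits (R3 62) \<le> K"
      unfolding K_def using x3 M k by (auto intro!: bits_add_le_twice bits_le_twice)
    have e: "l + 7 + clen c = l + clen c + 7" by simp
    have 21: "reaches P K (l + 7 + clen c, R3, ot (sem c (?s k)))
        (l + clen c + 8, R3(x := Suc k), ot (?s (Suc k)))"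
      unfolding e using P c x3 wf by (intro reaches_single[of _ _ "Add x x 62"]) auto
    have 22: "reaches P K (l + clen c + 8, R3(x := Suc k), ot (?s (Suc k)))
        (l + 1, R3(x := Suc k), ot (?s (Suc k)))"
      using P c x3 wf by (intro reaches_single[of _ _ "Jump 62 (l + 1)"]) auto
    have 2: "reaches P (2 * K) (l + 7 + clen c, R3, ot (sem c (?s k))) (l + 1, R3(x := Suc k), ot (?s (Suc k)))"
      by (rule reaches_trans[OF 21 22]) simp
    have r4: "represents (R3(x := Suc k)) (?s (Suc k))"
      using represents_upd[OF R3(1) wf(1)] by simp
    from reaches_trans[OF reaches_trans[OF reaches_trans[OF R1(2) 1 order_refl] R3(2) order_refl] 2 order_refl]
    have "reaches P (8 * ?T (Suc k) * K + K) (l, R, ot s) (l + 1, R3(x := Suc k), ot (?s (Suc k)))"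
      by (rule reaches_mono) (simp add: algebra_simps)
    then show ?case using r4 by blast
  qed
  obtain R1 where R1: "represents R1 (?s ?n)"
    "reaches P (8 * ?T ?n * K + K) (l, R, ot s) (l + 1, R1, ot (?s ?n))" using loop by blast
  have "\<exists>R'. represents R' (?s ?n) \<and>
    reaches P (5 * K) (l + 1, R1, ot (?s ?n)) (l + clen c + 9, R', ot (?s ?n))"
  \<comment> \<open>The smaller bound decides which of the two tests ends the loop; leaving through
    the second one takes the full five instructions.\<close>
  proof (cases "vr s y \<le> vr s z")
    case True
    let ?R = "R1(60 := 0)"
    have r: "represents ?R (?s ?n)" using R1 by (auto intro: represents_scratch)
    show ?thesis
      using reaches_trans[OF sub[OF R1(1) order_refl, of "ot (?s ?n)"] _, of K _ "5 * K"]
        leave[OF r, of "l + 3" "ot (?s ?n)"] True r by (auto simp: min_absorb1)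
  next
    case False
    let ?R = "R1(60 := vr s y - ?n)" and ?R' = "R1(60 := 0)"
    have r: "represents ?R (?s ?n)" "represents ?R' (?s ?n)" using R1 by (auto intro: represents_scratch)
    have "reaches P (2 * K) (l + 1, R1, ot (?s ?n)) (l + 4, ?R, ot (?s ?n))"
      using sub[OF R1(1) order_refl, of "ot (?s ?n)"] False by (simp add: min_absorb2)
    moreover have "reaches P (2 * K) (l + 4, ?R, ot (?s ?n)) (l + 6, ?R', ot (?s ?n))"
      using sub2[OF r(1) order_refl, of "ot (?s ?n)"] False by (simp add: min_absorb2)
    ultimately show ?thesis
      using leave[OF r(2), of "l + 6" "ot (?s ?n)"] r
        reaches_trans[OF reaches_trans[OF _ _ order_refl] _, of P "2 * K" _ _ "2 * K" _ K _ "5 * K"]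
      by auto
  qed
  then obtain R2 where R2: "represents R2 (?s ?n)"
    "reaches P (5 * K) (l + 1, R1, ot (?s ?n)) (l + clen c + 9, R2, ot (?s ?n))" by blast
  from reaches_trans[OF R1(2) R2(2) order_refl]
  have "reaches P (8 * Suc (?T ?n) * K) (l, R, ot s) (l + clen c + 9, R2, ot (?s ?n))"
    by (rule reaches_mono) (simp add: algebra_simps)
  then show ?case using R2 by (auto simp: algebra_simps)
qed

section \<open>Static cost bounds, loop invariants and odometers\<close>

definition start_state :: "nat list \<Rightarrow> st" where
  "start_state xs = \<lparr>vr = init_regs xs, ar = (\<lambda>_ _. 0), ot = []\<rparr>"

text \<open>Registers outside the input start at 0, so of the two constants assumed by the compiled
  code only the 1 in register 62 has to be written.\<close>

definition program :: "com \<Rightarrow> ram" where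
  "program c = Const 62 1 # comp c 1"

lemma program_outputs:
  assumes "wf c" "length xs \<le> 60" "\<forall>x\<in>set xs. x \<le> M"
  shows "\<exists>t. ram_outputs (program c) xs (ot (sem c (start_state xs))) t \<and>
    t \<le> (8 * steps c (start_state xs) + 1) * (2 * bits (16 * (M + steps c (start_state xs)) + 100))"
proof -
  let ?s = "start_state xs" and ?R = "(init_regs xs)(62 := 1)"
  let ?K = "2 * bits (16 * (M + steps c ?s) + 100)"
  have r: "represents ?R ?s"
    using assms(2) by (auto simp: represents_def start_state_def init_regs_def)
  have b: "bounded M ?s"
    using assms(3) by (auto simp: bounded_def start_state_def init_regs_def)
  have "code_at (program c) 0 (program c)" unfolding code_at_def by auto
  then have ca: "code_at (program c) 1 (comp c 1)"
    by (simp add: program_def code_at_Cons)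
  obtain R' where R': "reaches (program c) (8 * steps c ?s * ?K) (1, ?R, ot ?s)
      (1 + clen c, R', ot (sem c ?s))"
    using comp_correct[OF assms(1) ca r b order_refl] by blast
  have "bits 1 \<le> ?K" by (intro bits_le_twice) simp
  then have "reaches (program c) ?K (0, init_regs xs, []) (1, ?R, ot ?s)"
    by (intro reaches_single[of _ _ "Const 62 1"]) (auto simp: program_def start_state_def)
  from reaches_trans[OF this R' order_refl] obtain t where
    t: "t \<le> ?K + 8 * steps c ?s * ?K"
      "exec (program c) (0, init_regs xs, []) t (1 + clen c, R', ot (sem c ?s))"
    unfolding reaches_def by blast
  have "length (program c) = 1 + clen c" by (simp add: program_def length_comp)
  then have "ram_outputs (program c) xs (ot (sem c ?s)) t"
    unfolding ram_outputs_def using t by fastforce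
  moreover have "t \<le> (8 * steps c ?s + 1) * ?K"
    using t(1) by (simp add: add_mult_distrib)
  ultimately show ?thesis by blast
qed

section \<open>Static bounds on the number of steps\<close>

fun caps :: "com \<Rightarrow> nat set" where
  "caps (c ;; d) = caps c \<union> caps d"
| "caps (If x c d) = caps c \<union> caps d"
| "caps (For x y z c) = insert z (caps c)"
| "caps _ = {}"

fun csize :: "com \<Rightarrow> nat" where
  "csize Skip = 0"
| "csize (Set x c) = Suc c"
| "csize (c ;; d) = csize c + csize d"
| "csize (If x c d) = Suc (csize c + csize d)"
| "csize (For x y z c) = csize c + 2"
| "csize _ = 1"

fun depth :: "nat set \<Rightarrow> com \<Rightarrow> nat" where
  "depth H (c ;; d) = max (depth H c) (depth H d)"
| "depth H (If x c d) = max (depth H c) (depth H d)"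
| "depth H (For x y z c) = (if z \<in> H then 1 else 0) + depth H c"
| "depth H _ = 0"

text \<open>No cap is assigned, so each loop is bounded by an initial value and a loop nest by a
  product of such values. The variable \<open>h\<close> is kept apart because its value may be
  exponential, so that its exponent matters while the exponent of \<open>X + 1\<close> may be any
  constant.\<close>

lemma steps_le:
  assumes "caps c \<inter> modv c = {}" "\<And>z. z \<in> caps c \<Longrightarrow> vr s z \<le> (if z = h then Z else X)"
  shows "steps c s \<le> csize c * ((X + 1) ^ depth (- {h}) c * (Z + 1) ^ depth {h} c)"
  using assms
proof (induction c arbitrary: s)
  case (Seq c d)
  let ?A = "\<lambda>c. (X + 1) ^ depth (- {h}) c * (Z + 1) ^ depth {h} c"
  have "vr (sem c s) z = vr s z" if "z \<in> caps (c ;; d)" for z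
    using that Seq.prems(1) by (intro vr_frame) auto
  then have "steps c s \<le> csize c * ?A c" "steps d (sem c s) \<le> csize d * ?A d"
    using Seq.prems by (intro Seq.IH; force)+
  moreover have "?A c \<le> ?A (c ;; d)" "?A d \<le> ?A (c ;; d)"
    by (auto intro!: mult_le_mono power_increasing)
  ultimately have "steps c s \<le> csize c * ?A (c ;; d)" "steps d (sem c s) \<le> csize d * ?A (c ;; d)"
    by (meson le_trans mult_le_mono2)+
  then show ?case by (simp add: add_mult_distrib)
next
  case (If x c d)
  let ?A = "\<lambda>c. (X + 1) ^ depth (- {h}) c * (Z + 1) ^ depth {h} c"
  let ?B = "?A (If x c d)"
  have "steps c s \<le> csize c * ?A c" "steps d s \<le> csize d * ?A d"
    using If.prems by (intro If.IH; force)+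
  moreover have "?A c \<le> ?B" "?A d \<le> ?B"
    by (auto intro!: mult_le_mono power_increasing)
  ultimately have "steps c s \<le> csize c * ?B" "steps d s \<le> csize d * ?B"
    by (meson le_trans mult_le_mono2)+
  moreover have "1 \<le> ?B" by simp
  moreover have "steps (If x c d) s \<le> 1 + (steps c s + steps d s)" by simp
  ultimately have "steps (If x c d) s \<le> ?B + (csize c * ?B + csize d * ?B)" by linarith
  also have "\<dots> = csize (If x c d) * ?B" by (simp add: add_mult_distrib)
  finally show ?case .
next
  case (For x y z c)
  let ?A = "(X + 1) ^ depth (- {h}) c * (Z + 1) ^ depth {h} c"
  let ?w = "if z = h then Z else X" and ?n = "min (vr s y) (vr s z)"
  have "vr (iter x (sem c) s k) v = vr s v" if "v \<in> caps (For x y z c)" for v k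
    using that For.prems(1) by (intro vr_iter_frame vr_frame) auto
  then have "steps c (iter x (sem c) s k) \<le> csize c * ?A" for k
    using For.prems by (intro For.IH) force+
  moreover have A: "1 \<le> ?A" by simp
  ultimately have "Suc (steps c (iter x (sem c) s k)) \<le> (csize c + 1) * ?A" for k
    by (metis Suc_eq_plus1 add_mono add_mult_distrib mult_1)
  then have "(\<Sum>k<?n. Suc (steps c (iter x (sem c) s k))) \<le> (\<Sum>k<?n. (csize c + 1) * ?A)"
    by (intro sum_mono)
  also have "\<dots> \<le> ?w * ((csize c + 1) * ?A)"
    using For.prems(2)[of z] by (simp add: min.coboundedI2)
  finally have "steps (For x y z c) s \<le> ?A + ?w * ((csize c + 1) * ?A)"
    unfolding steps.simps(11) using A by linarith
  also have "\<dots> \<le> (csize c + 2) * (?A * (?w + 1))"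
    by (simp add: algebra_simps)
  also have "?A * (?w + 1) = (X + 1) ^ depth (- {h}) (For x y z c) * (Z + 1) ^ depth {h} (For x y z c)"
    by (simp add: algebra_simps)
  finally show ?case by simp
qed auto

section \<open>Reasoning about loops, capped arithmetic and counters\<close>

declare sem.simps(11)[simp del] steps.simps(11)[simp del]

text \<open>The step may assume that whatever the body never assigns still has its value from loop
  entry, so invariants speak only about what changes.\<close>

lemma For_inv:
  assumes "I 0 (upd x 0 s)"
    and "\<And>k t. k < min (vr s y) (vr s z) \<Longrightarrow> I k t \<Longrightarrow> vr t x = k \<Longrightarrow>
      \<forall>v. v \<notin> insert x (modv c) \<longrightarrow> vr t v = vr s v \<Longrightarrow> \<forall>a. a \<notin> moda c \<longrightarrow> ar t a = ar s a \<Longrightarrow>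
      I (Suc k) (upd x (Suc k) (sem c t))"
  shows "I (min (vr s y) (vr s z)) (sem (For x y z c) s)"
proof -
  have "I k (iter x (sem c) s k)" if "k \<le> min (vr s y) (vr s z)" for k
    using that
  proof (induction k)
    case (Suc k)
    have "ar (iter x (sem c) s k) a = ar s a" if "a \<notin> moda c" for a
      using that by (induction k) (auto simp: ar_frame)
    then have "I (Suc k) (upd x (Suc k) (sem c (iter x (sem c) s k)))"
      using Suc by (intro assms(2)) (auto simp: vr_iter_index vr_iter_frame vr_frame)
    then show ?case by simp
  qed (use assms(1) in simp)
  then show ?thesis by (simp add: sem.simps(11))
qed

lemma st_eqI: "vr s = vr t \<Longrightarrow> ar s = ar t \<Longrightarrow> ot s = ot t \<Longrightarrow> (s :: st) = t"
  by (cases s; cases t) simp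

text \<open>Repeated increments, since a built-in addition could double values in one step. The cap
  in variable 8 serves the static cost bound and does not interfere as long as \<open>y\<close> is
  at most its value.\<close>

definition AddTo :: "nat \<Rightarrow> nat \<Rightarrow> com" where
  "AddTo z y = For 12 y 8 (Inc z)"

lemma sem_AddTo:
  assumes "vr s y \<le> vr s 8" "z \<noteq> 12"
  shows "sem (AddTo z y) s = upd 12 (vr s y) (upd z (vr s z + vr s y) s)"
proof -
  have "sem (For 12 y 8 (Inc z)) s =
    upd 12 (min (vr s y) (vr s 8)) (upd z (vr s z + min (vr s y) (vr s 8)) s)"
    by (rule For_inv[where I = "\<lambda>k t. t = upd 12 k (upd z (vr s z + k) s)"])
      (use assms in \<open>auto intro!: st_eqI\<close>)
  then show ?thesis using assms by (simp add: AddTo_def)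
qed

definition Idx :: "nat \<Rightarrow> nat \<Rightarrow> nat \<Rightarrow> nat \<Rightarrow> com" where
  "Idx z i w j = Set z 0 ;; For 13 i 8 (AddTo z w) ;; AddTo z j"

lemma sem_Idx:
  assumes "vr s i \<le> vr s 8" "vr s w \<le> vr s 8" "vr s j \<le> vr s 8"
    "z \<noteq> 12" "z \<noteq> 13" "z \<noteq> 8" "i \<noteq> z" "w \<noteq> z" "j \<noteq> z" "w \<noteq> 12" "w \<noteq> 13" "j \<noteq> 12" "j \<noteq> 13" "i \<noteq> 12" "i \<noteq> 13"
  shows "sem (Idx z i w j) s = upd 13 (vr s i) (upd 12 (vr s j) (upd z (vr s i * vr s w + vr s j) s))"
proof -
  let ?s = "upd z 0 s"
  let ?I = "\<lambda>k t. (\<forall>v. v \<notin> {12, 13, z} \<longrightarrow> vr t v = vr s v) \<and> vr t z = k * vr s w \<and> vr t 13 = k \<and>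
    ar t = ar s \<and> ot t = ot s"
  have "?I (min (vr ?s i) (vr ?s 8)) (sem (For 13 i 8 (AddTo z w)) ?s)"
    by (rule For_inv) (use assms in \<open>auto simp: sem_AddTo\<close>)
  then show ?thesis using assms
    by (auto simp: Idx_def sem_AddTo min_absorb1 intro!: st_eqI ext)
qed

lemma mod_AddTo [simp]: "modv (AddTo z y) = {12, z}" "moda (AddTo z y) = {}" "silent (AddTo z y)"
  by (auto simp: AddTo_def)

lemma mod_Idx [simp]: "modv (Idx z i w j) = {12, 13, z}" "moda (Idx z i w j) = {}" "silent (Idx z i w j)"
  by (auto simp: Idx_def)

text \<open>Mixed-radix representation of \<open>k\<close>, least significant digit first.\<close>

definition digit :: "(nat \<Rightarrow> nat) \<Rightarrow> nat \<Rightarrow> nat \<Rightarrow> nat" where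
  "digit \<rho> k i = (k div (\<Prod>j<i. \<rho> j)) mod \<rho> i"

lemma digit_0 [simp]: "digit \<rho> 0 i = 0"
  by (simp add: digit_def)

lemma digit_less: "\<rho> i \<ge> 1 \<Longrightarrow> digit \<rho> k i < \<rho> i"
  by (simp add: digit_def)

text \<open>Adding \<open>w m\<close> times the product of the lower radices leaves the lower digits
  unchanged, because this product is a multiple of every shorter one. Counting up to the product of
  all radices therefore visits every vector.\<close>

lemma digit_surj:
  assumes "\<And>i. i < m \<Longrightarrow> w i < \<rho> i"
  shows "\<exists>k < (\<Prod>j<m. \<rho> j). \<forall>i<m. digit \<rho> k i = w i"
  using assms
proof (induction m)
  case (Suc m)
  then obtain k where k: "k < (\<Prod>j<m. \<rho> j)" "\<forall>i<m. digit \<rho> k i = w i" by force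
  let ?M = "\<Prod>j<m. \<rho> j" and ?k = "k + w m * (\<Prod>j<m. \<rho> j)"
  have "Suc (w m) * ?M \<le> \<rho> m * ?M" using Suc.prems[of m] by (intro mult_le_mono1) simp
  then have "?k < (\<Prod>j<Suc m. \<rho> j)" using k(1) by (simp add: mult.commute)
  moreover have "digit \<rho> ?k i = w i" if "i < Suc m" for i
  proof (cases "i = m")
    case True
    have "?M \<noteq> 0" using k(1) by linarith
    from div_mult_self1[OF this, of k "w m"] k(1) have "?k div ?M = w m" by (metis div_less add.right_neutral)
    then show ?thesis using True Suc.prems[of m] by (simp add: digit_def)
  next
    case False
    then have "i < m" using that by simp
    let ?P = "\<Prod>j<i. \<rho> j"
    have "(\<Prod>j<Suc i. \<rho> j) dvd ?M"
      using \<open>i < m\<close> by (intro prod_dvd_prod_subset) auto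
    then obtain c where c: "?M = ?P * (\<rho> i * c)" unfolding dvd_def by (auto simp: mult.assoc)
    have pos: "?P \<noteq> 0"
    proof
      assume "?P = 0"
      then have "?M = 0" using c by (metis mult_zero_left)
      with k(1) show False by linarith
    qed
    have "?k = k + (\<rho> i * (c * w m)) * ?P"
      by (subst c) (simp add: algebra_simps)
    then have "?k div ?P = \<rho> i * (c * w m) + k div ?P"
      using div_mult_self1[OF pos, of k "\<rho> i * (c * w m)"] by metis
    then show ?thesis using k(2) \<open>i < m\<close> by (simp add: digit_def)
  qed
  ultimately show ?case by blast
qed simp

definition Odo_inc :: "nat \<Rightarrow> nat \<Rightarrow> nat \<Rightarrow> com" where
  "Odo_inc D R l = Set 15 1 ;; For 14 l l (If 15 (Get 16 D 14 ;; Inc 16 ;; Get 17 R 14 ;; Sb 18 17 16 ;;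
     If 18 (Put D 14 16 ;; Set 15 0) (Set 16 0 ;; Put D 14 16)) Skip)"

text \<open>The body \<open>c\<close> finds in array \<open>D\<close> the digits of the counter
  \<open>v\<close> for the radices in array \<open>R\<close>. Incrementing the digit vector after
  each round, with variable 15 as the carry, avoids division.\<close>

definition Odo :: "nat \<Rightarrow> nat \<Rightarrow> nat \<Rightarrow> nat \<Rightarrow> nat \<Rightarrow> com \<Rightarrow> com" where
  "Odo v V D R l c = For 14 l l (Set 16 0 ;; Put D 14 16) ;; For v V V (c ;; Odo_inc D R l)"

lemma mod_Odo_inc [simp]: "modv (Odo_inc D R l) = {14, 15, 16, 17, 18}" "moda (Odo_inc D R l) = {D}"
  "silent (Odo_inc D R l)"
  by (auto simp: Odo_inc_def)

lemma mod_Odo [simp]: "modv (Odo v V D R l c) = {14, 15, 16, 17, 18, v} \<union> modv c"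
  "moda (Odo v V D R l c) = insert D (moda c)" "silent (Odo v V D R l c) = silent c"
  by (auto simp: Odo_def)

text \<open>The carry reaches position \<open>i\<close> exactly if the product of the lower radices
  divides \<open>k + 1\<close>, since only then does the quotient by this product grow.\<close>

lemma digit_Suc:
  assumes "\<rho> i \<ge> 1" "(\<Prod>j<i. \<rho> j) \<ge> 1"
  shows "digit \<rho> (Suc k) i = (if (\<Prod>j<i. \<rho> j) dvd Suc k
      then if Suc (digit \<rho> k i) < \<rho> i then Suc (digit \<rho> k i) else 0 else digit \<rho> k i)"
    and "(\<Prod>j<Suc i. \<rho> j) dvd Suc k \<longleftrightarrow> (\<Prod>j<i. \<rho> j) dvd Suc k \<and> \<not> Suc (digit \<rho> k i) < \<rho> i"
proof -
  define M where "M = (\<Prod>j<i. \<rho> j)"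
  define a where "a = k div M"
  have q: "Suc k div M = (if M dvd Suc k then Suc a else a)"
    by (simp add: a_def div_Suc dvd_eq_mod_eq_0)
  have d: "digit \<rho> k i = a mod \<rho> i" "digit \<rho> (Suc k) i = (Suc k div M) mod \<rho> i"
    by (simp_all add: digit_def M_def a_def)
  have lt: "a mod \<rho> i < \<rho> i" using assms(1) by simp
  have s: "Suc a mod \<rho> i = (if Suc (a mod \<rho> i) < \<rho> i then Suc (a mod \<rho> i) else 0)"
    using lt by (subst mod_Suc) auto
  show "digit \<rho> (Suc k) i = (if (\<Prod>j<i. \<rho> j) dvd Suc k
      then if Suc (digit \<rho> k i) < \<rho> i then Suc (digit \<rho> k i) else 0 else digit \<rho> k i)"
    unfolding M_def[symmetric] d q by (simp add: s)
  have "M * \<rho> i dvd Suc k \<longleftrightarrow> M dvd Suc k \<and> \<rho> i dvd Suc k div M"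
  proof (cases "M dvd Suc k")
    case True
    have "M \<noteq> 0" using assms(2) unfolding M_def by linarith
    note h = dvd_div_iff_mult[OF this True, of "\<rho> i"]
    show ?thesis unfolding h mult.commute[of M "\<rho> i"] using True by blast
  qed (auto dest: dvd_mult_left)
  also have "\<dots> \<longleftrightarrow> M dvd Suc k \<and> Suc a mod \<rho> i = 0"
    unfolding q by (auto simp: dvd_eq_mod_eq_0)
  also have "\<dots> \<longleftrightarrow> M dvd Suc k \<and> \<not> Suc (digit \<rho> k i) < \<rho> i"
    unfolding d s by simp
  finally show "(\<Prod>j<Suc i. \<rho> j) dvd Suc k \<longleftrightarrow> (\<Prod>j<i. \<rho> j) dvd Suc k \<and> \<not> Suc (digit \<rho> k i) < \<rho> i"
    unfolding prod.lessThan_Suc M_def[symmetric] .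
qed

lemma sem_Odo_inc:
  assumes "D \<noteq> R" "l \<notin> {14..18}" "\<forall>i<vr s l. ar s R i = \<rho> i \<and> \<rho> i \<ge> 1"
    "\<forall>i<vr s l. ar s D i = digit \<rho> k i"
  shows "\<forall>i<vr s l. ar (sem (Odo_inc D R l) s) D i = digit \<rho> (Suc k) i"
proof -
  let ?s = "upd 15 1 s" and ?c = "If 15 (Get 16 D 14 ;; Inc 16 ;; Get 17 R 14 ;; Sb 18 17 16 ;;
     If 18 (Put D 14 16 ;; Set 15 0) (Set 16 0 ;; Put D 14 16)) Skip"
  let ?I = "\<lambda>i (t :: st). (\<forall>j<i. ar t D j = digit \<rho> (Suc k) j) \<and> (\<forall>j. i \<le> j \<and> j < vr s l \<longrightarrow> ar t D j = digit \<rho> k j) \<and>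
    vr t 15 = of_bool ((\<Prod>j<i. \<rho> j) dvd Suc k)"
  have "?I (min (vr ?s l) (vr ?s l)) (sem (For 14 l l ?c) ?s)"
  proof (rule For_inv)
    show "?I 0 (upd 14 0 ?s)" using assms by auto
  next
    fix i t assume i: "i < min (vr ?s l) (vr ?s l)" and I: "?I i t" and x: "vr t 14 = i"
      and "\<forall>a. a \<notin> moda ?c \<longrightarrow> ar t a = ar ?s a"
    then have R: "ar t R i = \<rho> i" "\<rho> i \<ge> 1" and D: "ar t D i = digit \<rho> k i"
      using assms by auto
    have "(\<Prod>j<i. \<rho> j) \<ge> 1" using i assms by (intro prod_ge_1) auto
    note d = digit_Suc[of \<rho> i k, OF R(2) this]
    show "?I (Suc i) (upd 14 (Suc i) (sem ?c t))"
      unfolding d(2) using d(1) I R D x by (auto simp: less_Suc_eq simp del: prod.lessThan_Suc)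
  qed
  moreover have "l \<noteq> 15" using assms(2) by auto
  ultimately show ?thesis by (simp add: Odo_inc_def)
qed

text \<open>The odometer works in variables 14 to 18, its counter and array \<open>D\<close>;
  \<open>indep\<close> makes the invariant insensitive to these, so that it survives the
  initialisation and every tick.\<close>

lemma Odo_inv:
  assumes "D \<noteq> R" "l \<notin> {14..18}" "v \<notin> {14..18}" "V \<notin> {14..18}" "v \<noteq> l" "D \<notin> moda c" "R \<notin> moda c"
    "{v, l} \<inter> modv c = {}" "\<forall>i<vr s l. ar s R i = \<rho> i \<and> \<rho> i \<ge> 1"
    and indep: "\<And>k t t'. I k t \<Longrightarrow> \<forall>x. x \<notin> {14, 15, 16, 17, 18, v} \<longrightarrow> vr t' x = vr t x \<Longrightarrow>
      \<forall>a. a \<noteq> D \<longrightarrow> ar t' a = ar t a \<Longrightarrow> ot t' = ot t \<Longrightarrow> I k t'"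
    and "I 0 s"
    and step: "\<And>k t. k < vr s V \<Longrightarrow> I k t \<Longrightarrow> vr t v = k \<Longrightarrow> \<forall>i<vr s l. ar t D i = digit \<rho> k i \<Longrightarrow>
      \<forall>x. x \<notin> modv (Odo v V D R l c) \<longrightarrow> vr t x = vr s x \<Longrightarrow>
      \<forall>a. a \<notin> moda (Odo v V D R l c) \<longrightarrow> ar t a = ar s a \<Longrightarrow> I (Suc k) (sem c t)"
  shows "I (vr s V) (sem (Odo v V D R l c) s)"
proof -
  let ?z = "For 14 l l (Set 16 0 ;; Put D 14 16)"
  let ?s = "sem ?z s"
  have z: "\<forall>i<min (vr s l) (vr s l). ar ?s D i = 0"
    by (rule For_inv) (auto simp: less_Suc_eq)
  have fr: "\<forall>x. x \<notin> {14, 15, 16, 17, 18, v} \<longrightarrow> vr ?s x = vr s x" "\<forall>a. a \<noteq> D \<longrightarrow> ar ?s a = ar s a" "ot ?s = ot s"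
    by (auto simp: vr_frame ar_frame ot_frame)
  have sl: "vr ?s l = vr s l" "vr ?s V = vr s V" using assms by (auto simp: vr_frame)
  let ?I = "\<lambda>k t. I k t \<and> (\<forall>i<vr s l. ar t D i = digit \<rho> k i)"
  have "?I (min (vr ?s V) (vr ?s V)) (sem (For v V V (c ;; Odo_inc D R l)) ?s)"
  proof (rule For_inv)
    have "I 0 (upd v 0 ?s)"
      by (rule indep[OF \<open>I 0 s\<close>]) (use fr in auto)
    then show "?I 0 (upd v 0 ?s)" using z by simp
  next
    fix k t assume k: "k < min (vr ?s V) (vr ?s V)" and I: "?I k t" and v: "vr t v = k"
      and f: "\<forall>x. x \<notin> insert v (modv (c ;; Odo_inc D R l)) \<longrightarrow> vr t x = vr ?s x"
        "\<forall>a. a \<notin> moda (c ;; Odo_inc D R l) \<longrightarrow> ar t a = ar ?s a"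
    have "I (Suc k) (sem c t)"
    proof (rule step)
      show "k < vr s V" using k sl by simp
      show "\<forall>x. x \<notin> modv (Odo v V D R l c) \<longrightarrow> vr t x = vr s x"
        using f fr by auto
      show "\<forall>a. a \<notin> moda (Odo v V D R l c) \<longrightarrow> ar t a = ar s a"
        using f fr by auto
    qed (use I v in auto)
    then have 1: "I (Suc k) (upd v (Suc k) (sem Odo_inc' (sem c t)))" if "Odo_inc' = Odo_inc D R l" for Odo_inc'
      by (rule indep) (auto simp: that vr_frame ar_frame ot_frame)
    have l: "vr (sem c t) l = vr s l" and D: "ar (sem c t) D = ar t D" and R: "ar (sem c t) R = ar s R"
      using f sl fr assms by (auto simp: vr_frame ar_frame)
    have "\<forall>i<vr s l. ar (sem (Odo_inc D R l) (sem c t)) D i = digit \<rho> (Suc k) i"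
      using sem_Odo_inc[of D R l "sem c t" \<rho> k] assms I l D R by auto
    with 1 show "?I (Suc k) (upd v (Suc k) (sem (c ;; Odo_inc D R l) t))" by simp
  qed
  then show ?thesis unfolding Odo_def using sl by simp
qed

section \<open>Greedy covers of a block and distribution over the blocks\<close>

lemma set_decode_subset_iff: "S < 2 ^ b \<longleftrightarrow> set_decode S \<subseteq> {..<b}"
proof
  assume S: "S < 2 ^ b"
  show "set_decode S \<subseteq> {..<b}"
  proof
    fix x assume "x \<in> set_decode S"
    then have "S div 2 ^ x \<noteq> 0" by (auto simp: set_decode_def elim: oddE)
    then have "2 ^ x \<le> S" by (meson div_less not_le)
    with S have "(2::nat) ^ x < 2 ^ b" by (rule le_less_trans[rotated])
    then show "x \<in> {..<b}" by simp
  qed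
next
  assume S: "set_decode S \<subseteq> {..<b}"
  have "S = set_encode (set_decode S)" by simp
  also have "\<dots> \<le> set_encode {..<b}"
    unfolding set_encode_def by (rule sum_mono2) (use S in auto)
  also have "\<dots> < 2 ^ b"
    unfolding set_encode_def by (induction b) auto
  finally show "S < 2 ^ b" .
qed

lemma set_encode_less: "A \<subseteq> {..<b} \<Longrightarrow> set_encode A < 2 ^ b"
  using finite_subset[of A "{..<b}"] by (simp add: set_decode_subset_iff)

lemma card_decode_subsets:
  "card {Y. set_decode Y \<subseteq> A \<and> card (set_decode Y) = k} = card A choose k" if "finite A"
proof -
  have "bij_betw set_decode {Y. set_decode Y \<subseteq> A \<and> card (set_decode Y) = k} {B. B \<subseteq> A \<and> card B = k}"
    unfolding bij_betw_def
  proof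
    show "inj_on set_decode {Y. set_decode Y \<subseteq> A \<and> card (set_decode Y) = k}"
      by (rule inj_on_inverseI[of _ set_encode]) simp
    show "set_decode ` {Y. set_decode Y \<subseteq> A \<and> card (set_decode Y) = k} = {B. B \<subseteq> A \<and> card B = k}"
    proof (intro equalityI subsetI)
      fix B assume B: "B \<in> {B. B \<subseteq> A \<and> card B = k}"
      then have "set_decode (set_encode B) = B"
        using that finite_subset[of B A] by (intro set_encode_inverse) simp
      with B show "B \<in> set_decode ` {Y. set_decode Y \<subseteq> A \<and> card (set_decode Y) = k}"
        by (intro image_eqI[of _ _ "set_encode B"]) simp_all
    qed auto
  qed
  from bij_betw_same_card[OF this] show ?thesis using n_subsets[OF that] by simp
qed

text \<open>The size test on \<open>Y\<close> empties this set for codes of the wrong size, so the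
  greedy search may run over all codes below \<open>2 ^ b\<close>.\<close>

definition elig :: "nat \<Rightarrow> nat \<Rightarrow> nat \<Rightarrow> nat \<Rightarrow> nat set" where
  "elig b P Q Y = {S. S < 2 ^ b \<and> card (set_decode S) = P \<and> card (set_decode Y) = Q \<and>
     set_decode Y \<subseteq> set_decode S}"

definition layer :: "nat \<Rightarrow> nat \<Rightarrow> nat set" where
  "layer b P = {S. S < 2 ^ b \<and> card (set_decode S) = P}"

lemma elig_subset_layer: "elig b P Q Y \<subseteq> layer b P"
  by (auto simp: elig_def layer_def)

lemma finite_layer [simp]: "finite (layer b P)"
  by (auto simp: layer_def)

lemma finite_elig [simp]: "finite (elig b P Q Y)"
  by (auto simp: elig_def)

lemma card_layer: "card (layer b P) = b choose P"
  using card_decode_subsets[of "{..<b}" P] by (simp add: layer_def set_decode_subset_iff)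

lemma card_layer_le: "card (layer b P) \<le> 2 ^ b"
  using card_mono[of "{..<2 ^ b}" "layer b P"] by (auto simp: layer_def)

section \<open>Harmonic numbers and greedy set cover\<close>

definition harm :: "nat \<Rightarrow> real" where
  "harm u = (\<Sum>j<u. 1 / real (Suc j))"

text \<open>Each dyadic range of indices contributes at most 1: it has \<open>2 ^ b\<close> terms,
  none above \<open>1 / 2 ^ b\<close>.\<close>

lemma harm_pow2_le: "harm (2 ^ b) \<le> real b + 1"
proof (induction b)
  case (Suc b)
  have "harm (2 ^ Suc b) = harm (2 ^ b) + (\<Sum>j\<in>{2 ^ b..<2 ^ Suc b}. 1 / real (Suc j))"
    unfolding harm_def lessThan_atLeast0 by (rule sum.atLeastLessThan_concat[symmetric]) auto
  also have "(\<Sum>j\<in>{2 ^ b..<2 ^ Suc b}. 1 / real (Suc j)) \<le> (\<Sum>j\<in>{2 ^ b..<2 ^ Suc b :: nat}. 1 / 2 ^ b)"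
  proof (rule sum_mono)
    fix j :: nat assume "j \<in> {2 ^ b..<2 ^ Suc b}"
    then have "2 ^ b \<le> Suc j" by simp
    then have "(2::real) ^ b \<le> real (Suc j)" by (metis of_nat_le_iff of_nat_numeral of_nat_power)
    then show "1 / real (Suc j) \<le> 1 / 2 ^ b" by (intro divide_left_mono) auto
  qed
  also have "\<dots> = 1" by simp
  finally show ?case using Suc by simp
qed (simp add: harm_def)

lemma harm_mono: "u \<le> v \<Longrightarrow> harm u \<le> harm v"
  unfolding harm_def by (rule sum_mono2) auto

lemma harm_diff_ge: "u > 0 \<Longrightarrow> t \<le> u \<Longrightarrow> real t / real u \<le> harm u - harm (u - t)"
proof -
  assume u: "u > 0" "t \<le> u"
  have "real t / real u = (\<Sum>j\<in>{u - t..<u}. 1 / real u)" using u by simp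
  also have "\<dots> \<le> (\<Sum>j\<in>{u - t..<u}. 1 / real (Suc j))"
    by (intro sum_mono divide_left_mono) auto
  also have "\<dots> = harm u - harm (u - t)"
    unfolding harm_def lessThan_atLeast0
    using sum.atLeastLessThan_concat[of 0 "u - t" u "\<lambda>j. 1 / real (Suc j)"] by simp
  finally show ?thesis .
qed

text \<open>Each set of the layer is eligible for the same number of members, so some member covers at
  least the average number of the sets that are still uncovered.\<close>

lemma uncovered_le:
  assumes "\<And>Y. Y < 2 ^ b \<Longrightarrow> card (elig b P Q Y - C) \<le> t"
  shows "card (layer b P - C) * (P choose Q) \<le> (b choose Q) * t"
proof -
  let ?U = "layer b P - C"
  have *: "{Y \<in> {..<2 ^ b}. S \<in> elig b P Q Y} = {Y. set_decode Y \<subseteq> set_decode S \<and> card (set_decode Y) = Q}"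
    if "S \<in> ?U" for S
    using that by (auto simp: elig_def layer_def set_decode_subset_iff)
  \<comment> \<open>Double counting of the pairs of an uncovered set and a member inside it; each
    uncovered set contains \<open>P choose Q\<close> possible members.\<close>
  have "card ?U * (P choose Q) = (\<Sum>S\<in>?U. card {Y \<in> {..<2 ^ b}. S \<in> elig b P Q Y})"
    using * by (simp add: card_decode_subsets layer_def)
  also have "\<dots> = (\<Sum>S\<in>?U. \<Sum>Y<2 ^ b. if S \<in> elig b P Q Y then 1 else 0)"
    by (simp add: sum.If_cases Int_def)
  also have "\<dots> = (\<Sum>Y<2 ^ b. \<Sum>S\<in>?U. if S \<in> elig b P Q Y then 1 else 0)"
    by (rule sum.swap)
  also have "\<dots> = (\<Sum>Y<2 ^ b. card (elig b P Q Y - C))"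
  proof (rule sum.cong[OF refl])
    fix Y
    have "{S \<in> ?U. S \<in> elig b P Q Y} = elig b P Q Y - C" using elig_subset_layer by blast
    then show "(\<Sum>S\<in>?U. if S \<in> elig b P Q Y then 1 else 0) = card (elig b P Q Y - C)"
      by (simp add: sum.If_cases Int_def)
  qed
  also have "\<dots> \<le> (\<Sum>Y<2 ^ b. if Y \<in> layer b Q then t else 0)"
  proof (rule sum_mono)
    fix Y :: nat assume Y: "Y \<in> {..<2 ^ b}"
    show "card (elig b P Q Y - C) \<le> (if Y \<in> layer b Q then t else 0)"
    proof (cases "Y \<in> layer b Q")
      case False
      then have "elig b P Q Y = {}" using Y by (auto simp: elig_def layer_def)
      then show ?thesis by simp
    qed (use assms Y in auto)
  qed
  also have "\<dots> = card ({..<2 ^ b} \<inter> layer b Q) * t"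
    by (simp add: sum.If_cases)
  also have "{..<2 ^ b} \<inter> layer b Q = layer b Q" by (auto simp: layer_def)
  finally show ?thesis by (simp add: card_layer)
qed

text \<open>Greedy set cover with decreasing threshold \<open>t\<close>: a member is chosen when it covers at least
  \<open>t\<close> uncovered sets. As every member covers at most \<open>t\<close> of them, this is the maximum, and the
  harmonic potential drops by at least \<open>1 / kappa b P Q\<close> with every choice.\<close>

definition greedy_inv :: "nat \<Rightarrow> nat \<Rightarrow> nat \<Rightarrow> nat \<Rightarrow> nat \<Rightarrow> nat list \<Rightarrow> nat set \<Rightarrow> bool" where
  "greedy_inv b P Q t y F C \<longleftrightarrow> C = (\<Union>Y\<in>set F. elig b P Q Y) \<and>
     (\<forall>Y\<in>set F. Y < 2 ^ b \<and> card (set_decode Y) = Q) \<and> length F \<le> card C \<and>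
     (\<forall>Y<2 ^ b. card (elig b P Q Y - C) \<le> t) \<and> (\<forall>Y<y. card (elig b P Q Y - C) < t) \<and>
     real (length F) + kappa b P Q * harm (card (layer b P - C)) \<le> kappa b P Q * harm (card (layer b P))"

lemma greedy_inv_start: "greedy_inv b P Q (2 ^ b) 0 [] {}"
proof -
  have "card (elig b P Q Y) \<le> 2 ^ b" for Y
    using card_mono[OF finite_layer elig_subset_layer] card_layer_le le_trans by blast
  then show ?thesis by (simp add: greedy_inv_def)
qed

lemma greedy_inv_skip:
  "greedy_inv b P Q t y F C \<Longrightarrow> card (elig b P Q y - C) < t \<Longrightarrow> greedy_inv b P Q t (Suc y) F C"
  by (auto simp: greedy_inv_def less_Suc_eq)

lemma greedy_inv_pass:
  "greedy_inv b P Q t (2 ^ b) F C \<Longrightarrow> greedy_inv b P Q (t - 1) 0 F C"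
  unfolding greedy_inv_def by fastforce

text \<open>The invariant forces the choice to cover exactly \<open>t\<close> of the
  \<open>u\<close> uncovered sets. Averaging gives \<open>u \<le> kappa b P Q * t\<close>, so the
  potential drops by at least \<open>kappa b P Q * t / u\<close>, which is at least 1 and pays for
  the new member.\<close>

lemma greedy_inv_take:
  assumes inv: "greedy_inv b P Q t y F C" and y: "y < 2 ^ b" and t: "t \<ge> 1"
    and ge: "t \<le> card (elig b P Q y - C)"
  shows "greedy_inv b P Q t (Suc y) (F @ [y]) (C \<union> elig b P Q y)"
proof -
  let ?E = "elig b P Q" and ?C = "C \<union> elig b P Q y" and ?\<kappa> = "kappa b P Q"
  let ?u = "card (layer b P - C)"
  have C: "C = (\<Union>Y\<in>set F. ?E Y)" using inv by (simp add: greedy_inv_def)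
  have finC: "finite C" unfolding C by auto
  have eq: "card (?E y - C) = t" using inv ge y by (auto simp: greedy_inv_def intro: antisym)
  then have "card (?E y - C) \<noteq> 0" using t by linarith
  then have "?E y - C \<noteq> {}" by (metis card.empty)
  then obtain S where S: "S \<in> ?E y" by blast
  \<comment> \<open>The newly covered set has size \<open>P\<close> and contains the set coded by
    \<open>y\<close>, whence \<open>Q \<le> P\<close> and the denominator of \<open>kappa\<close> is
    positive.\<close>
  then have yQ: "card (set_decode y) = Q" and QP: "Q \<le> P"
    unfolding elig_def using card_mono[OF finite_set_decode] by fastforce+
  have mono: "card (?E Y - ?C) \<le> card (?E Y - C)" for Y
    by (intro card_mono) auto
  have 0: "card (?E y - ?C) = 0" by simp
  have "length F \<le> card C" using inv unfolding greedy_inv_def by blast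
  moreover have "card ?C = card C + t"
    using eq finC card_Un_disjoint[of C "?E y - C"] by (simp add: Un_Diff_cancel)
  ultimately have len: "length (F @ [y]) \<le> card ?C" using t by simp
  have "layer b P - ?C = (layer b P - C) - (?E y - C)" by blast
  moreover have sub: "?E y - C \<subseteq> layer b P - C" using elig_subset_layer by blast
  ultimately have card': "card (layer b P - ?C) = ?u - t" and tu: "t \<le> ?u"
    using card_Diff_subset[of "?E y - C" "layer b P - C"] card_mono[OF _ sub] eq by auto
  have "?u * (P choose Q) \<le> (b choose Q) * t"
    using inv by (intro uncovered_le) (auto simp: greedy_inv_def)
  then have "real ?u * real (P choose Q) \<le> real (b choose Q) * real t"
    by (metis of_nat_le_iff of_nat_mult)
  then have "real ?u \<le> ?\<kappa> * real t"
    using QP by (simp add: kappa_def field_simps)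
  then have "1 \<le> ?\<kappa> * (real t / real ?u)"
    using tu t by (simp add: field_simps)
  also have "\<dots> \<le> ?\<kappa> * (harm ?u - harm (?u - t))"
    using tu t by (intro mult_left_mono harm_diff_ge) (auto simp: kappa_def)
  finally have "1 \<le> ?\<kappa> * (harm ?u - harm (?u - t))" .
  moreover have "real (length F) + ?\<kappa> * harm ?u \<le> ?\<kappa> * harm (card (layer b P))"
    using inv unfolding greedy_inv_def by blast
  ultimately have "real (length (F @ [y])) + ?\<kappa> * harm (card (layer b P - ?C)) \<le> ?\<kappa> * harm (card (layer b P))"
    unfolding card' by (simp add: algebra_simps)
  moreover have "\<forall>Y<2 ^ b. card (?E Y - ?C) \<le> t"
    using inv mono le_trans unfolding greedy_inv_def by blast
  moreover have "card (?E Y - ?C) < t" if "Y < Suc y" for Y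
  proof (cases "Y = y")
    case False
    then have "card (?E Y - C) < t" using that inv unfolding greedy_inv_def by auto
    then show ?thesis using mono le_less_trans by blast
  next
    case True
    then show ?thesis using 0 t by (simp only:)
  qed
  moreover have "?C = (\<Union>Y\<in>set (F @ [y]). ?E Y)" unfolding C by auto
  moreover have "\<forall>Y\<in>set (F @ [y]). Y < 2 ^ b \<and> card (set_decode Y) = Q"
    using inv y yQ unfolding greedy_inv_def by auto
  ultimately show ?thesis
    using len unfolding greedy_inv_def by blast
qed

text \<open>For \<open>Q > P\<close> the denominator of \<open>kappa\<close> is 0, hence so is
  \<open>kappa\<close>, and the list must be empty. The bound \<open>2 ^ b\<close> is the length of
  the array segment reserved for one family.\<close>

definition block_family :: "nat \<Rightarrow> nat \<Rightarrow> nat \<Rightarrow> nat list \<Rightarrow> bool" where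
  "block_family b P Q F \<longleftrightarrow> (\<forall>Y\<in>set F. Y < 2 ^ b \<and> card (set_decode Y) = Q) \<and> length F \<le> 2 ^ b \<and>
     real (length F) \<le> kappa b P Q * (real b + 1) \<and>
     (Q \<le> P \<longrightarrow> (\<forall>S<2 ^ b. card (set_decode S) = P \<longrightarrow> (\<exists>Y\<in>set F. set_decode Y \<subseteq> set_decode S)))"

lemma greedy_inv_length:
  assumes "greedy_inv b P Q t y F C"
  shows "length F \<le> 2 ^ b"
proof -
  have "C \<subseteq> layer b P" using assms elig_subset_layer unfolding greedy_inv_def by blast
  then have "card C \<le> card (layer b P)" by (intro card_mono) auto
  then show ?thesis using assms card_layer_le[of b P] unfolding greedy_inv_def by linarith
qed

text \<open>At threshold 0 no code covers an uncovered set. A set of size \<open>P \<ge> Q\<close>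
  is eligible for each of its subsets of size \<open>Q\<close>, so it must have been
  covered.\<close>

lemma greedy_inv_end:
  assumes "greedy_inv b P Q 0 y F C"
  shows "block_family b P Q F"
  unfolding block_family_def
proof (intro conjI impI allI)
  show "length F \<le> 2 ^ b" using assms by (rule greedy_inv_length)
  show "\<forall>Y\<in>set F. Y < 2 ^ b \<and> card (set_decode Y) = Q"
    using assms by (auto simp: greedy_inv_def)
  have "kappa b P Q \<ge> 0" by (simp add: kappa_def)
  moreover have "harm (card (layer b P)) \<le> real b + 1"
    using harm_mono[OF card_layer_le] harm_pow2_le order_trans by blast
  moreover have "harm k \<ge> 0" for k by (simp add: harm_def sum_nonneg)
  ultimately have "kappa b P Q * harm (card (layer b P)) \<le> kappa b P Q * (real b + 1)"
    "0 \<le> kappa b P Q * harm (card (layer b P - C))"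
    by (auto intro: mult_left_mono)
  then show "real (length F) \<le> kappa b P Q * (real b + 1)"
    using assms unfolding greedy_inv_def by linarith
next
  fix S assume Q: "Q \<le> P" and S: "S < 2 ^ b" "card (set_decode S) = P"
  obtain A where A: "A \<subseteq> set_decode S" "card A = Q"
    using Q S obtain_subset_with_card_n by metis
  let ?Y = "set_encode A"
  have fin: "finite A" using A finite_subset finite_set_decode by blast
  then have Y: "set_decode ?Y = A" by simp
  have "?Y < 2 ^ b" using A S by (intro set_encode_less) (auto simp: set_decode_subset_iff)
  then have "elig b P Q ?Y - C = {}"
    using assms by (auto simp: greedy_inv_def)
  moreover have "S \<in> elig b P Q ?Y" using S A Y by (simp add: elig_def)
  ultimately have "S \<in> C" by blast
  then obtain Y' where "Y' \<in> set F" "S \<in> elig b P Q Y'" using assms by (auto simp: greedy_inv_def)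
  then show "\<exists>Y\<in>set F. set_decode Y \<subseteq> set_decode S" by (auto simp: elig_def)
qed

text \<open>By Vandermonde's identity both \<open>n\<^sub>1 + n\<^sub>2\<close> choose \<open>q\<close> and \<open>p\<^sub>1 + p\<^sub>2\<close> choose \<open>q\<close> are sums over
  the ways to split \<open>q\<close>, so some split has at most the ratio of the sums.\<close>

lemma kappa_split:
  assumes "p1 \<le> n1" "p2 \<le> n2" "q \<le> p1 + p2"
  shows "\<exists>k\<le>q. k \<le> p1 \<and> q - k \<le> p2 \<and> kappa n1 p1 k * kappa n2 p2 (q - k) \<le> kappa (n1 + n2) (p1 + p2) q"
proof (rule ccontr)
  assume neg: "\<not> ?thesis"
  define A where "A k = real (n1 choose k) * real (n2 choose (q - k))" for k
  define B where "B k = real (p1 choose k) * real (p2 choose (q - k))" for k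
  define \<kappa> where "\<kappa> = kappa (n1 + n2) (p1 + p2) q"
  have A: "(\<Sum>k\<le>q. A k) = real ((n1 + n2) choose q)" and B: "(\<Sum>k\<le>q. B k) = real ((p1 + p2) choose q)"
    unfolding A_def B_def of_nat_mult[symmetric] of_nat_sum[symmetric] vandermonde by simp_all
  have less: "\<kappa> * B k < A k" if "k \<le> q" "B k > 0" for k
  proof -
    have k: "k \<le> p1" "q - k \<le> p2" using that(2)
      by (auto simp: B_def zero_less_mult_iff)
    then have "\<kappa> < kappa n1 p1 k * kappa n2 p2 (q - k)"
      using neg that(1) unfolding \<kappa>_def by auto
    also have "\<dots> = A k / B k" by (simp add: kappa_def A_def B_def)
    finally show ?thesis using that(2) by (simp add: field_simps)
  qed
  have le: "\<kappa> * B k \<le> A k" if "k \<le> q" for k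
  proof (cases "B k > 0")
    case True
    then show ?thesis using less that by (simp add: less_imp_le)
  next
    case False
    then have "B k = 0" by (auto simp: B_def not_less mult_le_0_iff)
    then show ?thesis by (simp add: A_def)
  qed
  \<comment> \<open>As \<open>q \<le> p1 + p2\<close>, some split has \<open>B k > 0\<close>. It
    makes the summed inequality strict, against Vandermonde's identity, and splits with
    \<open>B k = 0\<close> do no harm.\<close>
  have "(\<Sum>k\<le>q. B k) > 0" unfolding B using assms by simp
  then obtain k where k: "k \<le> q" "B k > 0"
    by (metis atMost_iff not_less sum_nonpos)
  have "\<kappa> * (\<Sum>k\<le>q. B k) < (\<Sum>k\<le>q. A k)"
    unfolding sum_distrib_left using less[OF k] le k(1)
    by (intro sum_strict_mono_ex1) auto
  moreover have "\<kappa> * (\<Sum>k\<le>q. B k) = (\<Sum>k\<le>q. A k)"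
    unfolding A B \<kappa>_def kappa_def using assms by simp
  ultimately show False by simp
qed

text \<open>By induction: all blocks but the last are treated as one universe and split against the
  last one; the induction hypothesis distributes their share.\<close>

lemma kappa_split_blocks:
  assumes "\<And>i. i < m \<Longrightarrow> p i \<le> b" "q \<le> (\<Sum>i<m. p i)"
  shows "\<exists>qv. (\<forall>i<m. qv i \<le> p i) \<and> (\<Sum>i<m. qv i) = q \<and>
    (\<Prod>i<m. kappa b (p i) (qv i)) \<le> kappa (m * b) (\<Sum>i<m. p i) q"
  using assms
proof (induction m arbitrary: q)
  case 0
  then show ?case by (auto simp: kappa_def)
next
  case (Suc m)
  have "(\<Sum>i<m. p i) \<le> (\<Sum>i<m. b)" using Suc.prems by (intro sum_mono) auto
  then obtain k where k: "k \<le> q" "k \<le> (\<Sum>i<m. p i)" "q - k \<le> p m"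
    "kappa (m * b) (\<Sum>i<m. p i) k * kappa b (p m) (q - k) \<le> kappa (m * b + b) ((\<Sum>i<m. p i) + p m) q"
    using kappa_split[of "\<Sum>i<m. p i" "m * b" "p m" b q] Suc.prems by auto
  obtain qv where qv: "\<forall>i<m. qv i \<le> p i" "(\<Sum>i<m. qv i) = k"
    "(\<Prod>i<m. kappa b (p i) (qv i)) \<le> kappa (m * b) (\<Sum>i<m. p i) k"
    using Suc.IH[of k] Suc.prems k by auto
  let ?qv = "qv(m := q - k)"
  have "(\<Prod>i<Suc m. kappa b (p i) (?qv i)) = (\<Prod>i<m. kappa b (p i) (qv i)) * kappa b (p m) (q - k)"
    by simp
  also have "\<dots> \<le> kappa (m * b) (\<Sum>i<m. p i) k * kappa b (p m) (q - k)"
    by (intro mult_right_mono qv) (simp add: kappa_def)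
  also have "\<dots> \<le> kappa (Suc m * b) (\<Sum>i<Suc m. p i) q"
    using k by (simp add: add.commute)
  finally show ?case using qv k by (intro exI[of _ ?qv]) (auto simp: less_Suc_eq)
qed

text \<open>Profiles with sum above \<open>p\<close> are searched as well; their ratio is no worse
  than the one for \<open>p\<close>.\<close>

lemma kappa_antimono: "q \<le> p \<Longrightarrow> p \<le> p' \<Longrightarrow> kappa n p' q \<le> kappa n p q"
  unfolding kappa_def by (intro divide_left_mono) (auto intro: binomial_right_mono)

lemma choose_Suc_le: "q \<le> n \<Longrightarrow> Suc n choose q \<le> Suc n * (n choose q)"
proof (cases q)
  case (Suc k)
  assume "q \<le> n"
  have "n choose k \<le> (n choose k) * (n - k)" using Suc \<open>q \<le> n\<close> by simp
  also have "\<dots> = (n choose Suc k) * Suc k"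
    using binomial_absorb_comp[of n k] binomial_absorption[of k n] by (simp only: mult.commute)
  also have "\<dots> \<le> (n choose Suc k) * n" using Suc \<open>q \<le> n\<close> by (intro mult_le_mono2) simp
  finally show ?thesis using Suc by (simp add: algebra_simps)
qed simp

lemma choose_add_le: "q \<le> n \<Longrightarrow> (n + j) choose q \<le> (n + j) ^ j * (n choose q)"
proof (induction j)
  case (Suc j)
  have "(n + Suc j) choose q \<le> (n + Suc j) * ((n + j) choose q)"
    using choose_Suc_le[of q "n + j"] Suc.prems by simp
  also have "\<dots> \<le> (n + Suc j) * ((n + j) ^ j * (n choose q))"
    using Suc by (intro mult_le_mono2) simp
  also have "\<dots> \<le> (n + Suc j) * ((n + Suc j) ^ j * (n choose q))"
    by (intro mult_le_mono mult_le_mono1 power_mono) auto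
  finally show ?case by (simp only: power_Suc mult.assoc)
qed simp

text \<open>This is the price of padding: for \<open>j\<close> of order \<open>log n\<close> the
  factor is only \<open>2 powr O((log n)^2)\<close>.\<close>

lemma kappa_add_le:
  assumes "q \<le> n"
  shows "kappa (n + j) p q \<le> kappa n p q * real ((n + j) ^ j)"
proof -
  have "real ((n + j) choose q) \<le> real ((n + j) ^ j * (n choose q))"
    using choose_add_le[OF assms] by (simp only: of_nat_le_iff)
  then show ?thesis unfolding kappa_def by (simp add: divide_right_mono mult.commute)
qed

lemma kappa_ge_1: "q \<le> p \<Longrightarrow> p \<le> n \<Longrightarrow> 1 \<le> kappa n p q"
  unfolding kappa_def by (simp add: binomial_right_mono)

text \<open>Elements are numbered from 1, which leaves 0 free to terminate a printed set.\<close>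

definition place :: "nat \<Rightarrow> nat \<Rightarrow> (nat \<Rightarrow> nat set) \<Rightarrow> nat set" where
  "place b m D = {i * b + x + 1 | i x. i < m \<and> x \<in> D i}"

lemma index_eq_iff:
  fixes x y :: nat
  assumes "x < b" "y < b"
  shows "i * b + x = j * b + y \<longleftrightarrow> i = j \<and> x = y"
proof
  assume eq: "i * b + x = j * b + y"
  have "(i * b + x) div b = i" "(i * b + x) mod b = x" "(j * b + y) div b = j" "(j * b + y) mod b = y"
    using assms by auto
  with eq show "i = j \<and> x = y" by simp
qed simp

lemma card_place:
  assumes "\<And>i. i < m \<Longrightarrow> D i \<subseteq> {..<b}"
  shows "card (place b m D) = (\<Sum>i<m. card (D i))" "finite (place b m D)"
proof -
  let ?f = "\<lambda>(i, x). i * b + x + 1"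
  have eq: "place b m D = ?f ` (SIGMA i:{..<m}. D i)" by (auto simp: place_def image_iff)
  have "inj_on ?f (SIGMA i:{..<m}. D i)"
  proof (rule inj_onI)
    fix u v assume "u \<in> (SIGMA i:{..<m}. D i)" "v \<in> (SIGMA i:{..<m}. D i)" "?f u = ?f v"
    then show "u = v"
      using assms[of "fst u"] assms[of "fst v"] index_eq_iff[of "snd u" b "snd v" "fst u" "fst v"]
      by (auto simp: subset_iff)
  qed
  then show "card (place b m D) = (\<Sum>i<m. card (D i))"
    unfolding eq using assms by (subst card_image) (auto intro!: card_SigmaI finite_subset[of _ "{..<b}"])
  show "finite (place b m D)" unfolding eq
    by (intro finite_imageI finite_SigmaI) (use assms in \<open>auto intro: finite_subset[of _ "{..<b}"]\<close>)
qed

lemma place_blocks: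
  assumes "S \<subseteq> {1..n}" "n \<le> m * b"
  shows "place b m (\<lambda>i. {x. x < b \<and> i * b + x + 1 \<in> S}) = S"
proof
  show "place b m (\<lambda>i. {x. x < b \<and> i * b + x + 1 \<in> S}) \<subseteq> S" by (auto simp: place_def)
  show "S \<subseteq> place b m (\<lambda>i. {x. x < b \<and> i * b + x + 1 \<in> S})"
  proof
    fix e assume e: "e \<in> S"
    then have e1: "1 \<le> e" "e - 1 < m * b" using assms by fastforce+
    then have b: "b > 0" by (cases b) auto
    have "(e - 1) div b < m" using e1 b by (simp add: less_mult_imp_div_less)
    moreover have "(e - 1) div b * b + (e - 1) mod b + 1 = e" using e1 by simp
    ultimately show "e \<in> place b m (\<lambda>i. {x. x < b \<and> i * b + x + 1 \<in> S})"
      unfolding place_def using e b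
      by (intro CollectI exI[of _ "(e - 1) div b"] exI[of _ "(e - 1) mod b"]) auto
  qed
qed

section \<open>Parameters and bit tables\<close>

text \<open>
  Variables: \<open>0, 1, 2\<close> hold the input \<open>n, p, q\<close>; \<open>3, 4, 5\<close> hold \<open>b\<close>, \<open>b + 1\<close>, \<open>2^b\<close>; \<open>6\<close> holds \<open>m\<close>,
  \<open>7\<close> the number \<open>(b + 1)^m\<close> of profiles, \<open>8\<close> the cap \<open>4^b\<close> of the additions, \<open>9\<close> the number 2,
  \<open>10\<close> the cost threshold \<open>W\<close> and \<open>11\<close> its power \<open>2^W\<close>. A result flag is returned in \<open>37\<close>.

  Arrays: \<open>0\<close> and \<open>1\<close> are constantly \<open>b + 1\<close> and 2 (radices), \<open>2\<close> has bit \<open>x\<close> of the set coded by \<open>Y\<close> at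
  \<open>Y * b + x\<close>; with \<open>d = P * (b + 1) + Q\<close>, the arrays \<open>3\<close> and \<open>4\<close> have at \<open>d\<close> the size of \<open>F P Q\<close> and its
  rounded binary logarithm, and \<open>5\<close> has the members of \<open>F P Q\<close> from \<open>d * 2^b\<close> on; \<open>7\<close> marks covered
  sets; \<open>8\<close> and \<open>9\<close> are the current profile and split, \<open>11\<close> selects a member of each block family
  (radices in \<open>10\<close>), and \<open>12\<close> has the selected members.
\<close>

definition Pow :: "nat \<Rightarrow> nat \<Rightarrow> nat \<Rightarrow> com" where
  "Pow z x e = Set z 1 ;;
     For 20 e e (Mov 21 z ;; Set z 0 ;; For 22 x x (For 23 21 21 (Inc z)))"

lemma mod_Pow [simp]: "modv (Pow z x e) = {20, 21, 22, 23, z}" "moda (Pow z x e) = {}"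
  "silent (Pow z x e)"
  by (auto simp: Pow_def)

lemma sem_Pow:
  assumes "z \<notin> {20..23}" "x \<notin> {20..23}" "e \<notin> {20..23}" "z \<noteq> x" "z \<noteq> e" "vr s x \<ge> 1"
  shows "vr (sem (Pow z x e) s) z = vr s x ^ vr s e"
    and "steps (Pow z x e) s \<le> 10 * (vr s e + 1) * (vr s x + 1) * (vr s x ^ vr s e + 1)"
proof -
  define X where "X = vr s x"
  let ?c = "Mov 21 z ;; Set z 0 ;; For 22 x x (For 23 21 21 (Inc z))"
  define s1 where "s1 = upd z 1 s"
  have z: "z \<noteq> 20" "z \<noteq> 21" "z \<noteq> 22" "z \<noteq> 23" "x \<noteq> 20" "x \<noteq> 21" "x \<noteq> 22" "x \<noteq> 23" "e \<noteq> 20" "x \<noteq> z" "e \<noteq> z"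
    using assms by auto
  have s1: "vr s1 x = X" "vr s1 z = 1" using z by (auto simp: s1_def X_def)
  have mult: "vr (sem (For 22 x x (For 23 21 21 (Inc z))) t) z = vr t z + vr t x * vr t 21" for t
  proof -
    have inner: "vr (sem (For 23 21 21 (Inc z)) t) z = vr t z + vr t 21" for t
    proof -
      have "vr (sem (For 23 21 21 (Inc z)) t) z = vr t z + min (vr t 21) (vr t 21)"
        by (rule For_inv[where I = "\<lambda>k t'. vr t' z = vr t z + k"]) (use z in auto)
      then show ?thesis by simp
    qed
    have "vr (sem (For 22 x x (For 23 21 21 (Inc z))) t) z = vr t z + min (vr t x) (vr t x) * vr t 21"
      by (rule For_inv[where I = "\<lambda>k t'. vr t' z = vr t z + k * vr t 21"])
        (use z in \<open>auto simp: inner\<close>)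
    then show ?thesis by simp
  qed
  have inv: "vr (iter 20 (sem ?c) s1 k) z = X ^ k" for k
  proof (induction k)
    case (Suc k)
    have "vr (iter 20 (sem ?c) s1 k) x = X"
      using z by (subst vr_iter_frame) (auto simp: s1 vr_frame)
    then show ?case using Suc z by (simp add: mult)
  qed (use z s1 in auto)
  then show "vr (sem (Pow z x e) s) z = vr s x ^ vr s e"
    using z by (simp add: Pow_def sem.simps(11) X_def s1_def)
  have le: "X ^ k \<le> X ^ vr s e" if "k \<le> vr s e" for k
    using that assms(6) by (intro power_increasing) (auto simp: X_def)
  let ?B = "5 * ((X + 1) * (X ^ vr s e + 1))"
  have body: "steps ?c (iter 20 (sem ?c) s1 k) \<le> 2 + ?B" if "k < vr s e" for k
  proof -
    let ?t = "iter 20 (sem ?c) s1 k"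
    let ?t' = "upd z 0 (upd 21 (vr ?t z) ?t)"
    have "vr ?t x = X"
      using z by (subst vr_iter_frame) (auto simp: s1 vr_frame)
    then have "steps (For 22 x x (For 23 21 21 (Inc z))) ?t'
       \<le> csize (For 22 x x (For 23 21 21 (Inc z))) *
        ((X + 1) ^ depth (- {21}) (For 22 x x (For 23 21 21 (Inc z))) *
          (X ^ vr s e + 1) ^ depth {21} (For 22 x x (For 23 21 21 (Inc z))))"
      using z inv le[of k] that by (intro steps_le) auto
    then show ?thesis using z by simp
  qed
  have "(\<Sum>k<vr s e. Suc (steps ?c (iter 20 (sem ?c) s1 k))) \<le> (\<Sum>k<vr s e. 3 + ?B)"
  proof (rule sum_mono)
    fix k assume "k \<in> {..<vr s e}"
    then have "k < vr s e" by simp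
    then show "Suc (steps ?c (iter 20 (sem ?c) s1 k)) \<le> 3 + ?B" using body[of k] by linarith
  qed
  then have "steps (Pow z x e) s \<le> 3 + vr s e * (3 + ?B)"
    using z by (simp add: Pow_def steps.simps(11) s1_def)
  also have "\<dots> \<le> 10 * (vr s e + 1) * ((X + 1) * (X ^ vr s e + 1))"
    by (simp add: algebra_simps)
  finally show "steps (Pow z x e) s \<le> 10 * (vr s e + 1) * (vr s x + 1) * (vr s x ^ vr s e + 1)"
    by (simp only: X_def mult.assoc)
qed

definition Size :: com where
  "Size = Set 3 0 ;; Set 5 1 ;;
     For 20 0 0 (Sb 16 5 0 ;; If 16 Skip (Mov 21 5 ;; For 22 21 0 (Inc 5) ;; Inc 3))"

definition Caps :: com where
  "Caps = Mov 4 3 ;; Inc 4 ;; Set 9 2 ;; Set 8 0 ;; For 20 5 5 (For 21 5 5 (Inc 8))"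

definition Count :: com where
  "Count = Set 6 0 ;; Set 16 0 ;;
     For 20 0 0 (Sb 17 0 16 ;; If 17 (AddTo 16 3 ;; Inc 6) Skip)"

lemma mod_setup [simp]:
  "modv Size = {3, 5, 16, 20, 21, 22}" "moda Size = {}" "silent Size"
  "modv Caps = {4, 8, 9, 20, 21}" "moda Caps = {}" "silent Caps"
  "modv Count = {6, 12, 16, 17, 20}" "moda Count = {}" "silent Count"
  by (auto simp: Size_def Caps_def Count_def)

lemma sem_Size:
  assumes "vr s 0 = n"
  shows "\<exists>b. vr (sem Size s) 3 = b \<and> vr (sem Size s) 5 = 2 ^ b \<and> n < 2 ^ b \<and> (b = 0 \<or> 2 ^ b \<le> 2 * n)"
proof -
  let ?c = "Sb 16 5 0 ;; If 16 Skip (Mov 21 5 ;; For 22 21 0 (Inc 5) ;; Inc 3)"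
  let ?s = "upd 5 1 (upd 3 0 s)"
  have add: "vr (sem (For 22 21 0 (Inc 5)) t) 5 = vr t 5 + min (vr t 21) (vr t 0)" for t
    by (rule For_inv[where I = "\<lambda>k t'. vr t' 5 = vr t 5 + k"]) auto
  let ?I = "\<lambda>k (t :: st). vr t 0 = n \<and> vr t 5 = 2 ^ vr t 3 \<and> (vr t 3 = k \<or> n < 2 ^ vr t 3) \<and>
    (vr t 3 = 0 \<or> 2 ^ vr t 3 \<le> 2 * n)"
  have "?I (min (vr ?s 0) (vr ?s 0)) (sem (For 20 0 0 ?c) ?s)"
    by (rule For_inv) (use assms in \<open>auto simp: add vr_frame\<close>)
  \<comment> \<open>If all \<open>n\<close> rounds double, then \<open>b = n\<close>, so
    \<open>n < 2 ^ b\<close> holds in this case too.\<close>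
  moreover have "n < 2 ^ n" by (rule less_exp)
  ultimately show ?thesis using assms by (auto simp: Size_def)
qed

lemma sem_Caps:
  "vr (sem Caps s) 4 = Suc (vr s 3)" "vr (sem Caps s) 9 = 2" "vr (sem Caps s) 8 = vr s 5 * vr s 5"
proof -
  have inner: "vr (sem (For 21 5 5 (Inc 8)) t) 8 = vr t 8 + min (vr t 5) (vr t 5)" for t
    by (rule For_inv[where I = "\<lambda>k t'. vr t' 8 = vr t 8 + k"]) auto
  have outer: "vr (sem (For 20 5 5 (For 21 5 5 (Inc 8))) t) 8 = vr t 8 + min (vr t 5) (vr t 5) * vr t 5" for t
    by (rule For_inv[where I = "\<lambda>k t'. vr t' 8 = vr t 8 + k * vr t 5"]) (auto simp: inner)
  show "vr (sem Caps s) 4 = Suc (vr s 3)" "vr (sem Caps s) 9 = 2" "vr (sem Caps s) 8 = vr s 5 * vr s 5"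
    by (auto simp: Caps_def outer vr_frame)
qed

lemma sem_Count:
  assumes "vr s 0 = n" "vr s 3 = b" "b \<le> vr s 8" "b \<ge> 1 \<or> n = 0"
  shows "\<exists>m. vr (sem Count s) 6 = m \<and> n \<le> m * b \<and> m * b \<le> n + b \<and> m \<le> n"
proof -
  let ?c = "Sb 17 0 16 ;; If 17 (AddTo 16 3 ;; Inc 6) Skip"
  let ?s = "upd 16 0 (upd 6 0 s)"
  let ?I = "\<lambda>k (t :: st). vr t 0 = n \<and> vr t 3 = b \<and> b \<le> vr t 8 \<and> vr t 16 = vr t 6 * b \<and> vr t 6 \<le> k \<and>
    (vr t 6 = k \<or> n \<le> vr t 16) \<and> vr t 16 \<le> n + b"
  have "?I (min (vr ?s 0) (vr ?s 0)) (sem (For 20 0 0 ?c) ?s)"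
    by (rule For_inv) (use assms in \<open>auto simp: sem_AddTo\<close>)
  moreover have "n \<le> n * b" using assms(4) by auto
  ultimately show ?thesis using assms by (auto simp: Count_def)
qed

section \<open>Bit tables and the eligibility test\<close>

definition Bits :: com where
  "Bits = For 20 6 6 (Put 0 20 4) ;; For 20 3 3 (Put 1 20 9) ;;
     Odo 25 5 6 1 3 (For 19 3 3 (Idx 16 25 3 19 ;; Get 17 6 19 ;; Put 2 16 17))"

text \<open>Subtraction is truncated, so both differences are tested. The flag is only ever raised,
  which lets several tests share it.\<close>

definition Neq :: "nat \<Rightarrow> nat \<Rightarrow> com" where
  "Neq x y = Sb 16 x y ;; If 16 (Set 37 1) Skip ;; Sb 16 y x ;; If 16 (Set 37 1) Skip"

lemma mod_Neq [simp]: "modv (Neq x y) = {16, 37}" "moda (Neq x y) = {}" "silent (Neq x y)"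
  by (auto simp: Neq_def)

lemma sem_Neq:
  assumes "x \<noteq> 16" "y \<noteq> 16" "x \<noteq> 37" "y \<noteq> 37"
  shows "vr (sem (Neq x y) s) 37 = 0 \<longleftrightarrow> vr s 37 = 0 \<and> vr s x = vr s y"
  using assms by (auto simp: Neq_def)

definition Rel :: com where
  "Rel = Set 37 0 ;; Set 39 0 ;; Set 40 0 ;;
     For 19 3 3 (Idx 16 34 3 19 ;; Get 17 2 16 ;; Idx 16 36 3 19 ;; Get 18 2 16 ;;
       AddTo 39 17 ;; AddTo 40 18 ;; Sb 16 17 18 ;; If 16 (Set 37 1) Skip) ;;
     Neq 39 27 ;; Neq 40 26"

lemma mod_Bits [simp]: "modv Bits = {12, 13, 14, 15, 16, 17, 18, 19, 20, 25}" "moda Bits = {0, 1, 2, 6}"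
  "silent Bits"
  by (auto simp: Bits_def)

lemma mod_Rel [simp]: "modv Rel = {12, 13, 16, 17, 18, 19, 37, 39, 40}" "moda Rel = {}" "silent Rel"
  by (auto simp: Rel_def)

lemma card_decode_Suc:
  "card {x \<in> set_decode Y. x < Suc k} = card {x \<in> set_decode Y. x < k} + of_bool (k \<in> set_decode Y)"
proof -
  have "{x \<in> set_decode Y. x < Suc k} =
      (if k \<in> set_decode Y then insert k {x \<in> set_decode Y. x < k} else {x \<in> set_decode Y. x < k})"
    by (auto simp: less_Suc_eq)
  then show ?thesis by simp
qed

text \<open>The bound on \<open>2 ^ b\<close> makes brute force over a block polynomial in
  \<open>n\<close>; the case \<open>b = 0\<close> occurs only for \<open>n = 0\<close>. Padding adds
  at most \<open>b\<close> elements.\<close>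

locale blocks =
  fixes n p q b m :: nat
  assumes qp: "q \<le> p" and pn: "p \<le> n" and n_less: "n < 2 ^ b" and b_small: "b = 0 \<or> 2 ^ b \<le> 2 * n"
    and n_le: "n \<le> m * b" and mb_le: "m * b \<le> n + b" and m_le: "m \<le> n"
begin

definition big :: nat where "big = 2 ^ b * 2 ^ b"

lemma big_ge: "2 ^ b \<le> big" "b + 1 \<le> big" "b \<le> big" "(b + 1) * (b + 1) \<le> big" "m \<le> big"
  "1 \<le> big"
proof -
  have N: "b + 1 \<le> 2 ^ b" by (simp add: Suc_leI)
  show 1: "2 ^ b \<le> big" by (simp add: big_def)
  with N show 2: "b + 1 \<le> big" "b \<le> big" by linarith+
  show "(b + 1) * (b + 1) \<le> big" unfolding big_def using N by (intro mult_le_mono)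
  show "m \<le> big" using m_le n_less 1 by linarith
  show "1 \<le> big" using 2 by simp
qed

definition regs :: "st \<Rightarrow> bool" where
  "regs s \<longleftrightarrow> vr s 0 = n \<and> vr s 1 = p \<and> vr s 2 = q \<and> vr s 3 = b \<and> vr s 4 = b + 1 \<and> vr s 5 = 2 ^ b \<and>
     vr s 6 = m \<and> vr s 7 = (b + 1) ^ m \<and> vr s 8 = big \<and> vr s 9 = 2"

definition env :: "st \<Rightarrow> bool" where
  "env s \<longleftrightarrow> regs s \<and> (\<forall>i<m. ar s 0 i = b + 1) \<and>
     (\<forall>Y<2 ^ b. \<forall>x<b. ar s 2 (Y * b + x) = of_bool (x \<in> set_decode Y))"

lemma regs_frame: "regs s \<Longrightarrow> \<forall>x<10. vr t x = vr s x \<Longrightarrow> regs t"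
  unfolding regs_def by simp

lemma env_frame: "env s \<Longrightarrow> \<forall>x<10. vr t x = vr s x \<Longrightarrow> \<forall>a<3. ar t a = ar s a \<Longrightarrow> env t"
  unfolding env_def using regs_frame[of s t] by simp

lemma env_sem: "env s \<Longrightarrow> modv c \<inter> {..<10} = {} \<Longrightarrow> moda c \<inter> {..<3} = {} \<Longrightarrow> env (sem c s)"
  by (rule env_frame[of s]) (auto intro!: vr_frame ar_frame)

text \<open>A binary odometer of length \<open>b\<close> runs through all codes; its digits, kept in
  array 6, are the bits of the current code.\<close>

lemma sem_Bits:
  assumes "regs s"
  shows "env (sem Bits s)"
proof -
  let ?s1 = "sem (For 20 6 6 (Put 0 20 4)) s"
  let ?s2 = "sem (For 20 3 3 (Put 1 20 9)) ?s1"
  let ?c = "Idx 16 25 3 19 ;; Get 17 6 19 ;; Put 2 16 17"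
  let ?odo = "Odo 25 5 6 1 3 (For 19 3 3 ?c)"
  have r: "vr s 3 = b" "vr s 4 = b + 1" "vr s 5 = 2 ^ b" "vr s 6 = m" "vr s 8 = big" "vr s 9 = 2"
    using assms by (auto simp: regs_def)
  have "\<forall>i<min (vr s 6) (vr s 6). ar ?s1 0 i = b + 1"
    by (rule For_inv) (use r in \<open>auto simp: less_Suc_eq\<close>)
  then have 0: "\<forall>i<m. ar ?s1 0 i = b + 1" using r by simp
  have "\<forall>i<min (vr ?s1 3) (vr ?s1 3). ar ?s2 1 i = 2"
    by (rule For_inv) (use r in \<open>auto simp: less_Suc_eq vr_frame\<close>)
  then have 1: "\<forall>i<b. ar ?s2 1 i = 2" using r by (simp add: vr_frame)
  let ?I = "\<lambda>k (t :: st). \<forall>Y<k. \<forall>x<b. ar t 2 (Y * b + x) = of_bool (x \<in> set_decode Y)"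
  have "?I (vr ?s2 5) (sem ?odo ?s2)"
  proof (rule Odo_inv[where \<rho> = "\<lambda>_. 2"])
    show "\<forall>i<vr ?s2 3. ar ?s2 1 i = 2 \<and> (1::nat) \<le> 2" using 1 r by (simp add: vr_frame)
  next
    fix k t assume k: "k < vr ?s2 5" and I: "?I k t" and v: "vr t 25 = k"
      and D: "\<forall>i<vr ?s2 3. ar t 6 i = digit (\<lambda>_. 2) k i"
      and f: "\<forall>x. x \<notin> modv ?odo \<longrightarrow> vr t x = vr ?s2 x"
    have rt: "vr t 3 = b" "vr t 8 = big" using f r by (auto simp: vr_frame)
    have kb: "k \<le> big" "k < 2 ^ b" using k r big_ge by (auto simp: vr_frame)
    have D: "\<forall>x<b. ar t 6 x = of_bool (x \<in> set_decode k)"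
      using D r by (auto simp: vr_frame digit_def set_decode_def mod2_eq_if odd_iff_mod_2_eq_one)
    let ?J = "\<lambda>j (t' :: st). \<forall>Y x. x < b \<and> (Y < k \<or> Y = k \<and> x < j) \<longrightarrow> ar t' 2 (Y * b + x) = of_bool (x \<in> set_decode Y)"
    have "?J (min (vr t 3) (vr t 3)) (sem (For 19 3 3 ?c) t)"
    proof (rule For_inv)
      show "?J 0 (upd 19 0 t)" using I by simp
    next
      fix j t' assume j: "j < min (vr t 3) (vr t 3)" and J: "?J j t'" and v': "vr t' 19 = j"
        and f: "\<forall>v. v \<notin> insert 19 (modv ?c) \<longrightarrow> vr t' v = vr t v" "\<forall>a. a \<notin> moda ?c \<longrightarrow> ar t' a = ar t a"
      have vt: "vr t' 25 = k" "vr t' 3 = b" "vr t' 8 = big" "ar t' 6 = ar t 6" using f v rt by auto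
      have jb: "j < b" "j \<le> big" using j rt big_ge by auto
      have "ar (sem ?c t') 2 = (ar t' 2)(k * b + j := of_bool (j \<in> set_decode k))"
        using vt v' jb kb big_ge(3) D by (simp add: sem_Idx)
      moreover have "Y * b + x = k * b + j \<longleftrightarrow> Y = k \<and> x = j" if "x < b" for Y x
        using index_eq_iff[of x b j Y k] that jb by simp
      ultimately show "?J (Suc j) (upd 19 (Suc j) (sem ?c t'))"
        using J by (auto simp: less_Suc_eq simp del: sem.simps)
    qed
    then show "?I (Suc k) (sem (For 19 3 3 ?c) t)" using rt by (auto simp: less_Suc_eq)
  qed auto
  moreover have "regs (sem Bits s)"
    by (rule regs_frame[OF assms]) (auto simp: vr_frame)
  moreover have "ar (sem Bits s) 0 = ar ?s1 0" by (simp add: Bits_def ar_frame)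
  ultimately show ?thesis using 0 r by (simp add: env_def Bits_def vr_frame)
qed

lemma sem_Rel:
  assumes env: "env s" and Y: "vr s 34 = Y" "Y < 2 ^ b" and S: "vr s 36 = S" "S < 2 ^ b"
  shows "vr (sem Rel s) 37 = 0 \<longleftrightarrow> S \<in> elig b (vr s 26) (vr s 27) Y"
proof -
  let ?c = "Idx 16 34 3 19 ;; Get 17 2 16 ;; Idx 16 36 3 19 ;; Get 18 2 16 ;;
       AddTo 39 17 ;; AddTo 40 18 ;; Sb 16 17 18 ;; If 16 (Set 37 1) Skip"
  let ?s = "upd 40 0 (upd 39 0 (upd 37 0 s))"
  have r: "vr s 3 = b" "vr s 8 = big" "\<forall>Y<2 ^ b. \<forall>x<b. ar s 2 (Y * b + x) = of_bool (x \<in> set_decode Y)"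
    using env by (auto simp: env_def regs_def)
  have le: "Y \<le> big" "S \<le> big" using Y S big_ge by auto
  let ?I = "\<lambda>k (t :: st). vr t 39 = card {x \<in> set_decode Y. x < k} \<and> vr t 40 = card {x \<in> set_decode S. x < k} \<and>
    (vr t 37 = 0 \<longleftrightarrow> (\<forall>x<k. x \<in> set_decode Y \<longrightarrow> x \<in> set_decode S))"
  have "?I (min (vr ?s 3) (vr ?s 3)) (sem (For 19 3 3 ?c) ?s)"
  proof (rule For_inv)
    fix k t assume k: "k < min (vr ?s 3) (vr ?s 3)" and I: "?I k t" and v: "vr t 19 = k"
      and f: "\<forall>v. v \<notin> insert 19 (modv ?c) \<longrightarrow> vr t v = vr ?s v" "\<forall>a. a \<notin> moda ?c \<longrightarrow> ar t a = ar ?s a"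
    have vt: "vr t 34 = Y" "vr t 36 = S" "vr t 3 = b" "vr t 8 = big" "ar t 2 = ar s 2" using f r Y S by auto
    have kb: "k < b" "k \<le> big" using k r big_ge by auto
    have bits: "ar s 2 (Y * b + k) = of_bool (k \<in> set_decode Y)" "ar s 2 (S * b + k) = of_bool (k \<in> set_decode S)"
      using r(3) Y S kb by auto
    have ob: "of_bool B \<le> big" for B using big_ge by (cases B) auto
    have "vr (sem ?c t) 39 = vr t 39 + of_bool (k \<in> set_decode Y)"
      "vr (sem ?c t) 40 = vr t 40 + of_bool (k \<in> set_decode S)"
      "vr (sem ?c t) 37 = (if k \<in> set_decode Y \<and> k \<notin> set_decode S then 1 else vr t 37)"
      using vt v kb le big_ge(3) bits ob by (simp_all add: sem_Idx sem_AddTo)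
    then show "?I (Suc k) (upd 19 (Suc k) (sem ?c t))"
      using I by (simp add: card_decode_Suc All_less_Suc del: sem.simps)
  qed auto
  moreover have "{x \<in> set_decode Y. x < b} = set_decode Y" "{x \<in> set_decode S. x < b} = set_decode S"
    using Y(2) S(2) by (auto simp: set_decode_subset_iff)
  moreover have "(\<forall>x<b. x \<in> set_decode Y \<longrightarrow> x \<in> set_decode S) \<longleftrightarrow> set_decode Y \<subseteq> set_decode S"
    using Y(2) by (auto simp: set_decode_subset_iff)
  moreover define t where t: "t = sem (For 19 3 3 ?c) ?s"
  moreover have "vr t 26 = vr s 26" "vr t 27 = vr s 27" by (auto simp: t vr_frame)
  ultimately show ?thesis using r(1) S
    by (auto simp: Rel_def elig_def t[symmetric] sem_Neq vr_frame)
qed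

end

section \<open>Computing the block families\<close>

definition Cover :: com where
  "Cover = Set 35 0 ;; For 36 5 5 (Rel ;; Get 16 7 36 ;; If 16 (Set 37 1) Skip ;; If 37 Skip (Inc 35))"

definition Mark :: com where
  "Mark = For 36 5 5 (Rel ;; If 37 Skip (Set 16 1 ;; Put 7 36 16))"

text \<open>The power of two in variable 31, with its exponent in 30, is doubled when the list
  outgrows it; this yields the rounded logarithm without division.\<close>

definition Append :: com where
  "Append = Idx 38 28 5 29 ;; Put 5 38 34 ;; Inc 29 ;; Sb 16 29 31 ;;
     If 16 (Mov 17 31 ;; AddTo 31 17 ;; Inc 30) Skip"

definition Try :: com where
  "Try = Cover ;; Sb 16 33 35 ;; If 16 Skip (Append ;; Mark)"

text \<open>Loops only count upwards, so the decreasing threshold in variable 33 is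
  \<open>2 ^ b\<close> minus the loop counter, running from \<open>2 ^ b\<close> down to 1.\<close>

definition Greedy :: com where
  "Greedy = Set 29 0 ;; Set 30 0 ;; Set 31 1 ;; Set 16 0 ;; For 20 5 5 (Put 7 20 16) ;;
     For 32 5 5 (Sb 33 5 32 ;; For 34 5 5 Try) ;; Put 3 28 29 ;; Put 4 28 30"

definition Tables :: com where
  "Tables = For 26 4 4 (For 27 4 4 (Idx 28 26 4 27 ;; Greedy))"

lemma mod_Cover [simp]: "modv Cover = {12, 13, 16, 17, 18, 19, 35, 36, 37, 39, 40}" "moda Cover = {}"
  "silent Cover"
  by (auto simp: Cover_def)

lemma mod_Mark [simp]: "modv Mark = {12, 13, 16, 17, 18, 19, 36, 37, 39, 40}" "moda Mark = {7}"
  "silent Mark"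
  by (auto simp: Mark_def)

lemma mod_Append [simp]: "modv Append = {12, 13, 16, 17, 29, 30, 31, 38}" "moda Append = {5}" "silent Append"
  by (auto simp: Append_def)

lemma mod_Try [simp]: "modv Try = {12, 13, 16, 17, 18, 19, 29, 30, 31, 35, 36, 37, 38, 39, 40}"
  "moda Try = {5, 7}" "silent Try"
  by (auto simp: Try_def)

lemma mod_Greedy [simp]:
  "modv Greedy = {12, 13, 16, 17, 18, 19, 20, 29, 30, 31, 32, 33, 34, 35, 36, 37, 38, 39, 40}"
  "moda Greedy = {3, 4, 5, 7}" "silent Greedy"
  by (auto simp: Greedy_def)

lemma mod_Tables [simp]:
  "modv Tables = {12, 13, 16, 17, 18, 19, 20, 26, 27, 28, 29, 30, 31, 32, 33, 34, 35, 36, 37, 38, 39, 40}"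
  "moda Tables = {3, 4, 5, 7}" "silent Tables"
  by (auto simp: Tables_def)

context blocks
begin

lemma sem_Cover:
  assumes env: "env s" and Y: "vr s 34 = Y" "Y < 2 ^ b" and C: "\<forall>S<2 ^ b. ar s 7 S = of_bool (S \<in> C)"
  shows "vr (sem Cover s) 35 = card (elig b (vr s 26) (vr s 27) Y - C)"
proof -
  let ?c = "Rel ;; Get 16 7 36 ;; If 16 (Set 37 1) Skip ;; If 37 Skip (Inc 35)"
  let ?s = "upd 35 0 s" and ?E = "elig b (vr s 26) (vr s 27) Y"
  have r: "vr s 5 = 2 ^ b" using env by (simp add: env_def regs_def)
  have "vr (sem (For 36 5 5 ?c) ?s) 35 = card {S \<in> ?E - C. S < min (vr ?s 5) (vr ?s 5)}"
  proof (rule For_inv[where I = "\<lambda>k t. vr t 35 = card {S \<in> ?E - C. S < k}"])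
    fix k and t :: st assume k: "k < min (vr ?s 5) (vr ?s 5)" and I: "vr t 35 = card {S \<in> ?E - C. S < k}"
      and v: "vr t 36 = k"
      and f: "\<forall>v. v \<notin> insert 36 (modv ?c) \<longrightarrow> vr t v = vr ?s v" "\<forall>a. a \<notin> moda ?c \<longrightarrow> ar t a = ar ?s a"
    have "env t" by (rule env_frame[OF env]) (use f in auto)
    moreover have vt: "vr t 34 = Y" "vr t 26 = vr s 26" "vr t 27 = vr s 27" "ar t 7 = ar s 7"
      using f Y by auto
    moreover have kb: "k < 2 ^ b" using k r by simp
    ultimately have rel: "vr (sem Rel t) 37 = 0 \<longleftrightarrow> k \<in> ?E"
      using sem_Rel[of t Y k] Y v by simp
    have c: "vr (sem ?c t) 35 = vr t 35 + of_bool (k \<in> ?E - C)"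
      using rel C kb vt v by (auto simp: vr_frame ar_frame)
    have "{S \<in> ?E - C. S < Suc k} =
        (if k \<in> ?E - C then insert k {S \<in> ?E - C. S < k} else {S \<in> ?E - C. S < k})"
      by (auto simp: less_Suc_eq)
    then have "card {S \<in> ?E - C. S < Suc k} = card {S \<in> ?E - C. S < k} + of_bool (k \<in> ?E - C)"
      by simp
    then show "vr (upd 36 (Suc k) (sem ?c t)) 35 = card {S \<in> ?E - C. S < Suc k}"
      using c I by (simp del: sem.simps)
  qed simp
  moreover have "{S \<in> ?E - C. S < 2 ^ b} = ?E - C" by (auto simp: elig_def)
  ultimately show ?thesis using r by (simp add: Cover_def)
qed

lemma sem_Mark:
  assumes env: "env s" and Y: "vr s 34 = Y" "Y < 2 ^ b" and C: "\<forall>S<2 ^ b. ar s 7 S = of_bool (S \<in> C)"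
  shows "\<forall>S<2 ^ b. ar (sem Mark s) 7 S = of_bool (S \<in> C \<union> elig b (vr s 26) (vr s 27) Y)"
proof -
  let ?c = "Rel ;; If 37 Skip (Set 16 1 ;; Put 7 36 16)"
  let ?E = "elig b (vr s 26) (vr s 27) Y"
  have r: "vr s 5 = 2 ^ b" using env by (simp add: env_def regs_def)
  let ?I = "\<lambda>k (t :: st). \<forall>S<2 ^ b. ar t 7 S = of_bool (S \<in> C \<or> S \<in> ?E \<and> S < k)"
  have "?I (min (vr s 5) (vr s 5)) (sem (For 36 5 5 ?c) s)"
  proof (rule For_inv)
    fix k t assume k: "k < min (vr s 5) (vr s 5)" and I: "?I k t" and v: "vr t 36 = k"
      and f: "\<forall>v. v \<notin> insert 36 (modv ?c) \<longrightarrow> vr t v = vr s v" "\<forall>a. a \<notin> moda ?c \<longrightarrow> ar t a = ar s a"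
    have "env t" by (rule env_frame[OF env]) (use f in auto)
    moreover have vt: "vr t 34 = Y" "vr t 26 = vr s 26" "vr t 27 = vr s 27" using f Y by auto
    moreover have kb: "k < 2 ^ b" using k r by simp
    ultimately have rel: "vr (sem Rel t) 37 = 0 \<longleftrightarrow> k \<in> ?E"
      using sem_Rel[of t Y k] Y v by simp
    have c: "ar (sem ?c t) 7 = (if k \<in> ?E then (ar t 7)(k := 1) else ar t 7)"
      using rel v by (auto simp: vr_frame ar_frame)
    show "?I (Suc k) (upd 36 (Suc k) (sem ?c t))"
      using c I by (auto simp: less_Suc_eq simp del: sem.simps)
  qed (use C in simp)
  then show ?thesis using r by (auto simp: Mark_def)
qed

definition stored :: "nat \<Rightarrow> nat list \<Rightarrow> st \<Rightarrow> bool" where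
  "stored d F s \<longleftrightarrow> (\<forall>j<length F. ar s 5 (d * 2 ^ b + j) = F ! j)"

text \<open>The maximum admits \<open>c = 0\<close> for the empty list; otherwise
  \<open>2 ^ c\<close> is within a factor 2 of the size.\<close>

definition log_size :: "nat \<Rightarrow> nat list \<Rightarrow> bool" where
  "log_size c F \<longleftrightarrow> length F \<le> 2 ^ c \<and> 2 ^ c \<le> max 1 (2 * length F)"

lemma sem_Append:
  assumes env: "env s" and d: "vr s 28 = d" "d \<le> big" and Y: "vr s 34 = Y" and F: "vr s 29 = length F" "length F \<le> 2 ^ b"
    "stored d F s" and c: "vr s 31 = 2 ^ vr s 30" "log_size (vr s 30) F"
  shows "vr (sem Append s) 29 = length (F @ [Y])" "stored d (F @ [Y]) (sem Append s)"
    "\<forall>i<d * 2 ^ b. ar (sem Append s) 5 i = ar s 5 i"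
    "vr (sem Append s) 31 = 2 ^ vr (sem Append s) 30" "log_size (vr (sem Append s) 30) (F @ [Y])"
proof -
  have r: "vr s 5 = 2 ^ b" "vr s 8 = big" using env by (simp_all add: env_def regs_def)
  have F': "length F \<le> big" using F big_ge by simp
  have 29: "vr (sem Append s) 29 = length F + 1"
    using r d F F' big_ge by (simp add: Append_def sem_Idx vr_frame)
  have 5: "ar (sem Append s) 5 = (ar s 5)(d * 2 ^ b + length F := Y)"
    using r d F F' Y big_ge by (simp add: Append_def sem_Idx ar_frame)
  have e: "vr (sem Append s) 30 = (if 2 ^ vr s 30 < Suc (length F) then Suc (vr s 30) else vr s 30)"
    "vr (sem Append s) 31 = (if 2 ^ vr s 30 < Suc (length F) then 2 * 2 ^ vr s 30 else 2 ^ vr s 30)"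
  proof -
    have "2 ^ vr s 30 < Suc (length F) \<Longrightarrow> 2 ^ vr s 30 \<le> big" using F' by simp
    then show "vr (sem Append s) 30 = (if 2 ^ vr s 30 < Suc (length F) then Suc (vr s 30) else vr s 30)"
    "vr (sem Append s) 31 = (if 2 ^ vr s 30 < Suc (length F) then 2 * 2 ^ vr s 30 else 2 ^ vr s 30)"
      using r d F F' c big_ge by (auto simp: Append_def sem_Idx sem_AddTo)
  qed
  show "vr (sem Append s) 29 = length (F @ [Y])" using 29 by simp
  show "stored d (F @ [Y]) (sem Append s)" using F(3) unfolding stored_def 5 by (auto simp: nth_append)
  show "\<forall>i<d * 2 ^ b. ar (sem Append s) 5 i = ar s 5 i" unfolding 5 by simp
  show "vr (sem Append s) 31 = 2 ^ vr (sem Append s) 30" unfolding e by simp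
  define X :: nat where "X = 2 ^ vr s 30"
  have "X \<ge> 1" by (simp add: X_def)
  then show "log_size (vr (sem Append s) 30) (F @ [Y])"
    using c(2) unfolding e log_size_def X_def[symmetric] by (auto simp: X_def[symmetric])
qed

text \<open>\<open>A\<close> records array 5 before the current segment: the families computed
  earlier must survive.\<close>

definition greedy_state :: "nat \<Rightarrow> nat \<Rightarrow> nat \<Rightarrow> (nat \<Rightarrow> nat) \<Rightarrow> nat \<Rightarrow> nat \<Rightarrow> st \<Rightarrow> bool" where
  "greedy_state P Q d A t y s \<longleftrightarrow> (\<exists>F C. greedy_inv b P Q t y F C \<and> (\<forall>S<2 ^ b. ar s 7 S = of_bool (S \<in> C)) \<and>
     vr s 29 = length F \<and> stored d F s \<and> (\<forall>i<d * 2 ^ b. ar s 5 i = A i) \<and>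
     vr s 31 = 2 ^ vr s 30 \<and> log_size (vr s 30) F)"

lemma greedy_state_frame:
  "greedy_state P Q d A t y s \<Longrightarrow> \<forall>v\<in>{29, 30, 31}. vr s' v = vr s v \<Longrightarrow> \<forall>a\<in>{5, 7}. ar s' a = ar s a \<Longrightarrow>
    greedy_state P Q d A t y s'"
  unfolding greedy_state_def stored_def by simp

lemma sem_Try:
  assumes env: "env s" and v: "vr s 26 = P" "vr s 27 = Q" "vr s 28 = d" "d \<le> big"
    and Y: "vr s 34 = y" "y < 2 ^ b" and t: "vr s 33 = t" "t \<ge> 1" and G: "greedy_state P Q d A t y s"
  shows "greedy_state P Q d A t (Suc y) (sem Try s)"
proof -
  obtain F C where F: "greedy_inv b P Q t y F C" "\<forall>S<2 ^ b. ar s 7 S = of_bool (S \<in> C)"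
     "vr s 29 = length F" "stored d F s" "\<forall>i<d * 2 ^ b. ar s 5 i = A i"
     "vr s 31 = 2 ^ vr s 30" "log_size (vr s 30) F"
    using G unfolding greedy_state_def by blast
  define s1 where "s1 = sem Cover s"
  define s2 where "s2 = upd 16 (t - vr s1 35) s1"
  have 35: "vr s1 35 = card (elig b P Q y - C)"
    unfolding s1_def using sem_Cover[OF env Y F(2)] v by simp
  have 33: "vr s1 33 = t" using t by (simp add: s1_def vr_frame)
  have fr: "vr s2 x = vr s x" if "x \<in> {26, 27, 28, 34, 29, 30, 31}" for x
    using that by (auto simp: s2_def s1_def vr_frame)
  have fa: "ar s2 = ar s" by (rule ext) (simp add: s2_def s1_def ar_frame)
  have env2: "env s2"
    by (rule env_frame[OF env]) (simp_all add: fa, auto simp: s2_def s1_def vr_frame)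
  show ?thesis
  proof (cases "card (elig b P Q y - C) < t")
    case True
    have "sem Try s = s2" using True 33 35 by (simp add: Try_def s1_def[symmetric] s2_def)
    moreover have "greedy_inv b P Q t (Suc y) F C" using F(1) True by (rule greedy_inv_skip)
    ultimately show ?thesis
      unfolding greedy_state_def using F fr fa by (intro exI[of _ F] exI[of _ C]) (auto simp: stored_def)
  next
    case False
    let ?s3 = "sem Append s2"
    have take: "sem Try s = sem Mark ?s3" using False 33 35 by (simp add: Try_def s1_def[symmetric] s2_def)
    have G': "greedy_inv b P Q t (Suc y) (F @ [y]) (C \<union> elig b P Q y)"
      using False F(1) Y t by (intro greedy_inv_take) auto
    have s2: "vr s2 28 = d" "vr s2 34 = y" "vr s2 29 = length F" "stored d F s2"
      "vr s2 31 = 2 ^ vr s2 30" "log_size (vr s2 30) F"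
      using fr v Y F fa by (simp_all add: stored_def)
    note a = sem_Append[OF env2 s2(1) v(4) s2(2,3) greedy_inv_length[OF F(1)] s2(4-6)]
    have "env ?s3" using env2 by (rule env_sem) auto
    moreover have "vr ?s3 34 = y" "vr ?s3 26 = P" "vr ?s3 27 = Q" using fr Y v by (auto simp: vr_frame)
    moreover have "\<forall>S<2 ^ b. ar ?s3 7 S = of_bool (S \<in> C)" using F fa by (simp add: ar_frame)
    ultimately have "\<forall>S<2 ^ b. ar (sem Mark ?s3) 7 S = of_bool (S \<in> C \<union> elig b P Q y)"
      using sem_Mark[of ?s3 y C] Y by simp
    moreover have "vr (sem Mark ?s3) x = vr ?s3 x" if "x \<in> {29, 30, 31}" for x
      using that by (auto intro!: vr_frame)
    moreover have "ar (sem Mark ?s3) 5 = ar ?s3 5" by (simp add: ar_frame)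
    ultimately show ?thesis
      unfolding greedy_state_def take using G' a F(5) fa
      by (intro exI[of _ "F @ [y]"] exI[of _ "C \<union> elig b P Q y"]) (simp add: stored_def)
  qed
qed

lemma sem_Greedy:
  assumes env: "env s" and v: "vr s 26 = P" "vr s 27 = Q" "vr s 28 = d" "d \<le> big"
  shows "\<exists>F c. block_family b P Q F \<and> log_size c F \<and> stored d F (sem Greedy s) \<and>
    ar (sem Greedy s) 3 = (ar s 3)(d := length F) \<and> ar (sem Greedy s) 4 = (ar s 4)(d := c) \<and>
    (\<forall>i<d * 2 ^ b. ar (sem Greedy s) 5 i = ar s 5 i)"
proof -
  let ?s0 = "upd 16 0 (upd 31 1 (upd 30 0 (upd 29 0 s)))"
  define s1 where "s1 = sem (For 20 5 5 (Put 7 20 16)) ?s0"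
  let ?c = "Sb 33 5 32 ;; For 34 5 5 Try"
  define s2 where "s2 = sem (For 32 5 5 ?c) s1"
  have r: "vr s 5 = 2 ^ b" using env by (simp add: env_def regs_def)
  let ?A = "ar s 5"
  have "\<forall>S<min (vr ?s0 5) (vr ?s0 5). ar s1 7 S = 0"
    unfolding s1_def by (rule For_inv) (auto simp: less_Suc_eq)
  then have 7: "\<forall>S<2 ^ b. ar s1 7 S = 0" using r by simp
  have v1: "vr s1 29 = 0" "vr s1 30 = 0" "vr s1 31 = 1" "vr s1 5 = 2 ^ b" "vr s1 26 = P" "vr s1 27 = Q"
    "vr s1 28 = d" "ar s1 5 = ?A" "ar s1 3 = ar s 3" "ar s1 4 = ar s 4"
    using v r by (simp_all add: s1_def vr_frame ar_frame)
  have env1: "env s1"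
    by (rule env_frame[OF env]) (auto simp: s1_def vr_frame ar_frame)
  have "greedy_state P Q d ?A (2 ^ b - min (vr s1 5) (vr s1 5)) 0 s2"
    unfolding s2_def
  proof (rule For_inv[where I = "\<lambda>k. greedy_state P Q d ?A (2 ^ b - k) 0"])
    show "greedy_state P Q d ?A (2 ^ b - 0) 0 (upd 32 0 s1)"
      unfolding greedy_state_def using 7 v1 greedy_inv_start[of b P Q]
      by (intro exI[of _ "[]"] exI[of _ "{}"]) (auto simp: stored_def log_size_def)
  next
    fix k t assume k: "k < min (vr s1 5) (vr s1 5)" and G: "greedy_state P Q d ?A (2 ^ b - k) 0 t"
      and vk: "vr t 32 = k" and f: "\<forall>v. v \<notin> insert 32 (modv ?c) \<longrightarrow> vr t v = vr s1 v"
        "\<forall>a. a \<notin> moda ?c \<longrightarrow> ar t a = ar s1 a"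
    let ?t1 = "upd 33 (2 ^ b - k) t"
    have e1: "env ?t1" by (rule env_frame[OF env1]) (use f in auto)
    have vt: "vr t 5 = 2 ^ b" "vr t 26 = P" "vr t 27 = Q" "vr t 28 = d" using f v1 by auto
    have "greedy_state P Q d ?A (2 ^ b - k) (min (vr ?t1 5) (vr ?t1 5)) (sem (For 34 5 5 Try) ?t1)"
    proof (rule For_inv)
      show "greedy_state P Q d ?A (2 ^ b - k) 0 (upd 34 0 ?t1)"
        by (rule greedy_state_frame[OF G]) auto
    next
      fix y t' assume y: "y < min (vr ?t1 5) (vr ?t1 5)" and G: "greedy_state P Q d ?A (2 ^ b - k) y t'"
        and vy: "vr t' 34 = y" and f: "\<forall>v. v \<notin> insert 34 (modv Try) \<longrightarrow> vr t' v = vr ?t1 v"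
        "\<forall>a. a \<notin> moda Try \<longrightarrow> ar t' a = ar ?t1 a"
      have "greedy_state P Q d ?A (2 ^ b - k) (Suc y) (sem Try t')"
      proof (rule sem_Try)
        show "env t'" by (rule env_frame[OF e1]) (use f in auto)
      qed (use f vt vy y k v1 G v in auto)
      then show "greedy_state P Q d ?A (2 ^ b - k) (Suc y) (upd 34 (Suc y) (sem Try t'))"
        by (rule greedy_state_frame) auto
    qed
    then have "greedy_state P Q d ?A (2 ^ b - k) (2 ^ b) (sem (For 34 5 5 Try) ?t1)" using vt by simp
    then have "greedy_state P Q d ?A (2 ^ b - k - 1) 0 (sem (For 34 5 5 Try) ?t1)"
      unfolding greedy_state_def using greedy_inv_pass by blast
    then have "greedy_state P Q d ?A (2 ^ b - Suc k) 0 (sem (For 34 5 5 Try) ?t1)" by simp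
    then have "greedy_state P Q d ?A (2 ^ b - Suc k) 0 (sem ?c t)" using vt vk by simp
    then show "greedy_state P Q d ?A (2 ^ b - Suc k) 0 (upd 32 (Suc k) (sem ?c t))"
      by (rule greedy_state_frame) auto
  qed
  then obtain F C where F: "greedy_inv b P Q 0 0 F C" "vr s2 29 = length F" "stored d F s2"
    "\<forall>i<d * 2 ^ b. ar s2 5 i = ?A i" "log_size (vr s2 30) F"
    unfolding greedy_state_def using v1(4) by auto
  have g: "sem Greedy s = sem (Put 3 28 29 ;; Put 4 28 30) s2"
    by (simp add: Greedy_def s2_def s1_def)
  have "vr s2 28 = d" "ar s2 3 = ar s 3" "ar s2 4 = ar s 4" using v1 by (simp_all add: s2_def vr_frame ar_frame)
  then have "ar (sem Greedy s) 3 = (ar s 3)(d := length F)" "ar (sem Greedy s) 4 = (ar s 4)(d := vr s2 30)"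
    "ar (sem Greedy s) 5 = ar s2 5" unfolding g using F by simp_all
  then show ?thesis using F greedy_inv_end[OF F(1)] unfolding stored_def by auto
qed

definition entry :: "st \<Rightarrow> nat \<Rightarrow> nat \<Rightarrow> nat list \<Rightarrow> bool" where
  "entry s P Q F \<longleftrightarrow> block_family b P Q F \<and> stored (P * (b + 1) + Q) F s \<and>
     ar s 3 (P * (b + 1) + Q) = length F \<and> log_size (ar s 4 (P * (b + 1) + Q)) F"

lemma index_less:
  assumes "P \<le> b" "Q \<le> b"
  shows "P * (b + 1) + Q < (b + 1) * (b + 1)"
proof -
  have "P * (b + 1) + Q < P * (b + 1) + (b + 1)" using assms by simp
  also have "\<dots> = (P + 1) * (b + 1)" by simp
  also have "\<dots> \<le> (b + 1) * (b + 1)" using assms by (intro mult_le_mono1) simp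
  finally show ?thesis .
qed

lemma index_mono:
  assumes "Q' \<le> b" "P' < P \<or> P' = P \<and> Q' < Q"
  shows "P' * (b + 1) + Q' < P * (b + 1) + Q"
proof (cases "P' < P")
  case True
  have "P' * (b + 1) + Q' < (P' + 1) * (b + 1)" using assms by simp
  also have "\<dots> \<le> P * (b + 1)" using True by (intro mult_le_mono1) simp
  finally show ?thesis by simp
qed (use assms in auto)

text \<open>The table is filled in lexicographic order of \<open>(P, Q)\<close>, which is also the
  order of the segments in array 5, so finished families are never overwritten.\<close>

lemma sem_Tables:
  assumes env: "env s"
  shows "\<exists>Fam. \<forall>P\<le>b. \<forall>Q\<le>b. entry (sem Tables s) P Q (Fam P Q)"
proof -
  let ?c = "Idx 28 26 4 27 ;; Greedy"
  have r: "vr s 4 = b + 1" "vr s 8 = big" using env by (simp_all add: env_def regs_def)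
  let ?J = "\<lambda>P Q (s :: st). \<forall>P' Q'. Q' \<le> b \<and> (P' < P \<or> P' = P \<and> Q' < Q) \<longrightarrow> (\<exists>F. entry s P' Q' F)"
  have frame: "?J P Q s'" if "?J P Q s" "ar s' 3 = ar s 3" "ar s' 4 = ar s 4" "ar s' 5 = ar s 5" for P Q s s'
    using that unfolding entry_def stored_def by presburger
  have "?J (min (vr s 4) (vr s 4)) 0 (sem (For 26 4 4 (For 27 4 4 ?c)) s)"
  proof (rule For_inv[where I = "\<lambda>P s. ?J P 0 s"])
    fix P t assume P: "P < min (vr s 4) (vr s 4)" and J: "?J P 0 t" and vP: "vr t 26 = P"
      and f: "\<forall>v. v \<notin> insert 26 (modv (For 27 4 4 ?c)) \<longrightarrow> vr t v = vr s v"
        "\<forall>a. a \<notin> moda (For 27 4 4 ?c) \<longrightarrow> ar t a = ar s a"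
    have et: "env t" by (rule env_frame[OF env]) (use f in auto)
    have vt: "vr t 4 = b + 1" using f r by simp
    have "?J P (min (vr t 4) (vr t 4)) (sem (For 27 4 4 ?c) t)"
    proof (rule For_inv)
      show "?J P 0 (upd 27 0 t)" by (rule frame[OF J]) auto
    next
      fix Q u assume Q: "Q < min (vr t 4) (vr t 4)" and J: "?J P Q u" and vQ: "vr u 27 = Q"
        and f: "\<forall>v. v \<notin> insert 27 (modv ?c) \<longrightarrow> vr u v = vr t v" "\<forall>a. a \<notin> moda ?c \<longrightarrow> ar u a = ar t a"
      let ?d = "P * (b + 1) + Q"
      let ?u = "sem (Idx 28 26 4 27) u"
      have PQ: "P \<le> b" "Q \<le> b" using P Q r vt by auto
      have d: "?d < big" using index_less[OF PQ] big_ge(4) by linarith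
      have le: "P \<le> big" "Q \<le> big" "b + 1 \<le> big" using PQ big_ge(2) by auto
      have eu: "env u" by (rule env_frame[OF et]) (use f in auto)
      have vu: "vr u 26 = P" "vr u 4 = b + 1" "vr u 8 = big" using f vP vt eu by (auto simp: env_def regs_def)
      have 28: "?u = upd 13 P (upd 12 Q (upd 28 ?d u))"
        using sem_Idx[of u 26 4 27 28] vu vQ le by simp
      have e': "env ?u" using eu by (rule env_sem) auto
      have v': "vr ?u 26 = P" "vr ?u 27 = Q" "vr ?u 28 = ?d" unfolding 28 using vu vQ by simp_all
      from sem_Greedy[OF e' v' less_imp_le[OF d]] obtain F c where F: "block_family b P Q F" "log_size c F"
        "stored ?d F (sem Greedy ?u)" "ar (sem Greedy ?u) 3 = (ar ?u 3)(?d := length F)"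
        "ar (sem Greedy ?u) 4 = (ar ?u 4)(?d := c)" "\<forall>i<?d * 2 ^ b. ar (sem Greedy ?u) 5 i = ar ?u 5 i"
        by blast
      have au: "ar ?u = ar u" unfolding 28 by simp
      have cu: "sem ?c u = sem Greedy ?u" by (simp only: sem.simps)
      have new: "entry (sem ?c u) P Q F"
        unfolding entry_def cu F(4,5) using F(1-3) by (simp only: fun_upd_same)
      have old: "\<exists>F. entry (sem ?c u) P' Q' F" if "Q' \<le> b" "P' < P \<or> P' = P \<and> Q' < Q" for P' Q'
      proof -
        from J[rule_format, OF conjI[OF that]] obtain F' where F': "entry u P' Q' F'" by (rule exE)
        let ?e = "P' * (b + 1) + Q'"
        have less: "?e < ?d" using that by (rule index_mono)
        \<comment> \<open>A family has at most \<open>2 ^ b\<close> members, so an earlier segment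
          ends before the current one begins.\<close>
        have "?e * 2 ^ b + j < ?d * 2 ^ b" if "j < length F'" for j
        proof -
          have "j < 2 ^ b" using that F' by (simp add: entry_def block_family_def)
          then have "?e * 2 ^ b + j < (?e + 1) * 2 ^ b" by simp
          also have "\<dots> \<le> ?d * 2 ^ b" using less by (intro mult_le_mono1) simp
          finally show ?thesis .
        qed
        then have "stored ?e F' (sem ?c u)" using F' F(6) au unfolding entry_def stored_def cu by metis
        moreover have "ar (sem ?c u) 3 ?e = ar u 3 ?e" "ar (sem ?c u) 4 ?e = ar u 4 ?e"
          unfolding cu F(4,5) au using less by (simp_all only: fun_upd_apply less_irrefl less_imp_neq if_False)
        ultimately have "entry (sem ?c u) P' Q' F'" using F' unfolding entry_def by metis
        then show ?thesis by blast
      qed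
      have "?J P (Suc Q) (sem ?c u)"
      proof (intro allI impI)
        fix P' Q' assume a: "Q' \<le> b \<and> (P' < P \<or> P' = P \<and> Q' < Suc Q)"
        show "\<exists>F. entry (sem ?c u) P' Q' F"
        proof (cases "P' = P \<and> Q' = Q")
          case True
          then show ?thesis using new by blast
        next
          case False
          then show ?thesis using a by (intro old) auto
        qed
      qed
      then show "?J P (Suc Q) (upd 27 (Suc Q) (sem ?c u))" by (rule frame) auto
    qed
    then have "?J P (b + 1) (sem (For 27 4 4 ?c) t)" using vt by simp
    then have "?J (Suc P) 0 (sem (For 27 4 4 ?c) t)" by (simp add: less_Suc_eq_le order_le_less)
    then show "?J (Suc P) 0 (upd 26 (Suc P) (sem (For 27 4 4 ?c) t))" by (rule frame) auto
  qed simp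
  then have "\<forall>P\<le>b. \<forall>Q\<le>b. \<exists>F. entry (sem Tables s) P Q F" using r by (simp add: Tables_def)
  then show ?thesis by metis
qed

end

section \<open>Searching for the budget\<close>

definition Eval :: com where
  "Eval = Set 45 0 ;; Set 46 0 ;; Set 47 0 ;; Set 37 0 ;;
     For 19 6 6 (Get 16 8 19 ;; Get 17 9 19 ;; Idx 18 16 4 17 ;; Get 48 4 18 ;;
       AddTo 45 16 ;; AddTo 46 17 ;; AddTo 47 48 ;; Sb 16 17 16 ;; If 16 (Set 37 1) Skip) ;;
     Neq 46 2 ;; Sb 16 47 10 ;; If 16 (Set 37 1) Skip ;; Sb 44 1 45"

definition Probe :: com where
  "Probe = Set 42 0 ;; Odo 43 7 9 0 6 (Eval ;; If 37 Skip (Set 42 1) ;; If 44 (Set 42 1) Skip)"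

text \<open>No loop can stop early, so each profile offers \<open>4 ^ b\<close> chances to raise the
  threshold, which is common to all profiles; once the profile is covered, the remaining rounds
  change nothing.\<close>

definition Find :: com where
  "Find = Set 10 0 ;; Odo 25 7 8 0 6 (For 41 8 8 (Probe ;; If 42 Skip (Inc 10)))"

lemma mod_Eval [simp]: "modv Eval = {12, 13, 16, 17, 18, 19, 37, 44, 45, 46, 47, 48}" "moda Eval = {}" "silent Eval"
  by (auto simp: Eval_def)

lemma mod_Probe [simp]: "modv Probe = {12, 13, 14, 15, 16, 17, 18, 19, 37, 42, 43, 44, 45, 46, 47, 48}"
  "moda Probe = {9}" "silent Probe"
  by (auto simp: Probe_def)

lemma mod_Find [simp]: "modv Find = {10, 12, 13, 14, 15, 16, 17, 18, 19, 25, 37, 41, 42, 43, 44, 45, 46, 47, 48}"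
  "moda Find = {8, 9}" "silent Find"
  by (auto simp: Find_def)

locale tables = blocks +
  fixes Fam :: "nat \<Rightarrow> nat \<Rightarrow> nat list" and c :: "nat \<Rightarrow> nat \<Rightarrow> nat"
  assumes Fam: "P \<le> b \<Longrightarrow> Q \<le> b \<Longrightarrow> block_family b P Q (Fam P Q)"
    and log_c: "P \<le> b \<Longrightarrow> Q \<le> b \<Longrightarrow> log_size (c P Q) (Fam P Q)"
begin

definition tabs :: "st \<Rightarrow> bool" where
  "tabs s \<longleftrightarrow> env s \<and> (\<forall>P\<le>b. \<forall>Q\<le>b. ar s 3 (P * (b + 1) + Q) = length (Fam P Q) \<and>
     ar s 4 (P * (b + 1) + Q) = c P Q \<and> stored (P * (b + 1) + Q) (Fam P Q) s)"

lemma tabs_frame: "tabs s \<Longrightarrow> \<forall>x<10. vr t x = vr s x \<Longrightarrow> \<forall>a<6. ar t a = ar s a \<Longrightarrow> tabs t"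
  unfolding tabs_def stored_def using env_frame[of s t] by simp

lemma c_le: "P \<le> b \<Longrightarrow> Q \<le> b \<Longrightarrow> c P Q \<le> b + 1"
proof -
  assume "P \<le> b" "Q \<le> b"
  then have "2 ^ c P Q \<le> max 1 (2 * length (Fam P Q))" "length (Fam P Q) \<le> 2 ^ b"
    using Fam log_c by (auto simp: log_size_def block_family_def)
  then have "(2::nat) ^ c P Q \<le> 2 ^ (b + 1)" by (auto intro: le_trans)
  then show ?thesis by (simp only: power_increasing_iff[of "2 :: nat"] one_less_numeral_iff semiring_norm)
qed

definition cost :: "(nat \<Rightarrow> nat) \<Rightarrow> (nat \<Rightarrow> nat) \<Rightarrow> nat" where
  "cost pv qv = (\<Sum>i<m. c (pv i) (qv i))"

definition split :: "(nat \<Rightarrow> nat) \<Rightarrow> (nat \<Rightarrow> nat) \<Rightarrow> bool" where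
  "split pv qv \<longleftrightarrow> (\<forall>i<m. qv i \<le> pv i) \<and> (\<Sum>i<m. qv i) = q"

abbreviation dg :: "nat \<Rightarrow> nat \<Rightarrow> nat" where
  "dg \<equiv> digit (\<lambda>_. b + 1)"

lemma dg_le: "dg k i \<le> b"
  using digit_less[of "\<lambda>_. b + 1" i k] by simp

lemma cost_le:
  assumes "\<And>i. i < m \<Longrightarrow> pv i \<le> b" "\<And>i. i < m \<Longrightarrow> qv i \<le> b"
  shows "cost pv qv \<le> m * (b + 1)"
proof -
  have "cost pv qv \<le> (\<Sum>i<m. b + 1)"
    unfolding cost_def using assms by (intro sum_mono c_le) auto
  then show ?thesis by simp
qed

lemma index_le_big: "P \<le> b \<Longrightarrow> Q \<le> b \<Longrightarrow> P * (b + 1) + Q \<le> big"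
  using index_less[of P Q] big_ge(4) by linarith

lemma sem_table_index:
  assumes "vr t 4 = b + 1" "vr t 8 = big" "P \<le> big" "Q \<le> big" "b + 1 \<le> big"
  shows "sem (Idx 18 16 4 17) (upd 17 Q (upd 16 P t)) =
    upd 13 P (upd 12 Q (upd 18 (P * (b + 1) + Q) (upd 17 Q (upd 16 P t))))"
  using assms by (subst sem_Idx) simp_all

lemma sem_Eval:
  assumes tabs: "tabs s" and pv: "\<And>i. i < m \<Longrightarrow> ar s 8 i = pv i \<and> pv i \<le> b"
    and qv: "\<And>i. i < m \<Longrightarrow> ar s 9 i = qv i \<and> qv i \<le> b"
  shows "vr (sem Eval s) 37 = 0 \<longleftrightarrow> split pv qv \<and> cost pv qv \<le> vr s 10"
    and "vr (sem Eval s) 44 = p - (\<Sum>i<m. pv i)"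
proof -
  let ?c = "Get 16 8 19 ;; Get 17 9 19 ;; Idx 18 16 4 17 ;; Get 48 4 18 ;;
       AddTo 45 16 ;; AddTo 46 17 ;; AddTo 47 48 ;; Sb 16 17 16 ;; If 16 (Set 37 1) Skip"
  let ?s = "upd 37 0 (upd 47 0 (upd 46 0 (upd 45 0 s)))"
  have r: "vr s 1 = p" "vr s 2 = q" "vr s 4 = b + 1" "vr s 6 = m" "vr s 8 = big"
    using tabs by (auto simp: tabs_def env_def regs_def)
  define u where "u = sem (For 19 6 6 ?c) ?s"
  let ?I = "\<lambda>k (t :: st). vr t 45 = (\<Sum>i<k. pv i) \<and> vr t 46 = (\<Sum>i<k. qv i) \<and> vr t 47 = (\<Sum>i<k. c (pv i) (qv i)) \<and>
    (vr t 37 = 0 \<longleftrightarrow> (\<forall>i<k. qv i \<le> pv i))"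
  have "?I (min (vr ?s 6) (vr ?s 6)) u"
    unfolding u_def
  proof (rule For_inv)
    fix k t assume k: "k < min (vr ?s 6) (vr ?s 6)" and I: "?I k t" and v: "vr t 19 = k"
      and f: "\<forall>v. v \<notin> insert 19 (modv ?c) \<longrightarrow> vr t v = vr ?s v" "\<forall>a. a \<notin> moda ?c \<longrightarrow> ar t a = ar ?s a"
    have km: "k < m" using k r by simp
    note pq = pv[OF km] qv[OF km]
    have vt: "vr t 4 = b + 1" "vr t 8 = big" "ar t 8 k = pv k" "ar t 9 k = qv k" "ar t 4 = ar s 4"
      using f r pq by auto
    have 4: "ar s 4 (pv k * (b + 1) + qv k) = c (pv k) (qv k)" using tabs pq unfolding tabs_def by blast
    have le: "pv k \<le> big" "qv k \<le> big" "b + 1 \<le> big" "c (pv k) (qv k) \<le> big"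
      using pq big_ge(2) c_le[of "pv k" "qv k"] by auto
    note i = sem_table_index[OF vt(1,2) le(1-3)]
    have "vr (sem ?c t) 45 = vr t 45 + pv k" "vr (sem ?c t) 46 = vr t 46 + qv k"
      "vr (sem ?c t) 47 = vr t 47 + c (pv k) (qv k)"
      "vr (sem ?c t) 37 = (if qv k \<le> pv k then vr t 37 else 1)"
      using vt v le 4 i by (simp_all add: sem_AddTo)
    then show "?I (Suc k) (upd 19 (Suc k) (sem ?c t))"
      using I by (simp add: All_less_Suc del: sem.simps)
  qed simp
  then have u: "vr u 45 = (\<Sum>i<m. pv i)" "vr u 46 = (\<Sum>i<m. qv i)" "vr u 47 = cost pv qv"
    "vr u 37 = 0 \<longleftrightarrow> (\<forall>i<m. qv i \<le> pv i)" using r by (simp_all add: cost_def)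
  have u': "vr u 1 = p" "vr u 2 = q" "vr u 10 = vr s 10" using r by (simp_all add: u_def vr_frame)
  have e: "sem Eval s = sem (Neq 46 2 ;; Sb 16 47 10 ;; If 16 (Set 37 1) Skip ;; Sb 44 1 45) u"
    by (simp add: Eval_def u_def)
  show "vr (sem Eval s) 37 = 0 \<longleftrightarrow> split pv qv \<and> cost pv qv \<le> vr s 10"
    unfolding e using u u' by (auto simp: sem_Neq vr_frame split_def)
  show "vr (sem Eval s) 44 = p - (\<Sum>i<m. pv i)"
    unfolding e using u u' by (auto simp: vr_frame)
qed

text \<open>A profile with sum below \<open>p\<close> belongs to no set of size \<open>p\<close> and
  is dismissed.\<close>

definition covered :: "nat \<Rightarrow> (nat \<Rightarrow> nat) \<Rightarrow> bool" where
  "covered W pv \<longleftrightarrow> (\<Sum>i<m. pv i) < p \<or> (\<exists>l<(b + 1) ^ m. split pv (dg l) \<and> cost pv (dg l) \<le> W)"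

lemma covered_mono: "covered W pv \<Longrightarrow> W \<le> W' \<Longrightarrow> covered W' pv"
  unfolding covered_def by (meson le_trans)

lemma radices:
  assumes "env s"
  shows "\<forall>i<vr s 6. ar s 0 i = b + 1 \<and> b + 1 \<ge> 1" "vr s 6 = m" "vr s 7 = (b + 1) ^ m"
  using assms by (auto simp: env_def regs_def)

lemma sem_Probe:
  assumes tabs: "tabs s" and pv: "\<And>i. i < m \<Longrightarrow> ar s 8 i = pv i \<and> pv i \<le> b"
  shows "vr (sem Probe s) 42 > 0 \<longleftrightarrow> covered (vr s 10) pv"
proof -
  let ?c = "Eval ;; If 37 Skip (Set 42 1) ;; If 44 (Set 42 1) Skip"
  let ?s = "upd 42 0 s" and ?odo = "Odo 43 7 9 0 6 (Eval ;; If 37 Skip (Set 42 1) ;; If 44 (Set 42 1) Skip)"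
  have tabs': "tabs ?s" by (rule tabs_frame[OF tabs]) auto
  have env': "env ?s" using tabs' by (simp add: tabs_def)
  let ?G = "\<lambda>l. split pv (dg l) \<and> cost pv (dg l) \<le> vr s 10"
  let ?I = "\<lambda>k (t :: st). vr t 42 > 0 \<longleftrightarrow> (\<exists>l<k. ?G l \<or> (\<Sum>i<m. pv i) < p)"
  have "?I (vr ?s 7) (sem ?odo ?s)"
  proof (rule Odo_inv[where \<rho> = "\<lambda>_. b + 1" and I = ?I])
    show "\<forall>i<vr ?s 6. ar ?s 0 i = b + 1 \<and> 1 \<le> b + 1" using radices[OF env'] by simp
  next
    fix k t assume I: "?I k t" and D: "\<forall>i<vr ?s 6. ar t 9 i = dg k i"
      and f: "\<forall>x. x \<notin> modv ?odo \<longrightarrow> vr t x = vr ?s x" "\<forall>a. a \<notin> moda ?odo \<longrightarrow> ar t a = ar ?s a"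
    have "tabs t" by (rule tabs_frame[OF tabs']) (use f in auto)
    moreover have "ar t 8 i = pv i \<and> pv i \<le> b" if "i < m" for i using f pv that by simp
    moreover have "ar t 9 i = dg k i \<and> dg k i \<le> b" if "i < m" for i
      using D that dg_le radices(2)[OF env'] by simp
    moreover have "vr t 10 = vr s 10" using f by simp
    ultimately have e: "vr (sem Eval t) 37 = 0 \<longleftrightarrow> ?G k" "vr (sem Eval t) 44 = p - (\<Sum>i<m. pv i)"
      using sem_Eval[of t pv "dg k"] by auto
    have "vr (sem ?c t) 42 > 0 \<longleftrightarrow> vr t 42 > 0 \<or> ?G k \<or> (\<Sum>i<m. pv i) < p"
      using e by (auto simp: vr_frame)
    then show "?I (Suc k) (sem ?c t)" using I unfolding Ex_less_Suc by blast
  qed auto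
  moreover have "vr ?s 7 = (b + 1) ^ m" using radices(3)[OF env'] by simp
  ultimately have "vr (sem Probe s) 42 > 0 \<longleftrightarrow> (\<exists>l<(b + 1) ^ m. ?G l \<or> (\<Sum>i<m. pv i) < p)"
    by (simp add: Probe_def)
  moreover have "0 < (b + 1) ^ m" by simp
  ultimately show ?thesis unfolding covered_def by blast
qed

text \<open>The threshold \<open>W\<close> is raised only if some profile has no split of cost at
  most \<open>W\<close>. By \<open>ex\<close> this profile has a split of some cost \<open>C\<close>
  with \<open>2 ^ C \<le> B\<close>; then \<open>W + 1 \<le> C\<close>, and the bound persists
  although the program never knows \<open>B\<close>. Profiles handled earlier stay covered by
  monotonicity.\<close>

lemma sem_Find:
  assumes tabs: "tabs s"
    and ex: "\<And>k. \<not> (\<Sum>i<m. dg k i) < p \<Longrightarrow>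
      \<exists>l<(b + 1) ^ m. split (dg k) (dg l) \<and> 2 ^ cost (dg k) (dg l) \<le> B"
    and B: "1 \<le> (B :: real)"
  shows "2 ^ vr (sem Find s) 10 \<le> B" "vr (sem Find s) 10 < big"
    "\<forall>k<(b + 1) ^ m. covered (vr (sem Find s) 10) (dg k)"
proof -
  let ?b = "Probe ;; If 42 Skip (Inc 10)"
  let ?s = "upd 10 0 s" and ?odo = "Odo 25 7 8 0 6 (For 41 8 8 ?b)"
  define ok where "ok W \<longleftrightarrow> 2 ^ W \<le> B \<and> W \<le> m * (b + 1)" for W :: nat
  have ok_Suc: "ok (Suc W)" if nc: "\<not> covered W (dg k)" for W k
  proof -
    obtain l where l: "l < (b + 1) ^ m" "split (dg k) (dg l)" "2 ^ cost (dg k) (dg l) \<le> B"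
      using nc ex[of k] unfolding covered_def by blast
    then have "Suc W \<le> cost (dg k) (dg l)" using nc unfolding covered_def by (meson not_less_eq_eq)
    moreover from this have "(2::real) ^ Suc W \<le> 2 ^ cost (dg k) (dg l)" by (intro power_increasing) auto
    moreover have "cost (dg k) (dg l) \<le> m * (b + 1)" by (intro cost_le dg_le)
    ultimately show ?thesis using l(3) unfolding ok_def by linarith
  qed
  have "m * (b + 1) < big"
  proof -
    have "m < 2 ^ b" "b + 1 \<le> 2 ^ b" using m_le n_less by (auto simp: Suc_leI)
    then have "m * (b + 1) \<le> m * 2 ^ b" "m * 2 ^ b < 2 ^ b * 2 ^ b" by (simp_all only: mult_le_mono2) simp
    then show ?thesis unfolding big_def by (rule le_less_trans)
  qed
  then have ok_big: "W < big" if "ok W" for W using that unfolding ok_def by linarith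
  have tabs': "tabs ?s" by (rule tabs_frame[OF tabs]) auto
  have env': "env ?s" using tabs' by (simp add: tabs_def)
  let ?I = "\<lambda>k (t :: st). ok (vr t 10) \<and> (\<forall>k'<k. covered (vr t 10) (dg k'))"
  have "?I (vr ?s 7) (sem ?odo ?s)"
  proof (rule Odo_inv[where \<rho> = "\<lambda>_. b + 1" and I = ?I])
    show "\<forall>i<vr ?s 6. ar ?s 0 i = b + 1 \<and> 1 \<le> b + 1" using radices[OF env'] by simp
    show "?I 0 ?s" using B by (simp add: ok_def)
  next
    fix k t assume I: "?I k t" and D: "\<forall>i<vr ?s 6. ar t 8 i = dg k i"
      and f: "\<forall>x. x \<notin> modv ?odo \<longrightarrow> vr t x = vr ?s x" "\<forall>a. a \<notin> moda ?odo \<longrightarrow> ar t a = ar ?s a"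
    have tt: "tabs t" by (rule tabs_frame[OF tabs']) (use f in auto)
    then have big: "vr t 8 = big" by (simp add: tabs_def env_def regs_def)
    have D: "ar t 8 i = dg k i" if "i < m" for i using D that radices(2)[OF env'] by simp
    let ?J = "\<lambda>j (u :: st). ?I k u \<and> (covered (vr u 10) (dg k) \<or> j \<le> vr u 10)"
    have "?J (min (vr t 8) (vr t 8)) (sem (For 41 8 8 ?b) t)"
    proof (rule For_inv)
      show "?J 0 (upd 41 0 t)" using I by simp
    next
      fix j u assume J: "?J j u"
        and f: "\<forall>v. v \<notin> insert 41 (modv ?b) \<longrightarrow> vr u v = vr t v" "\<forall>a. a \<notin> moda ?b \<longrightarrow> ar u a = ar t a"
      have "tabs u" by (rule tabs_frame[OF tt]) (use f in auto)
      moreover have "ar u 8 i = dg k i \<and> dg k i \<le> b" if "i < m" for i using f D[OF that] dg_le by simp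
      ultimately have p: "vr (sem Probe u) 42 > 0 \<longleftrightarrow> covered (vr u 10) (dg k)"
        using sem_Probe[of u "dg k"] by simp
      have 10: "vr (sem ?b u) 10 = (if covered (vr u 10) (dg k) then vr u 10 else Suc (vr u 10))"
        using p by (auto simp: vr_frame)
      show "?J (Suc j) (upd 41 (Suc j) (sem ?b u))"
      proof (cases "covered (vr u 10) (dg k)")
        case True
        then show ?thesis using J 10 by (simp del: sem.simps)
      next
        case False
        moreover have "covered (Suc (vr u 10)) (dg k')" if "k' < k" for k'
          using J that covered_mono[of "vr u 10" "dg k'" "Suc (vr u 10)"] by simp
        ultimately show ?thesis using J 10 ok_Suc[OF False] by (simp del: sem.simps)
      qed
    qed
    then have J: "?J big (sem (For 41 8 8 ?b) t)" using big by simp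
    \<comment> \<open>An uncovered profile would have raised the threshold in all \<open>big\<close>
      rounds, beyond the largest possible cost.\<close>
    then have "covered (vr (sem (For 41 8 8 ?b) t) 10) (dg k)" using ok_big by fastforce
    then show "?I (Suc k) (sem (For 41 8 8 ?b) t)" using J by (auto simp: less_Suc_eq)
  qed auto
  moreover have "vr ?s 7 = (b + 1) ^ m" using radices(3)[OF env'] by simp
  ultimately have *: "ok (vr (sem Find s) 10) \<and> (\<forall>k<(b + 1) ^ m. covered (vr (sem Find s) 10) (dg k))"
    unfolding Find_def by simp
  then show "2 ^ vr (sem Find s) 10 \<le> B" "vr (sem Find s) 10 < big"
    "\<forall>k<(b + 1) ^ m. covered (vr (sem Find s) 10) (dg k)"
    using ok_big by (auto simp: ok_def)
qed

end

section \<open>Printing the family\<close>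

definition Word :: com where
  "Word = For 49 6 6 (Get 16 8 49 ;; Get 17 9 49 ;; Idx 18 16 4 17 ;; Get 16 11 49 ;; Idx 17 18 5 16 ;;
     Get 50 5 17 ;; Put 12 49 50)"

text \<open>Test and printing share one traversal, because a set must be known to avoid the padding
  before any of its elements is printed.\<close>

definition Trav :: "com \<Rightarrow> com" where
  "Trav leaf = For 49 6 6 (Get 50 12 49 ;; For 51 3 3 (Idx 16 50 3 51 ;; Get 17 2 16 ;;
     If 17 (Idx 52 49 3 51 ;; Inc 52 ;; leaf) Skip))"

definition Check :: com where
  "Check = Sb 16 52 0 ;; If 16 (Set 53 1) Skip"

definition Emit :: com where
  "Emit = Word ;; Set 53 0 ;; Trav Check ;; If 53 Skip (Trav (Out 52) ;; Set 16 0 ;; Out 16)"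

text \<open>The odometer ticks \<open>2 ^ W\<close> times rather than as often as the product of the
  family sizes demands, so that its cap is known beforehand. Surplus ticks wrap around and repeat
  sets.\<close>

definition Words :: com where
  "Words = For 19 6 6 (Get 16 8 19 ;; Get 17 9 19 ;; Idx 18 16 4 17 ;; Get 16 3 18 ;; Put 10 19 16) ;;
     Odo 54 11 11 10 6 Emit"

definition Show :: com where
  "Show = Odo 25 7 8 0 6 (Odo 43 7 9 0 6 (Eval ;; If 37 Skip (If 44 Skip Words)))"

lemma mod_Word [simp]: "modv Word = {12, 13, 16, 17, 18, 49, 50}" "moda Word = {12}" "silent Word"
  by (auto simp: Word_def)

lemma mod_Trav [simp]: "modv (Trav l) = {12, 13, 16, 17, 49, 50, 51, 52} \<union> modv l" "moda (Trav l) = moda l"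
  by (auto simp: Trav_def)

lemma mod_Check [simp]: "modv Check = {16, 53}" "moda Check = {}" "silent Check"
  by (auto simp: Check_def)

lemma mod_Emit [simp]: "modv Emit = {12, 13, 16, 17, 18, 49, 50, 51, 52, 53}" "moda Emit = {12}"
  by (auto simp: Emit_def)

lemma mod_Words [simp]:
  "modv Words = {12, 13, 14, 15, 16, 17, 18, 19, 49, 50, 51, 52, 53, 54}" "moda Words = {10, 11, 12}"
  by (auto simp: Words_def)

context tables
begin

definition wset :: "(nat \<Rightarrow> nat) \<Rightarrow> (nat \<Rightarrow> nat) \<Rightarrow> (nat \<Rightarrow> nat) \<Rightarrow> nat set" where
  "wset pv qv w = place b m (\<lambda>i. set_decode (Fam (pv i) (qv i) ! w i))"

lemma sem_Word:
  assumes tabs: "tabs s" and pv: "\<And>i. i < m \<Longrightarrow> ar s 8 i = pv i \<and> pv i \<le> b"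
    and qv: "\<And>i. i < m \<Longrightarrow> ar s 9 i = qv i \<and> qv i \<le> b"
    and w: "\<And>i. i < m \<Longrightarrow> ar s 11 i = w i \<and> w i < length (Fam (pv i) (qv i))"
  shows "\<forall>i<m. ar (sem Word s) 12 i = Fam (pv i) (qv i) ! w i"
proof -
  let ?c = "Get 16 8 49 ;; Get 17 9 49 ;; Idx 18 16 4 17 ;; Get 16 11 49 ;; Idx 17 18 5 16 ;;
     Get 50 5 17 ;; Put 12 49 50"
  have r: "vr s 4 = b + 1" "vr s 6 = m" "vr s 8 = big" "vr s 5 = 2 ^ b"
    using tabs by (auto simp: tabs_def env_def regs_def)
  have "\<forall>i<min (vr s 6) (vr s 6). ar (sem (For 49 6 6 ?c) s) 12 i = Fam (pv i) (qv i) ! w i"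
  proof (rule For_inv[where I = "\<lambda>k t. \<forall>i<k. ar t 12 i = Fam (pv i) (qv i) ! w i"])
    fix k and t :: st assume k: "k < min (vr s 6) (vr s 6)" and I: "\<forall>i<k. ar t 12 i = Fam (pv i) (qv i) ! w i"
      and v: "vr t 49 = k"
      and f: "\<forall>v. v \<notin> insert 49 (modv ?c) \<longrightarrow> vr t v = vr s v" "\<forall>a. a \<notin> moda ?c \<longrightarrow> ar t a = ar s a"
    have km: "k < m" using k r by simp
    note pq = pv[OF km] qv[OF km] w[OF km]
    let ?d = "pv k * (b + 1) + qv k"
    have vt: "vr t 4 = b + 1" "vr t 5 = 2 ^ b" "vr t 8 = big" "ar t 8 k = pv k" "ar t 9 k = qv k" "ar t 11 k = w k"
      "ar t 5 = ar s 5"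
      using f r pq by auto
    have 5: "ar s 5 (?d * 2 ^ b + w k) = Fam (pv k) (qv k) ! w k"
      using tabs pq unfolding tabs_def stored_def by blast
    have "length (Fam (pv k) (qv k)) \<le> 2 ^ b" using Fam pq by (simp add: block_family_def)
    then have le: "pv k \<le> big" "qv k \<le> big" "b + 1 \<le> big" "w k \<le> big" "2 ^ b \<le> big" "?d \<le> big"
      using pq big_ge index_le_big[of "pv k" "qv k"] by linarith+
    note i = sem_table_index[OF vt(1,3) le(1-3)]
    have "ar (sem ?c t) 12 = (ar t 12)(k := Fam (pv k) (qv k) ! w k)"
      using vt v le 5 i by (simp add: sem_Idx)
    then show "\<forall>i<Suc k. ar (upd 49 (Suc k) (sem ?c t)) 12 i = Fam (pv i) (qv i) ! w i"
      using I by (auto simp: less_Suc_eq simp del: sem.simps)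
  qed simp
  then show ?thesis using r by (simp add: Word_def)
qed

lemma place_cong: "(\<And>i. i < m \<Longrightarrow> D i = D' i) \<Longrightarrow> place b m D = place b m D'"
  unfolding place_def by (intro Collect_cong) metis

lemma place_mem_iff:
  assumes "\<And>i. i < m \<Longrightarrow> D i \<subseteq> {..<b}" "i < m" "x < b"
  shows "i * b + x + 1 \<in> place b m D \<longleftrightarrow> x \<in> D i"
proof
  assume "i * b + x + 1 \<in> place b m D"
  then obtain j y where "i * b + x = j * b + y" "j < m" "y \<in> D j" by (auto simp: place_def)
  then show "x \<in> D i" using index_eq_iff[of x b y i j] assms by (auto simp: subset_iff)
qed (use assms in \<open>auto simp: place_def\<close>)

text \<open>Positions are visited in the order of their numbers \<open>e\<close>. The invariant sees
  only \<open>e\<close>, flag 53 and the output, which is enough for both the test and the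
  printing.\<close>

lemma Trav_inv:
  assumes env: "env s" and Y: "\<And>i. i < m \<Longrightarrow> ar s 12 i = Y i \<and> Y i < 2 ^ b"
    and leaf: "modv l \<inter> ({..<10} \<union> {49, 50, 51}) = {}" "moda l = {}"
    and start: "I 1 (vr s 53) (ot s)"
    and skip: "\<And>e u w. e \<notin> place b m (\<lambda>i. set_decode (Y i)) \<Longrightarrow> I e u w \<Longrightarrow> I (Suc e) u w"
    and step: "\<And>e t. e \<in> place b m (\<lambda>i. set_decode (Y i)) \<Longrightarrow> vr t 52 = e \<Longrightarrow> vr t 0 = n \<Longrightarrow>
      I e (vr t 53) (ot t) \<Longrightarrow> I (Suc e) (vr (sem l t) 53) (ot (sem l t))"
  shows "I (m * b + 1) (vr (sem (Trav l) s) 53) (ot (sem (Trav l) s))"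
proof -
  let ?E = "place b m (\<lambda>i. set_decode (Y i))"
  let ?c = "Idx 16 50 3 51 ;; Get 17 2 16 ;; If 17 (Idx 52 49 3 51 ;; Inc 52 ;; l) Skip"
  let ?o = "Get 50 12 49 ;; For 51 3 3 ?c"
  have r: "vr s 3 = b" "vr s 6 = m" "vr s 8 = big" "vr s 0 = n" using env by (auto simp: env_def regs_def)
  have bits: "ar s 2 (y * b + x) = of_bool (x \<in> set_decode y)" if "y < 2 ^ b" "x < b" for y x
    using env that by (auto simp: env_def)
  have ml: "v \<notin> modv l" if "v < 10 \<or> v = 49 \<or> v = 50 \<or> v = 51" for v
    using leaf(1) that by auto
  let ?J = "\<lambda>k (t :: st). I (k * b + 1) (vr t 53) (ot t)"
  have "?J (min (vr s 6) (vr s 6)) (sem (For 49 6 6 ?o) s)"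
  proof (rule For_inv[where I = ?J])
    show "?J 0 (upd 49 0 s)" using start by simp
  next
    fix k and t :: st assume k: "k < min (vr s 6) (vr s 6)" and J: "?J k t" and v: "vr t 49 = k"
      and f: "\<forall>v. v \<notin> insert 49 (modv ?o) \<longrightarrow> vr t v = vr s v" "\<forall>a. a \<notin> moda ?o \<longrightarrow> ar t a = ar s a"
    have km: "k < m" using k r by simp
    let ?t = "upd 50 (Y k) t"
    have vt: "vr t 3 = b" "vr t 8 = big" "vr t 0 = n" using f(1) r ml by auto
    have at: "ar t 2 = ar s 2" "ar t 12 = ar s 12" using f(2) leaf(2) by auto
    let ?K = "\<lambda>x (u :: st). I (k * b + x + 1) (vr u 53) (ot u)"
    have "?K (min (vr ?t 3) (vr ?t 3)) (sem (For 51 3 3 ?c) ?t)"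
    proof (rule For_inv[where I = ?K])
      show "?K 0 (upd 51 0 ?t)" using J by simp
    next
      fix x and u :: st assume x: "x < min (vr ?t 3) (vr ?t 3)" and K: "?K x u" and vx: "vr u 51 = x"
        and f: "\<forall>v. v \<notin> insert 51 (modv ?c) \<longrightarrow> vr u v = vr ?t v" "\<forall>a. a \<notin> moda ?c \<longrightarrow> ar u a = ar ?t a"
      have xb: "x < b" using x vt by simp
      have vu: "vr u 3 = b" "vr u 8 = big" "vr u 0 = n" "vr u 49 = k" "vr u 50 = Y k"
        using f(1) vt v ml by auto
      have au: "ar u 2 = ar s 2" using f(2) leaf(2) at by auto
      have le: "Y k \<le> big" "b \<le> big" "x \<le> big" "k \<le> big"
        using Y[OF km] big_ge xb km by auto
      have mem: "k * b + x + 1 \<in> ?E \<longleftrightarrow> x \<in> set_decode (Y k)"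
        using Y km xb by (intro place_mem_iff) (auto simp: set_decode_subset_iff)
      let ?u = "upd 17 (of_bool (x \<in> set_decode (Y k))) (upd 13 (Y k) (upd 12 x (upd 16 (Y k * b + x) u)))"
      have c: "sem ?c u = sem (If 17 (Idx 52 49 3 51 ;; Inc 52 ;; l) Skip) ?u"
        using vu vx le au bits[of "Y k" x] Y[OF km] xb by (simp add: sem_Idx)
      have "?K (Suc x) (sem ?c u)"
      proof (cases "x \<in> set_decode (Y k)")
        case True
        let ?w = "upd 52 (k * b + x + 1) (upd 13 k (upd 12 x (upd 52 (k * b + x) ?u)))"
        have "sem ?c u = sem l ?w"
          unfolding c using True vu vx le by (simp add: sem_Idx)
        moreover have "I (Suc (k * b + x + 1)) (vr (sem l ?w) 53) (ot (sem l ?w))"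
          using True mem K vu by (intro step) auto
        ultimately show ?thesis by (simp del: sem.simps)
      next
        case False
        then show ?thesis unfolding c using mem K skip[of "k * b + x + 1"] by simp
      qed
      then show "?K (Suc x) (upd 51 (Suc x) (sem ?c u))" by (simp del: sem.simps)
    qed
    then have "?J (Suc k) (sem (For 51 3 3 ?c) ?t)" using vt by (simp add: add.commute)
    then show "?J (Suc k) (upd 49 (Suc k) (sem ?o t))" using at v Y[OF km] by simp
  qed
  then show ?thesis using r by (simp add: Trav_def)
qed

lemma place_less: "\<And>e. e \<in> place b m D \<Longrightarrow> (\<And>i. i < m \<Longrightarrow> D i \<subseteq> {..<b}) \<Longrightarrow> 1 \<le> e \<and> e < m * b + 1"
proof -
  fix e assume e: "e \<in> place b m D" and D: "\<And>i. i < m \<Longrightarrow> D i \<subseteq> {..<b}"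
  obtain i x where ix: "e = i * b + x + 1" "i < m" "x \<in> D i" using e by (auto simp: place_def)
  then have "x < b" using D by auto
  then have "i * b + x < (i + 1) * b" by simp
  also have "\<dots> \<le> m * b" using ix by (intro mult_le_mono1) simp
  finally show "1 \<le> e \<and> e < m * b + 1" using ix by simp
qed

text \<open>An inclusion of \<open>X\<close> is enough: all printed sets have the right form, and
  the size of the family is bounded through the length of the output.\<close>

definition out_ok :: "nat set set \<Rightarrow> st \<Rightarrow> bool" where
  "out_ok X s \<longleftrightarrow> (\<exists>Ys. ot s = concat (map (\<lambda>Y. Y @ [0]) Ys) \<and>
     (\<forall>Y\<in>set Ys. distinct Y \<and> 0 \<notin> set Y \<and> set Y \<subseteq> {1..n} \<and> card (set Y) = q) \<and> X \<subseteq> set ` set Ys)"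

lemma out_ok_mono: "out_ok X s \<Longrightarrow> X' \<subseteq> X \<Longrightarrow> ot s' = ot s \<Longrightarrow> out_ok X' s'"
  unfolding out_ok_def by fastforce

lemma out_ok_snoc:
  assumes "out_ok X s" "ot s' = ot s @ L @ [0]" "distinct L" "0 \<notin> set L" "set L \<subseteq> {1..n}" "card (set L) = q"
  shows "out_ok (insert (set L) X) s'"
proof -
  obtain Ys where Ys: "ot s = concat (map (\<lambda>Y. Y @ [0]) Ys)"
    "\<forall>Y\<in>set Ys. distinct Y \<and> 0 \<notin> set Y \<and> set Y \<subseteq> {1..n} \<and> card (set Y) = q" "X \<subseteq> set ` set Ys"
    using assms(1) unfolding out_ok_def by blast
  show ?thesis unfolding out_ok_def
    by (rule exI[of _ "Ys @ [L]"]) (use Ys assms in auto)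
qed

lemma wset_less:
  assumes "\<And>i. i < m \<Longrightarrow> pv i \<le> b \<and> qv i \<le> b \<and> w i < length (Fam (pv i) (qv i))" "i < m"
  shows "Fam (pv i) (qv i) ! w i < 2 ^ b" "card (set_decode (Fam (pv i) (qv i) ! w i)) = qv i"
    "set_decode (Fam (pv i) (qv i) ! w i) \<subseteq> {..<b}"
proof -
  have "Fam (pv i) (qv i) ! w i \<in> set (Fam (pv i) (qv i))" using assms by (intro nth_mem) auto
  then show "Fam (pv i) (qv i) ! w i < 2 ^ b" "card (set_decode (Fam (pv i) (qv i) ! w i)) = qv i"
    using Fam[of "pv i" "qv i"] assms unfolding block_family_def by blast+
  then show "set_decode (Fam (pv i) (qv i) ! w i) \<subseteq> {..<b}" using set_decode_subset_iff by blast
qed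

text \<open>Sets reaching into the padding are dropped. This loses no coverage, since a set
  contained in a subset of \<open>{1..n}\<close> never reaches there.\<close>

lemma sem_Emit:
  assumes tabs: "tabs s" and pv: "\<And>i. i < m \<Longrightarrow> ar s 8 i = pv i \<and> pv i \<le> b"
    and qv: "\<And>i. i < m \<Longrightarrow> ar s 9 i = qv i \<and> qv i \<le> b"
    and w: "\<And>i. i < m \<Longrightarrow> ar s 11 i = w i \<and> w i < length (Fam (pv i) (qv i))"
    and sp: "split pv qv" and ok: "out_ok X s"
  shows "out_ok (X \<union> (if wset pv qv w \<subseteq> {1..n} then {wset pv qv w} else {})) (sem Emit s)"
proof -
  let ?Y = "\<lambda>i. Fam (pv i) (qv i) ! w i" and ?E = "wset pv qv w"
  define s1 where "s1 = upd 53 0 (sem Word s)"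
  define s2 where "s2 = sem (Trav Check) s1"
  have D: "?Y i < 2 ^ b" "card (set_decode (?Y i)) = qv i" "set_decode (?Y i) \<subseteq> {..<b}" if "i < m" for i
    using wset_less[of pv qv w i] pv qv w that by blast+
  have Y1: "ar s1 12 i = ?Y i \<and> ?Y i < 2 ^ b" if "i < m" for i
    using sem_Word[OF tabs pv qv w] D that by (simp add: s1_def)
  have t1: "tabs s1" by (rule tabs_frame[OF tabs]) (auto simp: s1_def vr_frame ar_frame)
  have e1: "env s1" using t1 by (simp add: tabs_def)
  have E: "place b m (\<lambda>i. set_decode (?Y i)) = ?E" by (simp add: wset_def)
  have range: "1 \<le> e \<and> e < m * b + 1" if "e \<in> ?E" for e
    using place_less[of e "\<lambda>i. set_decode (?Y i)"] that D(3) unfolding wset_def by blast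
  have "(vr s2 53 = 0 \<longleftrightarrow> (\<forall>e\<in>?E. e < m * b + 1 \<longrightarrow> e \<le> n)) \<and> ot s2 = ot s"
    unfolding s2_def
  proof (rule Trav_inv[OF e1 Y1, where I = "\<lambda>e u w. (u = 0 \<longleftrightarrow> (\<forall>e'\<in>?E. e' < e \<longrightarrow> e' \<le> n)) \<and> w = ot s"])
    show "(vr s1 53 = 0 \<longleftrightarrow> (\<forall>e'\<in>?E. e' < 1 \<longrightarrow> e' \<le> n)) \<and> ot s1 = ot s"
      by (simp add: s1_def ot_frame)
  next
    fix e and t :: st assume a: "e \<in> place b m (\<lambda>i. set_decode (?Y i))" "vr t 52 = e" "vr t 0 = n"
      and I: "(vr t 53 = 0 \<longleftrightarrow> (\<forall>e'\<in>?E. e' < e \<longrightarrow> e' \<le> n)) \<and> ot t = ot s"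
    have "vr (sem Check t) 53 = (if e \<le> n then vr t 53 else 1)" "ot (sem Check t) = ot t"
      using a by (auto simp: Check_def)
    then show "(vr (sem Check t) 53 = 0 \<longleftrightarrow> (\<forall>e'\<in>?E. e' < Suc e \<longrightarrow> e' \<le> n)) \<and> ot (sem Check t) = ot s"
      using I a unfolding E by (auto simp: less_Suc_eq)
  next
    fix e u :: nat and w' assume "e \<notin> place b m (\<lambda>i. set_decode (?Y i))"
      "(u = 0 \<longleftrightarrow> (\<forall>e'\<in>?E. e' < e \<longrightarrow> e' \<le> n)) \<and> w' = ot s"
    then show "(u = 0 \<longleftrightarrow> (\<forall>e'\<in>?E. e' < Suc e \<longrightarrow> e' \<le> n)) \<and> w' = ot s"
      unfolding E by (metis less_Suc_eq)
  qed auto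
  then have s2: "vr s2 53 = 0 \<longleftrightarrow> ?E \<subseteq> {1..n}" "ot s2 = ot s"
    using range by fastforce+
  show ?thesis
  proof (cases "?E \<subseteq> {1..n}")
    case False
    then have "sem Emit s = s2" using s2(1) by (auto simp: Emit_def s1_def[symmetric] s2_def[symmetric])
    then show ?thesis using out_ok_mono[OF ok order_refl] s2(2) False by simp
  next
    case True
    define L where "L = filter (\<lambda>e. e \<in> ?E) [1..<m * b + 1]"
    have e2: "env s2" using e1 unfolding s2_def by (rule env_sem) auto
    have Y2: "ar s2 12 i = ?Y i \<and> ?Y i < 2 ^ b" if "i < m" for i
      using Y1[OF that] by (simp add: s2_def ar_frame)
    have "ot (sem (Trav (Out 52)) s2) = ot s @ L"
      unfolding L_def
    proof (rule Trav_inv[OF e2 Y2, where I = "\<lambda>e u w. w = ot s @ filter (\<lambda>e. e \<in> ?E) [1..<e]"])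
      fix e u :: nat and w' assume "e \<notin> place b m (\<lambda>i. set_decode (?Y i))" "w' = ot s @ filter (\<lambda>e. e \<in> ?E) [1..<e]"
      then show "w' = ot s @ filter (\<lambda>e. e \<in> ?E) [1..<Suc e]" unfolding E by simp
    next
      fix e and t :: st assume e: "e \<in> place b m (\<lambda>i. set_decode (?Y i))" "vr t 52 = e"
        "ot t = ot s @ filter (\<lambda>e. e \<in> ?E) [1..<e]"
      then show "ot (sem (Out 52) t) = ot s @ filter (\<lambda>e. e \<in> ?E) [1..<Suc e]"
        using range[of e] unfolding E by simp
    qed (use s2(2) in auto)
    moreover have "sem Emit s = sem (Trav (Out 52) ;; Set 16 0 ;; Out 16) s2"
      using True s2(1) by (auto simp: Emit_def s1_def[symmetric] s2_def[symmetric])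
    ultimately have o: "ot (sem Emit s) = ot s @ L @ [0]" by simp
    have setL: "set L = ?E"
    proof (intro equalityI subsetI)
      fix e assume "e \<in> ?E"
      with range[of e] show "e \<in> set L" by (simp add: L_def del: upt_Suc)
    qed (simp add: L_def del: upt_Suc)
    have "card ?E = (\<Sum>i<m. card (set_decode (?Y i)))"
      unfolding wset_def using D(3) by (rule card_place)
    also have "\<dots> = q" using D(2) sp by (simp add: split_def)
    finally have "out_ok (insert (set L) X) (sem Emit s)"
      using ok o True setL by (intro out_ok_snoc[of X s]) (auto simp: L_def)
    then show ?thesis using True setL by simp
  qed
qed

definition wsets :: "(nat \<Rightarrow> nat) \<Rightarrow> (nat \<Rightarrow> nat) \<Rightarrow> nat set set" where
  "wsets pv qv = {wset pv qv w | w. (\<forall>i<m. w i < length (Fam (pv i) (qv i))) \<and> wset pv qv w \<subseteq> {1..n}}"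

text \<open>Some member must lie inside \<open>{..<P}\<close>. Nonemptiness makes the family sizes
  admissible radices and removes the maximum in \<open>log_size\<close>.\<close>

lemma Fam_nonempty:
  assumes "Q \<le> P" "P \<le> b"
  shows "1 \<le> length (Fam P Q)"
proof -
  have "block_family b P Q (Fam P Q)" using assms Fam by simp
  moreover have "set_decode (set_encode {..<P}) = {..<P}" by simp
  moreover have "set_encode {..<P} < 2 ^ b" using assms by (intro set_encode_less) auto
  ultimately have "\<exists>Y\<in>set (Fam P Q). set_decode Y \<subseteq> {..<P}"
    using assms unfolding block_family_def by (metis card_lessThan)
  then show ?thesis by (cases "Fam P Q") auto
qed

lemma prod_length_le:
  assumes "\<And>i. i < m \<Longrightarrow> pv i \<le> b" "\<And>i. i < m \<Longrightarrow> qv i \<le> b"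
  shows "(\<Prod>i<m. length (Fam (pv i) (qv i))) \<le> 2 ^ cost pv qv"
proof -
  have "(\<Prod>i<m. length (Fam (pv i) (qv i))) \<le> (\<Prod>i<m. 2 ^ c (pv i) (qv i))"
    using assms log_c by (intro prod_mono) (auto simp: log_size_def)
  then show ?thesis by (simp add: cost_def power_sum)
qed

lemma sem_Words:
  assumes tabs: "tabs s" and pv: "\<And>i. i < m \<Longrightarrow> ar s 8 i = pv i \<and> pv i \<le> b"
    and qv: "\<And>i. i < m \<Longrightarrow> ar s 9 i = qv i \<and> qv i \<le> b"
    and sp: "split pv qv" and W: "2 ^ cost pv qv \<le> vr s 11" and ok: "out_ok X s"
  shows "out_ok (X \<union> wsets pv qv) (sem Words s)"
proof -
  let ?c = "Get 16 8 19 ;; Get 17 9 19 ;; Idx 18 16 4 17 ;; Get 16 3 18 ;; Put 10 19 16"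
  let ?\<rho> = "\<lambda>i. length (Fam (pv i) (qv i))"
  define s1 where "s1 = sem (For 19 6 6 ?c) s"
  have r: "vr s 4 = b + 1" "vr s 6 = m" "vr s 8 = big" using tabs by (auto simp: tabs_def env_def regs_def)
  have "\<forall>i<min (vr s 6) (vr s 6). ar s1 10 i = ?\<rho> i"
    unfolding s1_def
  proof (rule For_inv[where I = "\<lambda>k t. \<forall>i<k. ar t 10 i = ?\<rho> i"])
    fix k and t :: st assume k: "k < min (vr s 6) (vr s 6)" and I: "\<forall>i<k. ar t 10 i = ?\<rho> i"
      and v: "vr t 19 = k"
      and f: "\<forall>v. v \<notin> insert 19 (modv ?c) \<longrightarrow> vr t v = vr s v" "\<forall>a. a \<notin> moda ?c \<longrightarrow> ar t a = ar s a"
    have km: "k < m" using k r by simp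
    note pq = pv[OF km] qv[OF km]
    have vt: "vr t 4 = b + 1" "vr t 8 = big" "ar t 8 k = pv k" "ar t 9 k = qv k" "ar t 3 = ar s 3"
      using f r pq by auto
    have 3: "ar s 3 (pv k * (b + 1) + qv k) = ?\<rho> k" using tabs pq unfolding tabs_def by blast
    have le: "pv k \<le> big" "qv k \<le> big" "b + 1 \<le> big" using pq big_ge(2) by auto
    note i = sem_table_index[OF vt(1,2) le(1-3)]
    have "ar (sem ?c t) 10 = (ar t 10)(k := ?\<rho> k)" using vt v 3 i by simp
    then show "\<forall>i<Suc k. ar (upd 19 (Suc k) (sem ?c t)) 10 i = ?\<rho> i"
      using I by (auto simp: less_Suc_eq simp del: sem.simps)
  qed simp
  then have 10: "\<forall>i<m. ar s1 10 i = ?\<rho> i" using r by simp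
  have pos: "1 \<le> ?\<rho> i" if "i < m" for i
    using Fam_nonempty[of "qv i" "pv i"] sp pv that by (auto simp: split_def)
  have t1: "tabs s1" by (rule tabs_frame[OF tabs]) (auto simp: s1_def vr_frame ar_frame)
  have f1: "vr s1 6 = m" "vr s1 11 = vr s 11" "ar s1 8 = ar s 8" "ar s1 9 = ar s 9" "ot s1 = ot s"
    using r by (simp_all add: s1_def vr_frame ar_frame ot_frame)
  let ?odo = "Odo 54 11 11 10 6 Emit"
  let ?G = "\<lambda>k. X \<union> {wset pv qv (digit ?\<rho> j) | j. j < k \<and> wset pv qv (digit ?\<rho> j) \<subseteq> {1..n}}"
  let ?I = "\<lambda>k. out_ok (?G k)"
  have "?I (vr s1 11) (sem ?odo s1)"
  proof (rule Odo_inv[where \<rho> = ?\<rho> and I = ?I])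
    show "\<forall>i<vr s1 6. ar s1 10 i = ?\<rho> i \<and> 1 \<le> ?\<rho> i" using 10 pos f1 by simp
    show "?I k t'" if "?I k t" "ot t' = ot t" for k t t'
      using that by (auto intro: out_ok_mono)
    show "?I 0 s1" by (rule out_ok_mono[OF ok]) (use f1 in auto)
  next
    fix k t assume I: "?I k t" and D: "\<forall>i<vr s1 6. ar t 11 i = digit ?\<rho> k i"
      and f: "\<forall>x. x \<notin> modv ?odo \<longrightarrow> vr t x = vr s1 x" "\<forall>a. a \<notin> moda ?odo \<longrightarrow> ar t a = ar s1 a"
    have tt: "tabs t" by (rule tabs_frame[OF t1]) (use f in auto)
    have w: "ar t 11 i = digit ?\<rho> k i \<and> digit ?\<rho> k i < ?\<rho> i" if "i < m" for i
      using D f1(1) that pos digit_less[of ?\<rho> i k] by simp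
    have "out_ok (?G k \<union> (if wset pv qv (digit ?\<rho> k) \<subseteq> {1..n} then {wset pv qv (digit ?\<rho> k)} else {})) (sem Emit t)"
      using tt _ _ w sp I by (rule sem_Emit) (use f f1 pv qv in auto)
    moreover have "?G (Suc k) \<subseteq> ?G k \<union> (if wset pv qv (digit ?\<rho> k) \<subseteq> {1..n} then {wset pv qv (digit ?\<rho> k)} else {})"
      by (auto simp: less_Suc_eq)
    ultimately show "?I (Suc k) (sem Emit t)" by (rule out_ok_mono) simp
  qed auto
  moreover have "X \<union> wsets pv qv \<subseteq> ?G (vr s1 11)"
  proof -
    have "wset pv qv w \<in> ?G (vr s1 11)" if "\<forall>i<m. w i < ?\<rho> i" "wset pv qv w \<subseteq> {1..n}" for w
    proof -
      obtain k where k: "k < (\<Prod>i<m. ?\<rho> i)" "\<forall>i<m. digit ?\<rho> k i = w i"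
        using digit_surj[of m w ?\<rho>] \<open>\<forall>i<m. w i < ?\<rho> i\<close> by blast
      \<comment> \<open>The number of choices is at most the number of ticks in variable 11, so
        every choice of members turns up.\<close>
      have "(\<Prod>i<m. ?\<rho> i) \<le> 2 ^ cost pv qv" using pv qv by (intro prod_length_le) auto
      then have "k < vr s1 11" using k(1) W f1 by linarith
      moreover have "wset pv qv (digit ?\<rho> k) = wset pv qv w"
        unfolding wset_def by (rule place_cong) (use k(2) in simp)
      ultimately have "\<exists>j. wset pv qv w = wset pv qv (digit ?\<rho> j) \<and> j < vr s1 11 \<and>
          wset pv qv (digit ?\<rho> j) \<subseteq> {1..n}"
        using that(2) by (intro exI[of _ k]) simp
      then show ?thesis by (intro UnI2 CollectI)
    qed
    then show ?thesis unfolding wsets_def by blast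
  qed
  ultimately have "out_ok (X \<union> wsets pv qv) (sem ?odo s1)" by (rule out_ok_mono) simp
  then show ?thesis by (simp add: Words_def s1_def)
qed

definition family :: "nat \<Rightarrow> nat set set" where
  "family W = (\<Union>k<(b + 1) ^ m. \<Union>l\<in>{l. l < (b + 1) ^ m \<and> split (dg k) (dg l) \<and>
     cost (dg k) (dg l) \<le> W \<and> \<not> (\<Sum>i<m. dg k i) < p}. wsets (dg k) (dg l))"

lemma sem_Show:
  assumes tabs: "tabs s" and W: "vr s 11 = 2 ^ vr s 10" and out: "ot s = []"
  shows "out_ok (family (vr s 10)) (sem Show s)"
proof -
  let ?c = "Eval ;; If 37 Skip (If 44 Skip Words)"
  let ?in = "Odo 43 7 9 0 6 ?c"
  let ?odo = "Odo 25 7 8 0 6 ?in"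
  let ?ok = "\<lambda>k l. split (dg k) (dg l) \<and> cost (dg k) (dg l) \<le> vr s 10 \<and> \<not> (\<Sum>i<m. dg k i) < p"
  let ?A = "\<lambda>k L. \<Union>l\<in>{l. l < L \<and> ?ok k l}. wsets (dg k) (dg l)"
  let ?V = "(b + 1) ^ m"
  let ?B = "\<lambda>K. \<Union>k<K. ?A k ?V"
  have env: "env s" using tabs by (simp add: tabs_def)
  have "out_ok (?B (vr s 7)) (sem ?odo s)"
  proof (rule Odo_inv[where \<rho> = "\<lambda>_. b + 1" and I = "\<lambda>k. out_ok (?B k)"])
    show "\<forall>i<vr s 6. ar s 0 i = b + 1 \<and> 1 \<le> b + 1" using radices[OF env] by simp
    show "out_ok (?B 0) s" unfolding out_ok_def using out by (intro exI[of _ "[]"]) simp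
    show "out_ok (?B k) t'" if "out_ok (?B k) t" "ot t' = ot t" for k t t'
      using that by (auto intro: out_ok_mono)
  next
    fix k t assume I: "out_ok (?B k) t" and D: "\<forall>i<vr s 6. ar t 8 i = dg k i"
      and f: "\<forall>x. x \<notin> modv ?odo \<longrightarrow> vr t x = vr s x" "\<forall>a. a \<notin> moda ?odo \<longrightarrow> ar t a = ar s a"
    have tt: "tabs t" by (rule tabs_frame[OF tabs]) (use f in auto)
    have et: "env t" using tt by (simp add: tabs_def)
    have vt: "vr t 10 = vr s 10" "vr t 11 = vr s 11" using f by auto
    have D: "ar t 8 i = dg k i" if "i < m" for i using D that radices(2)[OF env] by simp
    have "out_ok (?B k \<union> ?A k (vr t 7)) (sem ?in t)"
    proof (rule Odo_inv[where \<rho> = "\<lambda>_. b + 1" and I = "\<lambda>l. out_ok (?B k \<union> ?A k l)"])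
      show "\<forall>i<vr t 6. ar t 0 i = b + 1 \<and> 1 \<le> b + 1" using radices[OF et] by simp
      show "out_ok (?B k \<union> ?A k 0) t" using I by simp
      show "out_ok (?B k \<union> ?A k l) u'" if "out_ok (?B k \<union> ?A k l) u" "ot u' = ot u" for l u u'
        using that by (auto intro: out_ok_mono)
    next
      fix l u assume I: "out_ok (?B k \<union> ?A k l) u" and D': "\<forall>i<vr t 6. ar u 9 i = dg l i"
        and f: "\<forall>x. x \<notin> modv ?in \<longrightarrow> vr u x = vr t x" "\<forall>a. a \<notin> moda ?in \<longrightarrow> ar u a = ar t a"
      have tu: "tabs u" by (rule tabs_frame[OF tt]) (use f in auto)
      have vu: "vr u 10 = vr s 10" "vr u 11 = vr s 11" using f vt by auto
      have pv: "ar u 8 i = dg k i \<and> dg k i \<le> b" if "i < m" for i using f D[OF that] dg_le by simp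
      have qv: "ar u 9 i = dg l i \<and> dg l i \<le> b" if "i < m" for i
        using D' that dg_le radices(2)[OF et] by simp
      let ?e = "sem Eval u"
      have e: "vr ?e 37 = 0 \<longleftrightarrow> split (dg k) (dg l) \<and> cost (dg k) (dg l) \<le> vr s 10"
        "vr ?e 44 = p - (\<Sum>i<m. dg k i)"
        using sem_Eval[OF tu pv qv] vu by auto
      have ote: "ot ?e = ot u" by (simp add: ot_frame)
      show "out_ok (?B k \<union> ?A k (Suc l)) (sem ?c u)"
      proof (cases "?ok k l")
        case True
        then have c: "sem ?c u = sem Words ?e" using e by simp
        have te: "tabs ?e" by (rule tabs_frame[OF tu]) (auto intro!: vr_frame ar_frame)
        have "2 ^ cost (dg k) (dg l) \<le> vr ?e 11"
          using True vu W by (simp add: vr_frame power_increasing)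
        moreover have "out_ok (?B k \<union> ?A k l) ?e" by (rule out_ok_mono[OF I order_refl ote])
        ultimately have "out_ok (?B k \<union> ?A k l \<union> wsets (dg k) (dg l)) (sem Words ?e)"
          using True pv qv by (intro sem_Words[OF te]) (auto simp: ar_frame)
        then have "out_ok (?B k \<union> ?A k l \<union> wsets (dg k) (dg l)) (sem ?c u)" unfolding c .
        then show ?thesis by (rule out_ok_mono) (auto simp: less_Suc_eq)
      next
        case False
        then have c: "sem ?c u = ?e" using e by auto
        have "?A k (Suc l) = ?A k l" using False by (auto simp: less_Suc_eq)
        then show ?thesis unfolding c using out_ok_mono[OF I _ ote, of "?B k \<union> ?A k (Suc l)"] by simp
      qed
    qed auto
    moreover have "vr t 7 = ?V" using radices(3)[OF et] .
    ultimately have "out_ok (?B k \<union> ?A k ?V) (sem ?in t)" by simp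
    moreover have "?B (Suc k) = ?B k \<union> ?A k ?V" by (simp only: lessThan_Suc UN_insert Un_commute)
    ultimately show "out_ok (?B (Suc k)) (sem ?in t)" by (simp only:)
  qed auto
  then show ?thesis using radices(3)[OF env] by (simp add: Show_def family_def)
qed

end

section \<open>Correctness and number of steps\<close>

context blocks
begin

text \<open>All that is lost against \<open>kappa n p q\<close>: in each block a factor
  \<open>b + 1\<close> from greedy cover and 2 from rounding to a power of two, and once a factor
  for the padding.\<close>

definition excess :: real where
  "excess = (2 * (real b + 1)) ^ m * real ((n + b + 1) ^ b)"

lemma kappa_blocks_le: "kappa (m * b) p q \<le> kappa n p q * real ((n + b + 1) ^ b)"
proof -
  have "(m * b) ^ (m * b - n) \<le> (n + b + 1) ^ (m * b - n)"
    using mb_le by (intro power_mono) auto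
  also have "\<dots> \<le> (n + b + 1) ^ b" using mb_le by (intro power_increasing) auto
  finally have "real ((m * b) ^ (m * b - n)) \<le> real ((n + b + 1) ^ b)" by (simp only: of_nat_le_iff)
  moreover have "kappa (m * b) p q \<le> kappa n p q * real ((m * b) ^ (m * b - n))"
    using kappa_add_le[of q n "m * b - n" p] n_le qp pn by simp
  moreover have "0 \<le> kappa n p q" by (simp add: kappa_def)
  ultimately show ?thesis by (meson mult_left_mono order_trans)
qed

end

context tables
begin

text \<open>In every block \<open>2 ^ c\<close> is at most twice the family size, hence at most
  \<open>2 * (b + 1)\<close> times the ratio of the block; these bounds are multiplied along the
  split from \<open>kappa_split_blocks\<close>.\<close>

lemma exists_split:
  assumes pv: "\<And>i. i < m \<Longrightarrow> pv i \<le> b" and p: "p \<le> (\<Sum>i<m. pv i)"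
  shows "\<exists>l<(b + 1) ^ m. split pv (dg l) \<and> 2 ^ cost pv (dg l) \<le> kappa n p q * excess"
proof -
  obtain qv where qv: "\<forall>i<m. qv i \<le> pv i" "(\<Sum>i<m. qv i) = q"
    "(\<Prod>i<m. kappa b (pv i) (qv i)) \<le> kappa (m * b) (\<Sum>i<m. pv i) q"
    using kappa_split_blocks[of m pv b q] pv p qp by auto
  have "qv i < b + 1" if "i < m" for i using qv(1) pv[OF that] that by fastforce
  then obtain l where l: "l < (\<Prod>j<m. b + 1)" "\<forall>i<m. dg l i = qv i"
    using digit_surj[of m qv "\<lambda>_. b + 1"] by blast
  have "real (2 ^ c (pv i) (qv i)) \<le> 2 * (real b + 1) * kappa b (pv i) (qv i)" if "i < m" for i
  proof -
    have i: "pv i \<le> b" "qv i \<le> pv i" "qv i \<le> b" using pv[OF that] qv(1) that by auto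
    have "1 \<le> length (Fam (pv i) (qv i))" using Fam_nonempty i by simp
    then have "2 ^ c (pv i) (qv i) \<le> 2 * length (Fam (pv i) (qv i))"
      using log_c[of "pv i" "qv i"] i by (simp add: log_size_def)
    then have "real (2 ^ c (pv i) (qv i)) \<le> 2 * real (length (Fam (pv i) (qv i)))"
      by (metis of_nat_le_iff of_nat_mult of_nat_numeral)
    also have "\<dots> \<le> 2 * (kappa b (pv i) (qv i) * (real b + 1))"
      using Fam[of "pv i" "qv i"] i by (simp add: block_family_def)
    finally show ?thesis by (simp only: mult_ac)
  qed
  then have "(\<Prod>i<m. real (2 ^ c (pv i) (qv i))) \<le> (\<Prod>i<m. 2 * (real b + 1) * kappa b (pv i) (qv i))"
    by (intro prod_mono) auto
  also have "\<dots> = (2 * (real b + 1)) ^ m * (\<Prod>i<m. kappa b (pv i) (qv i))"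
    by (simp add: prod.distrib)
  also have "\<dots> \<le> (2 * (real b + 1)) ^ m * (kappa n p q * real ((n + b + 1) ^ b))"
    using qv(3) kappa_antimono[OF qp p, of "m * b"] kappa_blocks_le by (intro mult_left_mono) auto
  finally have "(\<Prod>i<m. real (2 ^ c (pv i) (qv i))) \<le> kappa n p q * excess"
    by (simp add: excess_def mult_ac)
  moreover have "cost pv (dg l) = cost pv qv" using l(2) by (simp add: cost_def)
  ultimately have "2 ^ cost pv (dg l) \<le> kappa n p q * excess"
    by (simp add: cost_def power_sum)
  moreover have "split pv (dg l)" using l(2) qv by (simp add: split_def)
  ultimately show ?thesis using l(1) by auto
qed

text \<open>A set \<open>S\<close> of size \<open>p\<close> is cut along the blocks. Its profile has
  an affordable split, each block family has a member inside the trace of \<open>S\<close>, and the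
  union of these members lies in \<open>S\<close>, so it avoids the padding and was printed.\<close>

lemma out_ok_family:
  assumes out: "out_ok (family W) s"
    and cov: "\<forall>k<(b + 1) ^ m. covered W (dg k)"
  shows "\<exists>\<C>. lists_family (ot s) \<C> \<and> set_inclusion_family {1..n} n p q \<C> \<and> card \<C> \<le> length (ot s)"
proof -
  obtain Ys where Ys: "ot s = concat (map (\<lambda>Y. Y @ [0]) Ys)"
    "\<forall>Y\<in>set Ys. distinct Y \<and> 0 \<notin> set Y \<and> set Y \<subseteq> {1..n} \<and> card (set Y) = q" "family W \<subseteq> set ` set Ys"
    using out unfolding out_ok_def by blast
  have len: "length Ys \<le> length (concat (map (\<lambda>Y. Y @ [0::nat]) Ys))" by (induction Ys) auto
  have "card (set ` set Ys) \<le> length Ys"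
    using card_image_le[of "set Ys" set] card_length[of Ys] by simp
  then have card: "card (set ` set Ys) \<le> length (ot s)" using len Ys(1) by simp
  have cover: "\<exists>Y\<in>set ` set Ys. Y \<subseteq> S" if S: "S \<subseteq> {1..n}" "card S = p" for S
  proof -
    let ?S = "\<lambda>i. {x. x < b \<and> i * b + x + 1 \<in> S}"
    define pv where "pv i = card (?S i)" for i
    have pvb: "pv i \<le> b" for i
      unfolding pv_def using card_mono[of "{..<b}" "?S i"] by auto
    have "S = place b m ?S" using place_blocks[OF S(1) n_le] by simp
    moreover have "card (place b m ?S) = (\<Sum>i<m. pv i)" unfolding pv_def by (rule card_place) auto
    ultimately have sum: "(\<Sum>i<m. pv i) = p" using S(2) by simp
    have "pv i < b + 1" for i using pvb[of i] by simp
    then obtain k where k: "k < (\<Prod>j<m. b + 1)" "\<forall>i<m. dg k i = pv i"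
      using digit_surj[of m pv "\<lambda>_. b + 1"] by blast
    have km: "k < (b + 1) ^ m" using k(1) by simp
    have sumk: "(\<Sum>i<m. dg k i) = p" using k(2) sum by simp
    then obtain l where l: "l < (b + 1) ^ m" "split (dg k) (dg l)" "cost (dg k) (dg l) \<le> W"
      using cov km unfolding covered_def by blast
    have "\<exists>w. w < length (Fam (dg k i) (dg l i)) \<and> set_decode (Fam (dg k i) (dg l i) ! w) \<subseteq> ?S i" if i: "i < m" for i
    proof -
      have e: "set_decode (set_encode (?S i)) = ?S i" by simp
      have "set_encode (?S i) < 2 ^ b" by (intro set_encode_less) auto
      moreover have "card (set_decode (set_encode (?S i))) = dg k i" using k(2) i by (simp add: pv_def)
      moreover have "dg l i \<le> dg k i" using l(2) i by (simp add: split_def)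
      moreover have "block_family b (dg k i) (dg l i) (Fam (dg k i) (dg l i))" by (intro Fam dg_le)
      ultimately have "\<exists>Y\<in>set (Fam (dg k i) (dg l i)). set_decode Y \<subseteq> set_decode (set_encode (?S i))"
        unfolding block_family_def by blast
      then obtain Y where Y: "Y \<in> set (Fam (dg k i) (dg l i))" "set_decode Y \<subseteq> ?S i"
        unfolding e by (rule bexE)
      from Y(1) obtain j where "j < length (Fam (dg k i) (dg l i))" "Fam (dg k i) (dg l i) ! j = Y"
        unfolding in_set_conv_nth by blast
      then show ?thesis using Y(2) by (intro exI[of _ j]) simp
    qed
    then have "\<forall>i\<in>{..<m}. \<exists>w. w < length (Fam (dg k i) (dg l i)) \<and>
        set_decode (Fam (dg k i) (dg l i) ! w) \<subseteq> ?S i" by simp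
    from bchoice[OF this] obtain w where w: "\<And>i. i < m \<Longrightarrow> w i < length (Fam (dg k i) (dg l i)) \<and>
        set_decode (Fam (dg k i) (dg l i) ! w i) \<subseteq> ?S i" by auto
    have sub: "wset (dg k) (dg l) w \<subseteq> S"
      using w unfolding wset_def place_def by blast
    then have "wset (dg k) (dg l) w \<in> wsets (dg k) (dg l)"
      unfolding wsets_def using w S(1) by blast
    moreover have "l \<in> {l. l < (b + 1) ^ m \<and> split (dg k) (dg l) \<and> cost (dg k) (dg l) \<le> W \<and>
        \<not> (\<Sum>i<m. dg k i) < p}" using l sumk by simp
    ultimately have "wset (dg k) (dg l) w \<in> family W" unfolding family_def using km by (intro UN_I[of k] UN_I[of l]) simp_all
    with Ys(3) have "wset (dg k) (dg l) w \<in> set ` set Ys" by (rule subsetD)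
    with sub show ?thesis by (rule bexI)
  qed
  have "set ` set Ys \<subseteq> {Y. Y \<subseteq> {1..n} \<and> card Y = q}" using Ys(2) by (intro image_subsetI CollectI) simp
  then have "set_inclusion_family {1..n} n p q (set ` set Ys)"
    unfolding set_inclusion_family_def using qp pn cover by (intro conjI allI impI) simp_all
  moreover have "lists_family (ot s) (set ` set Ys)"
    unfolding lists_family_def using Ys by blast
  ultimately show ?thesis using card by blast
qed

end

definition Prepare :: com where
  "Prepare = Bits ;; Tables ;; Find"

text \<open>The stages are cut where caps receive their values: within every stage other than the
  two powers no cap is assigned, and the static bound applies.\<close>

definition Main :: com where
  "Main = Size ;; Caps ;; Count ;; Pow 7 4 6 ;; Prepare ;; Pow 11 9 10 ;; Show"

lemmas Main_defs = Main_def Prepare_def Size_def Caps_def Count_def Pow_def Bits_def Tables_def Find_def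
  Show_def Neq_def Rel_def Cover_def Mark_def Append_def Try_def Greedy_def Eval_def Probe_def Word_def
  Trav_def Check_def Emit_def Words_def AddTo_def Idx_def Odo_inc_def Odo_def

lemma wf_Main: "wf Main"
  by (simp add: Main_defs)

text \<open>Depth 8 is reached in \<open>Tables\<close>: loops over \<open>P\<close>,
  \<open>Q\<close>, threshold, member, set and bit, and two for index arithmetic. Depth at most 1
  for \<open>h\<close> makes the bound linear in \<open>Z\<close>.\<close>

lemma steps_stage:
  assumes "caps c \<inter> modv c = {}" "\<And>z. z \<in> caps c \<Longrightarrow> z \<noteq> h \<Longrightarrow> vr s z \<le> X" "h \<in> caps c \<Longrightarrow> vr s h \<le> Z"
    "csize c \<le> 500" "depth (- {h}) c \<le> 8" "depth {h} c \<le> 1"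
  shows "steps c s \<le> 500 * ((X + 1) ^ 8 * (Z + 1))"
proof -
  have "steps c s \<le> csize c * ((X + 1) ^ depth (- {h}) c * (Z + 1) ^ depth {h} c)"
    using assms by (intro steps_le) auto
  also have "\<dots> \<le> 500 * ((X + 1) ^ 8 * (Z + 1) ^ 1)"
    using assms by (intro mult_le_mono power_increasing) auto
  finally show ?thesis by simp
qed

lemma main_family:
  assumes "q \<le> p" "p \<le> n"
  defines "s \<equiv> start_state [n, p, q]"
  shows "\<exists>\<C> b m W. blocks n p q b m \<and> lists_family (ot (sem Main s)) \<C> \<and> set_inclusion_family {1..n} n p q \<C> \<and>
    card \<C> \<le> steps Main s \<and> 2 ^ W \<le> kappa n p q * blocks.excess n b m \<and>
    steps Main s \<le> 3500 * ((2 ^ b * 2 ^ b * (b + 1) ^ m + 1) ^ 8 * (2 ^ W + 1))"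
proof -
  have s: "vr s 0 = n" "vr s 1 = p" "vr s 2 = q" "ot s = []"
    by (simp_all add: s_def start_state_def init_regs_def)
  define s1 where "s1 = sem Size s"
  obtain b where b: "vr s1 3 = b" "vr s1 5 = 2 ^ b" "n < 2 ^ b" "b = 0 \<or> 2 ^ b \<le> 2 * n"
    using sem_Size[OF s(1)] unfolding s1_def by blast
  have f1: "vr s1 0 = n" "vr s1 1 = p" "vr s1 2 = q" "ot s1 = []"
    using s by (simp_all add: s1_def vr_frame ot_frame)
  define s2 where "s2 = sem Caps s1"
  have f2: "vr s2 0 = n" "vr s2 1 = p" "vr s2 2 = q" "ot s2 = []" "vr s2 3 = b" "vr s2 5 = 2 ^ b"
    "vr s2 4 = b + 1" "vr s2 9 = 2" "vr s2 8 = 2 ^ b * 2 ^ b"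
    using f1 b sem_Caps[of s1] by (simp_all add: s2_def vr_frame ot_frame)
  define s3 where "s3 = sem Count s2"
  have N: "b < 2 ^ b" by (rule less_exp)
  moreover have "(2::nat) ^ b \<le> 2 ^ b * 2 ^ b" by simp
  ultimately have "b \<le> 2 ^ b * 2 ^ b" by linarith
  moreover have "1 \<le> b \<or> n = 0" using b(3) by (cases b) auto
  ultimately obtain m where m: "vr s3 6 = m" "n \<le> m * b" "m * b \<le> n + b" "m \<le> n"
    using sem_Count[of s2 n b] f2 unfolding s3_def by auto
  have f3: "vr s3 0 = n" "vr s3 1 = p" "vr s3 2 = q" "ot s3 = []" "vr s3 3 = b" "vr s3 5 = 2 ^ b"
    "vr s3 4 = b + 1" "vr s3 9 = 2" "vr s3 8 = 2 ^ b * 2 ^ b"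
    using f2 by (simp_all add: s3_def vr_frame ot_frame)
  interpret blocks n p q b m by unfold_locales (use assms b m in auto)
  define s4 where "s4 = sem (Pow 7 4 6) s3"
  have "vr s4 7 = (b + 1) ^ m" unfolding s4_def using f3 m by (subst sem_Pow) auto
  then have regs4: "regs s4" unfolding regs_def using f3 m by (simp add: s4_def vr_frame big_def)
  define s5 where "s5 = sem Bits s4"
  have env5: "env s5" unfolding s5_def using regs4 by (rule sem_Bits)
  define s6 where "s6 = sem Tables s5"
  obtain Fam where entries: "\<forall>P\<le>b. \<forall>Q\<le>b. entry s6 P Q (Fam P Q)"
    using sem_Tables[OF env5] unfolding s6_def by blast
  define c where "c P Q = ar s6 4 (P * (b + 1) + Q)" for P Q
  interpret tables n p q b m Fam c
    by unfold_locales (use entries in \<open>auto simp: entry_def c_def\<close>)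
  have "env s6" unfolding s6_def using env5 by (rule env_sem) auto
  moreover have "ar s6 3 (P * (b + 1) + Q) = length (Fam P Q) \<and> ar s6 4 (P * (b + 1) + Q) = c P Q \<and>
      stored (P * (b + 1) + Q) (Fam P Q) s6" if "P \<le> b" "Q \<le> b" for P Q
    using entries[rule_format, OF that] unfolding entry_def c_def by blast
  ultimately have tabs6: "tabs s6" unfolding tabs_def by (intro conjI allI impI) simp_all
  define s7 where "s7 = sem Find s6"
  define W where "W = vr s7 10"
  \<comment> \<open>The search starts from threshold 0, so the bound handed to it must be at least
    1.\<close>
  have "1 \<le> (2 * (real b + 1)) ^ m" by (rule one_le_power) simp
  moreover have "1 \<le> real ((n + b + 1) ^ b)" by simp
  ultimately have "1 * 1 \<le> excess" unfolding excess_def by (rule mult_mono) auto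
  then have "1 * 1 \<le> kappa n p q * excess"
    using kappa_ge_1[OF assms(1,2)] by (intro mult_mono) auto
  then have B: "1 \<le> kappa n p q * excess" by simp
  have "\<exists>l<(b + 1) ^ m. split (dg k) (dg l) \<and> 2 ^ cost (dg k) (dg l) \<le> kappa n p q * excess"
    if "\<not> (\<Sum>i<m. dg k i) < p" for k
    by (rule exists_split[OF dg_le]) (use that in simp)
  note W = sem_Find[OF tabs6 this B, folded s7_def, folded W_def]
  have tabs7: "tabs s7" by (rule tabs_frame[OF tabs6]) (auto simp: s7_def intro!: vr_frame ar_frame)
  define s8 where "s8 = sem (Pow 11 9 10) s7"
  have v9: "vr s7 9 = 2" using tabs7 by (simp add: tabs_def env_def regs_def)
  have 11: "vr s8 11 = 2 ^ W" unfolding s8_def W_def using v9 by (subst sem_Pow) auto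
  have 10: "vr s8 10 = W" by (simp add: s8_def W_def vr_frame)
  have tabs8: "tabs s8" by (rule tabs_frame[OF tabs7]) (auto simp: s8_def intro!: vr_frame ar_frame)
  have "ot s8 = []" using f3 by (simp add: s8_def s7_def s6_def s5_def s4_def ot_frame)
  from sem_Show[OF tabs8 _ this] 10 11
  have "out_ok (family W) (sem Show s8)" by simp
  from out_ok_family[OF this W(3)] obtain \<C> where \<C>: "lists_family (ot (sem Show s8)) \<C>"
    "set_inclusion_family {1..n} n p q \<C>" "card \<C> \<le> length (ot (sem Show s8))" by blast
  have main: "sem Main s = sem Show s8"
    by (simp add: Main_def Prepare_def s8_def s7_def s6_def s5_def s4_def s3_def s2_def s1_def)
  \<comment> \<open>\<open>X\<close> dominates all caps of the statically bounded stages except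
    variable 11, whose value \<open>2 ^ W\<close> is treated separately.\<close>
  define X where "X = big * (b + 1) ^ m"
  have "big \<le> X" "(b + 1) ^ m \<le> X" unfolding X_def using big_ge(6) by auto
  then have X: "n \<le> X" "b \<le> X" "b + 1 \<le> X" "2 ^ b \<le> X" "m \<le> X" "(b + 1) ^ m \<le> X" "big \<le> X"
    using big_ge n_less by linarith+
  let ?T = "500 * ((X + 1) ^ 8 * (2 ^ W + 1))"
  have lift: "t \<le> ?T" if "t \<le> 500 * (X + 1) ^ 8" for t
    by (rule le_trans[OF that]) simp
  have r4: "vr s4 3 = b" "vr s4 4 = b + 1" "vr s4 5 = 2 ^ b" "vr s4 6 = m" "vr s4 7 = (b + 1) ^ m" "vr s4 8 = big"
    using regs4 by (auto simp: regs_def)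
  have r8: "vr s8 3 = b" "vr s8 4 = b + 1" "vr s8 5 = 2 ^ b" "vr s8 6 = m" "vr s8 7 = (b + 1) ^ m" "vr s8 8 = big"
    using tabs8 by (auto simp: tabs_def env_def regs_def)
  have t1: "steps Size s \<le> ?T"
    by (rule steps_stage[where h = 11]) (use s X in \<open>auto simp: Main_defs\<close>)
  have t2: "steps Caps s1 \<le> ?T"
    by (rule steps_stage[where h = 11]) (use b X in \<open>auto simp: Main_defs\<close>)
  have t3: "steps Count s2 \<le> ?T"
    by (rule steps_stage[where h = 11]) (use f2 X in \<open>auto simp: Main_defs big_def\<close>)
  have "steps (Pow 7 4 6) s3 \<le> 10 * (m + 1) * (b + 1 + 1) * ((b + 1) ^ m + 1)"
    using sem_Pow(2)[of 7 4 6 s3] f3 m by simp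
  also have "\<dots> \<le> 10 * (X + 1) * (X + 1) * (X + 1)"
    using X by (intro mult_le_mono) auto
  also have "\<dots> = 10 * (X + 1) ^ 3" by (simp only: power3_eq_cube mult.assoc)
  also have "\<dots> \<le> 500 * (X + 1) ^ 8" by (intro mult_le_mono power_increasing) auto
  finally have t4: "steps (Pow 7 4 6) s3 \<le> ?T" by (rule lift)
  have t5: "steps Prepare s4 \<le> ?T"
    by (rule steps_stage[where h = 11]) (use r4 X in \<open>auto simp: Main_defs\<close>)
  have "steps (Pow 11 9 10) s7 \<le> 10 * (W + 1) * 3 * (2 ^ W + 1)"
    using sem_Pow(2)[of 11 9 10 s7] v9 by (simp add: W_def)
  also have "\<dots> \<le> 10 * (X + 1) * 3 * (2 ^ W + 1)"
    using W(2) X(7) by (intro mult_le_mono) auto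
  also have "\<dots> = 30 * ((X + 1) ^ 1 * (2 ^ W + 1))" by (simp add: algebra_simps)
  also have "\<dots> \<le> ?T" by (intro mult_le_mono power_increasing) auto
  finally have t6: "steps (Pow 11 9 10) s7 \<le> ?T" .
  have t7: "steps Show s8 \<le> ?T"
    by (rule steps_stage[where h = 11]) (use r8 11 X in \<open>auto simp: Main_defs\<close>)
  have "steps Main s = steps Size s + steps Caps s1 + steps Count s2 + steps (Pow 7 4 6) s3 + steps Prepare s4 +
      steps (Pow 11 9 10) s7 + steps Show s8"
    by (simp add: Main_def Prepare_def s8_def s7_def s6_def s5_def s4_def s3_def s2_def s1_def)
  also have "\<dots> \<le> 7 * ?T" using t1 t2 t3 t4 t5 t6 t7 by linarith
  finally have steps: "steps Main s \<le> 3500 * ((X + 1) ^ 8 * (2 ^ W + 1))" by simp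
  have "card \<C> \<le> steps Main s"
    using \<C>(3) length_ot_le_steps[of Main s] s(4) main by simp
  then show ?thesis
    using \<C> W(1) steps blocks_axioms unfolding main[symmetric] X_def big_def by blast
qed

section \<open>Running time\<close>

definition block_bound :: "real \<Rightarrow> real" where
  "block_bound x = log 2 (2 * x + 2)"

text \<open>Bounds \<open>m\<close>, by \<open>m * b \<le> n + b\<close> and
  \<open>log 2 (n + 1) \<le> b\<close>.\<close>

definition count_bound :: "real \<Rightarrow> real" where
  "count_bound x = x / log 2 (x + 1) + 1"

text \<open>The summands stem from the constant \<open>2 ^ 21\<close>, from the eighth power of
  \<open>4 ^ b\<close>, from \<open>m\<close> roundings with nine factors \<open>(b + 1) ^ m\<close>
  (eight from the loops, one from greedy cover), and from the padding.\<close>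

definition step_exponent :: "real \<Rightarrow> real" where
  "step_exponent x = 21 + 16 * block_bound x + count_bound x * (1 + 9 * log 2 (block_bound x + 1)) +
     block_bound x * log 2 (x + block_bound x + 1)"

text \<open>The second summand is the price of an instruction: the bracket
  \<open>x + 9 + step_exponent x\<close> bounds bit lengths, and 18 is the factor 9 for
  \<open>8 * S + 1\<close> with \<open>S\<close> steps times the factor 2 in the instruction
  cost.\<close>

definition time_exponent :: "real \<Rightarrow> real" where
  "time_exponent x = step_exponent x + log 2 (18 * (x + 9 + step_exponent x))"

text \<open>The dominating term is of order \<open>n * log log n / log n\<close>.\<close>

lemma time_exponent_smallo: "(\<lambda>n. time_exponent (real n)) \<in> o(\<lambda>n. real n)"
  unfolding time_exponent_def step_exponent_def block_bound_def count_bound_def by real_asymp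

lemma step_exponent_ge: "n \<ge> 0 \<Longrightarrow> 21 \<le> step_exponent n"
proof -
  assume n: "n \<ge> 0"
  have b: "1 \<le> block_bound n" using n by (simp add: block_bound_def le_log_iff)
  moreover have "1 \<le> count_bound n" using n by (simp add: count_bound_def)
  moreover have "0 \<le> log 2 (block_bound n + 1)" "0 \<le> log 2 (n + block_bound n + 1)"
    using b n by auto
  ultimately show ?thesis unfolding step_exponent_def by (simp add: add_nonneg_nonneg)
qed

lemma (in blocks) steps_exponent_le:
  "2 ^ 21 * real (2 ^ b * 2 ^ b * (b + 1) ^ m) ^ 8 * excess \<le> 2 powr step_exponent n"
proof -
  let ?B = "block_bound n" and ?M = "count_bound n"
  have b: "real b \<le> ?B"
    using b_small
  proof
    assume "2 ^ b \<le> 2 * n"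
    then have "(2::real) ^ b \<le> 2 * real n" by (metis of_nat_le_iff of_nat_mult of_nat_numeral of_nat_power)
    then show ?thesis unfolding block_bound_def by (intro le_log_of_power) auto
  qed (simp add: block_bound_def)
  have m: "real m \<le> ?M"
  proof (cases "n = 0")
    case False
    have "real n + 1 \<le> 2 ^ b" using n_less by (metis Suc_leI of_nat_Suc of_nat_le_iff of_nat_numeral of_nat_power add.commute)
    then have "log 2 (real n + 1) \<le> log 2 (2 ^ b)" by (intro log_mono) auto
    then have l: "log 2 (real n + 1) \<le> real b" by (simp add: log_nat_power)
    have pos: "0 < log 2 (real n + 1)" using False by simp
    have "real m * real b \<le> real n + real b" using mb_le by (metis of_nat_add of_nat_le_iff of_nat_mult)
    moreover have b0: "0 < real b" using l pos by linarith
    ultimately have "real m \<le> real n / real b + 1" by (simp add: field_simps)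
    also have "\<dots> \<le> ?M" unfolding count_bound_def
      using l mult_pos_pos[OF b0 pos] by (intro add_mono divide_left_mono) auto
    finally show ?thesis .
  qed (use m_le in \<open>simp add: count_bound_def\<close>)
  have pw: "x ^ k = 2 powr (real k * log 2 x)" if "x > 0" for x :: real and k
    using that by (simp add: powr_realpow[symmetric] powr_def log_def)
  define y where "y = real b + 1"
  have "real (2 ^ b * 2 ^ b * (b + 1) ^ m) = 2 ^ (2 * b) * y ^ m"
    by (simp add: y_def power_add mult_2 add.commute)
  then have 1: "real (2 ^ b * 2 ^ b * (b + 1) ^ m) ^ 8 = 2 ^ (16 * b) * y ^ (8 * m)"
    by (simp add: power_mult_distrib mult.commute flip: power_mult)
  have 2: "excess = 2 ^ m * y ^ m * (real n + real b + 1) ^ b"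
    unfolding excess_def y_def
    by (simp only: power_mult_distrib of_nat_power of_nat_add of_nat_1)
  have 3: "y ^ (9 * m) = y ^ (8 * m) * y ^ m" by (simp flip: power_add)
  have "2 ^ 21 * real (2 ^ b * 2 ^ b * (b + 1) ^ m) ^ 8 * excess =
      2 ^ 21 * (2 ^ (16 * b) * (2 ^ m * (y ^ (9 * m) * (real n + real b + 1) ^ b)))"
    unfolding 1 2 3 by (simp only: mult_ac)
  also have "\<dots> = 2 powr (21 + (16 * real b + (real m + (9 * real m * log 2 (real b + 1) +
      real b * log 2 (real n + real b + 1)))))"
  proof -
    have "(2::real) ^ 21 = 2 powr 21" "(2::real) ^ (16 * b) = 2 powr (16 * real b)"
      "(2::real) ^ m = 2 powr real m" "y ^ (9 * m) = 2 powr (9 * real m * log 2 (real b + 1))"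
      "(real n + real b + 1) ^ b = 2 powr (real b * log 2 (real n + real b + 1))"
      using pw[of 2 21] pw[of 2 "16 * b"] pw[of 2 m] pw[of y "9 * m"] pw[of "real n + real b + 1" b]
      by (simp_all add: y_def)
    then show ?thesis by (simp only: powr_add)
  qed
  also have "\<dots> \<le> 2 powr step_exponent n"
  proof (intro powr_mono)
    have "log 2 (real b + 1) \<le> log 2 (?B + 1)" "log 2 (real n + real b + 1) \<le> log 2 (real n + ?B + 1)"
      using b by (auto intro!: log_mono)
    then have "real m * (1 + 9 * log 2 (real b + 1)) \<le> ?M * (1 + 9 * log 2 (?B + 1))"
      "real b * log 2 (real n + real b + 1) \<le> ?B * log 2 (real n + ?B + 1)"
      using b m by (auto intro!: mult_mono)
    then show "21 + (16 * real b + (real m + (9 * real m * log 2 (real b + 1) +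
      real b * log 2 (real n + real b + 1)))) \<le> step_exponent n"
      unfolding step_exponent_def using b by (simp add: algebra_simps)
  qed simp
  finally show ?thesis .
qed

lemma bits_le_log: "x \<ge> 1 \<Longrightarrow> real (bits x) \<le> log 2 (real x) + 1"
  unfolding bits_def floorlog_def by (auto simp: max_def)

text \<open>Crude, but it enters only through the bit length of the numbers that occur.\<close>

lemma kappa_le_pow2: "q \<le> p \<Longrightarrow> kappa n p q \<le> 2 powr real n"
proof -
  assume "q \<le> p"
  then have pos: "0 < p choose q" by simp
  then have "1 \<le> real (p choose q)" by linarith
  then have "kappa n p q \<le> real (n choose q)" unfolding kappa_def
    using divide_left_mono[of 1 "real (p choose q)" "real (n choose q)"] pos by simp
  also have "\<dots> \<le> real (2 ^ n)" using binomial_le_pow2[of n q] by (simp only: of_nat_le_iff)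
  finally show ?thesis by (simp add: powr_realpow)
qed

theorem theorem6:
  "\<exists>(P :: ram) (f :: nat \<Rightarrow> real) (g :: nat \<Rightarrow> real).
     f \<in> o(\<lambda>n. real n) \<and> g \<in> o(\<lambda>n. real n) \<and>
     (\<forall>n p q :: nat. q \<le> p \<and> p \<le> n \<longrightarrow>
        (\<exists>out t \<C>. ram_outputs P [n, p, q] out t \<and>
           lists_family out \<C> \<and>
           set_inclusion_family {1..n} n p q \<C> \<and>
           real (card \<C>) \<le> kappa n p q * 2 powr f n \<and>
           real t \<le> kappa n p q * 2 powr g n))"
proof (rule exI[of _ "program Main"], rule exI[of _ "\<lambda>n. time_exponent (real n)"],
    rule exI[of _ "\<lambda>n. time_exponent (real n)"], intro conjI allI impI)
  show "(\<lambda>n. time_exponent (real n)) \<in> o(\<lambda>n. real n)" "(\<lambda>n. time_exponent (real n)) \<in> o(\<lambda>n. real n)"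
    by (rule time_exponent_smallo)+
  fix n p q :: nat assume "q \<le> p \<and> p \<le> n"
  then have pq: "q \<le> p" "p \<le> n" by auto
  let ?s = "start_state [n, p, q]" and ?\<kappa> = "kappa n p q"
  obtain \<C> b m W where blocks: "blocks n p q b m" and \<C>: "lists_family (ot (sem Main ?s)) \<C>"
    "set_inclusion_family {1..n} n p q \<C>" "card \<C> \<le> steps Main ?s"
    and W: "2 ^ W \<le> ?\<kappa> * blocks.excess n b m"
    and steps: "steps Main ?s \<le> 3500 * ((2 ^ b * 2 ^ b * (b + 1) ^ m + 1) ^ 8 * (2 ^ W + 1))"
    using main_family[OF pq] by blast
  interpret blocks n p q b m by (rule blocks)
  define S where "S = steps Main ?s"
  define h where "h = step_exponent (real n)"
  define X where "X = 2 ^ b * 2 ^ b * (b + 1) ^ m"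
  have X: "1 \<le> X" by (simp add: X_def)
  have h: "21 \<le> h" unfolding h_def by (rule step_exponent_ge) simp
  have \<kappa>: "1 \<le> ?\<kappa>" using pq by (rule kappa_ge_1)
  have "S \<le> 3500 * ((X + 1) ^ 8 * (2 ^ W + 1))" using steps by (simp add: S_def X_def)
  also have "\<dots> \<le> 3500 * ((2 * X) ^ 8 * (2 * 2 ^ W))"
    using X by (intro mult_le_mono power_mono) auto
  \<comment> \<open>The origin of the exponent 21: \<open>3500 * 2 ^ 9 \<le> 2 ^ 21\<close>.\<close>
  also have "\<dots> \<le> 2 ^ 21 * X ^ 8 * 2 ^ W" by (simp add: power_mult_distrib)
  finally have "real S \<le> real (2 ^ 21 * X ^ 8 * 2 ^ W)" by (simp only: of_nat_le_iff)
  also have "\<dots> = 2 ^ 21 * real X ^ 8 * 2 ^ W" by simp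
  also have "\<dots> \<le> 2 ^ 21 * real X ^ 8 * (?\<kappa> * excess)" by (intro mult_left_mono W) auto
  also have "\<dots> = ?\<kappa> * (2 ^ 21 * real X ^ 8 * excess)" by (simp only: mult_ac)
  also have "\<dots> \<le> ?\<kappa> * 2 powr h"
    using steps_exponent_le \<kappa> unfolding h_def X_def by (intro mult_left_mono) auto
  finally have S: "real S \<le> ?\<kappa> * 2 powr h" .
  have "1 \<le> 2 powr h" using h by (intro ge_one_powr_ge_zero) auto
  then have \<kappa>h: "1 \<le> ?\<kappa> * 2 powr h" using \<kappa> mult_mono[of 1 ?\<kappa> 1 "2 powr h"] by simp
  have time: "2 powr time_exponent n = 2 powr h * (18 * (real n + 9 + h))"
    using h unfolding time_exponent_def h_def[symmetric] by (simp add: powr_add)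
  obtain t where t: "ram_outputs (program Main) [n, p, q] (ot (sem Main ?s)) t"
    "t \<le> (8 * S + 1) * (2 * bits (16 * (n + S) + 100))"
    using program_outputs[OF wf_Main, of "[n, p, q]" n] pq unfolding S_def by auto
  have "?\<kappa> * 2 powr h \<le> 2 powr n * 2 powr h" using pq by (intro mult_right_mono kappa_le_pow2) auto
  then have "real S \<le> 2 powr (n + h)" using S unfolding powr_add by linarith
  moreover have "real n \<le> 2 powr (n + h)"
  proof -
    have "real n \<le> 2 powr real n" using of_nat_mono[OF less_imp_le[OF less_exp[of n]], where 'a = real] by (simp add: powr_realpow)
    also have "\<dots> \<le> 2 powr (n + h)" using h by (intro powr_mono) auto
    finally show ?thesis .
  qed
  moreover have "1 \<le> 2 powr (n + h)" using h by (intro ge_one_powr_ge_zero) auto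
  \<comment> \<open>Here \<open>16 + 16 + 100 \<le> 2 ^ 8\<close>; the 9 in the bit length is this 8
    plus the rounding in \<open>bits_le_log\<close>.\<close>
  ultimately have "real (16 * (n + S) + 100) \<le> 2 ^ 8 * 2 powr (n + h)" by simp
  also have "\<dots> = 2 powr (8 + (n + h))" by (simp add: powr_add)
  finally have "log 2 (real (16 * (n + S) + 100)) \<le> log 2 (2 powr (8 + (n + h)))"
    by (intro log_mono) auto
  then have bits: "real (bits (16 * (n + S) + 100)) \<le> real n + 9 + h"
    using bits_le_log[of "16 * (n + S) + 100"] by simp
  have "real t \<le> real ((8 * S + 1) * (2 * bits (16 * (n + S) + 100)))" using t(2) by (simp only: of_nat_le_iff)
  also have "\<dots> = (8 * real S + 1) * (2 * real (bits (16 * (n + S) + 100)))"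
    by (simp only: of_nat_mult of_nat_add of_nat_numeral of_nat_1)
  also have "\<dots> \<le> (9 * (?\<kappa> * 2 powr h)) * (2 * (real n + 9 + h))"
    using S \<kappa>h bits h by (intro mult_mono) auto
  also have "\<dots> = ?\<kappa> * 2 powr time_exponent n" unfolding time by simp
  finally have tt: "real t \<le> ?\<kappa> * 2 powr time_exponent n" .
  have "real (card \<C>) \<le> ?\<kappa> * 2 powr h" using \<C>(3) S unfolding S_def by linarith
  also have "\<dots> \<le> ?\<kappa> * 2 powr time_exponent n"
    unfolding time using h \<kappa> by (intro mult_left_mono) auto
  finally have cc: "real (card \<C>) \<le> ?\<kappa> * 2 powr time_exponent n" .
  show "\<exists>out t \<C>. ram_outputs (program Main) [n, p, q] out t \<and> lists_family out \<C> \<and>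
      set_inclusion_family {1..n} n p q \<C> \<and> real (card \<C>) \<le> ?\<kappa> * 2 powr time_exponent n \<and>
      real t \<le> ?\<kappa> * 2 powr time_exponent n"
    using t(1) \<C>(1,2) cc tt by blast
qed

end
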